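(* Let $G$ be a finite group, and let $\omega$ be a central weight on $\widehat G$ with symmetrization $\Omega$. Then $A(G,\omega)$ is operator amenable with operator amenability constant $$\frac{\sum_{\pi\in\widehat G}d_\pi^2\,\Omega(\pi)}{\sum_{\pi\in\widehat G}d_\pi^2}.$$
   Context: $\widehat G$ is the set of equivalence classes of irreducible unitary representations of $G$; $d_\pi=\dim\pi$; $\overline\pi$ is the conjugate of $\pi$; $\widehat f(\pi)=\int_Gf(t)\overline\pi(t)\,dt$ (normalized Haar measure); $\|\cdot\|_1$ is the trace-class norm; $\operatorname{supp}\rho$ is the set of irreducible representations occurring in a finite-dimensional representation $\rho$. A central weight on $\widehat G$ is a function $\omega:\widehat G\to(\delta,\infty)$, some $\delta>0$, with $\omega(\sigma)\le\omega(\pi)\omega(\pi')$ whenever $\sigma\in\operatorname{supp}(\pi\otimes\pi')$; its symmetrization is $\Omega(\pi)=\omega(\pi)\omega(\overline\pi)$. $A(G,\omega)=\{f\in C(G):\sum_\pi d_\pi\omega(\pi)\|\widehat f(\pi)\|_1<\infty\}$ with this sum as norm, pointwise multiplication, and the operator space structure for which $f\mapsto\phi$, $\widehat\phi(\pi)=\omega(\pi)\widehat f(\pi)$, is a complete isometry onto the Fourier algebra $A(G)=VN(G)_*$; it is a completely contractive Banach algebra. A completely contractive Banach algebra $A$ is operator amenable if it has a virtual diagonal, i.e. $M\in(A\widehat\otimes A)^{**}$ ($\widehat\otimes$ the operator space projective tensor product) with $a\cdot M=M\cdot a$ and $a\,m^{**}(M)=m^{**}(M)a=a$ for all $a\in A$,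 $m$ being the multiplication map; it is $K$-operator amenable if $M$ can be chosen with $\|M\|=K$, and the operator amenability constant is the smallest such $K$. *)

theory Defs
  imports "Jordan_Normal_Form.Schur_Decomposition" "HOL-Analysis.Infinite_Sum"
begin

section \<open>Matrices\<close>

text \<open>The norm of a complex matrix as an operator between the Hilbert spaces
  of column vectors.\<close>

definition vec_l2 :: "complex vec \<Rightarrow> real" where
  "vec_l2 v = sqrt (\<Sum>i<dim_vec v. (cmod (v $ i))\<^sup>2)"

definition mat_opnorm :: "complex mat \<Rightarrow> real" where
  "mat_opnorm A = Sup {vec_l2 (A *\<^sub>v v) | v. v \<in> carrier_vec (dim_col A) \<and> vec_l2 v \<le> 1}"

definition psd_mat :: "nat \<Rightarrow> complex mat \<Rightarrow> bool" where
  "psd_mat n P \<longleftrightarrow> P \<in> carrier_mat n n \<and>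
     (\<forall>v\<in>carrier_vec n. Im ((P *\<^sub>v v) \<bullet>c v) = 0 \<and> Re ((P *\<^sub>v v) \<bullet>c v) \<ge> 0)"

definition mat_modulus :: "complex mat \<Rightarrow> complex mat" where
  "mat_modulus A = (THE P. psd_mat (dim_col A) P \<and> P * P = mat_adjoint A * A)"

definition trace_norm :: "complex mat \<Rightarrow> real" where
  "trace_norm A = Re (\<Sum>i<dim_col A. mat_modulus A $$ (i, i))"

text \<open>Kronecker product with respect to an arbitrary product of the entries. The pair of row
  indices \<open>(i, k)\<close> is encoded as \<open>i * dim_row B + k\<close>, and similarly for columns.\<close>

definition kron_with :: "('a \<Rightarrow> 'b \<Rightarrow> 'c) \<Rightarrow> 'a mat \<Rightarrow> 'b mat \<Rightarrow> 'c mat" where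
  "kron_with p A B = mat (dim_row A * dim_row B) (dim_col A * dim_col B)
     (\<lambda>(i, j). p (A $$ (i div dim_row B, j div dim_col B)) (B $$ (i mod dim_row B, j mod dim_col B)))"

section \<open>Unitary representations and the dual of a finite group\<close>

text \<open>A finite-dimensional representation is given by a matrix-valued function; its values
  outside \<open>carrier G\<close> are irrelevant.\<close>

type_synonym 'a rep = "'a \<Rightarrow> complex mat"

definition rep_deg :: "('a, 'm) monoid_scheme \<Rightarrow> 'a rep \<Rightarrow> nat" where
  "rep_deg G \<rho> = dim_row (\<rho> \<one>\<^bsub>G\<^esub>)"

definition unitary_rep :: "('a, 'm) monoid_scheme \<Rightarrow> 'a rep \<Rightarrow> bool" where
  "unitary_rep G \<rho> \<longleftrightarrow>
     (\<forall>g\<in>carrier G. \<rho> g \<in> carrier_mat (rep_deg G \<rho>) (rep_deg G \<rho>) \<and>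
        mat_adjoint (\<rho> g) * \<rho> g = 1\<^sub>m (rep_deg G \<rho>)) \<and>
     (\<forall>g\<in>carrier G. \<forall>h\<in>carrier G. \<rho> (g \<otimes>\<^bsub>G\<^esub> h) = \<rho> g * \<rho> h)"

definition irreducible_rep :: "('a, 'm) monoid_scheme \<Rightarrow> 'a rep \<Rightarrow> bool" where
  "irreducible_rep G \<rho> \<longleftrightarrow> unitary_rep G \<rho> \<and> rep_deg G \<rho> > 0 \<and>
     (\<forall>W. VectorSpace.subspace class_ring W (module_vec TYPE(complex) (rep_deg G \<rho>)) \<longrightarrow>
          (\<forall>g\<in>carrier G. \<forall>w\<in>W. \<rho> g *\<^sub>v w \<in> W) \<longrightarrow>
          W = {0\<^sub>v (rep_deg G \<rho>)} \<or> W = carrier_vec (rep_deg G \<rho>))"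

definition rep_equiv :: "('a, 'm) monoid_scheme \<Rightarrow> 'a rep \<Rightarrow> 'a rep \<Rightarrow> bool" where
  "rep_equiv G \<rho> \<sigma> \<longleftrightarrow> rep_deg G \<rho> = rep_deg G \<sigma> \<and>
     (\<exists>U\<in>carrier_mat (rep_deg G \<rho>) (rep_deg G \<rho>).
        mat_adjoint U * U = 1\<^sub>m (rep_deg G \<rho>) \<and> (\<forall>g\<in>carrier G. \<sigma> g * U = U * \<rho> g))"

definition irrep_rel :: "('a, 'm) monoid_scheme \<Rightarrow> ('a rep \<times> 'a rep) set" where
  "irrep_rel G = {(\<rho>, \<sigma>). irreducible_rep G \<rho> \<and> irreducible_rep G \<sigma> \<and> rep_equiv G \<rho> \<sigma>}"

definition dual_group :: "('a, 'm) monoid_scheme \<Rightarrow> 'a rep set set" where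
  "dual_group G = {\<rho>. irreducible_rep G \<rho>} // irrep_rel G"

definition some_rep :: "'a rep set \<Rightarrow> 'a rep" where
  "some_rep \<pi> = (SOME \<rho>. \<rho> \<in> \<pi>)"

definition class_deg :: "('a, 'm) monoid_scheme \<Rightarrow> 'a rep set \<Rightarrow> nat" where
  "class_deg G \<pi> = rep_deg G (some_rep \<pi>)"

definition conj_rep :: "'a rep \<Rightarrow> 'a rep" where
  "conj_rep \<rho> = (\<lambda>g. map_mat cnj (\<rho> g))"

definition conj_class :: "('a, 'm) monoid_scheme \<Rightarrow> 'a rep set \<Rightarrow> 'a rep set" where
  "conj_class G \<pi> = irrep_rel G `` (conj_rep ` \<pi>)"

definition tensor_rep :: "'a rep \<Rightarrow> 'a rep \<Rightarrow> 'a rep" where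
  "tensor_rep \<rho> \<sigma> = (\<lambda>g. kron_with (*) (\<rho> g) (\<sigma> g))"

text \<open>The intertwining isometry \<open>V\<close> identifies \<open>\<sigma>\<close> with a subrepresentation of \<open>\<rho>\<close>.\<close>

definition rep_supp :: "('a, 'm) monoid_scheme \<Rightarrow> 'a rep \<Rightarrow> 'a rep set set" where
  "rep_supp G \<rho> = {\<pi> \<in> dual_group G. \<exists>\<sigma>\<in>\<pi>. \<exists>V\<in>carrier_mat (rep_deg G \<rho>) (rep_deg G \<sigma>).
     mat_adjoint V * V = 1\<^sub>m (rep_deg G \<sigma>) \<and> (\<forall>g\<in>carrier G. \<rho> g * V = V * \<sigma> g)}"

definition central_weight :: "('a, 'm) monoid_scheme \<Rightarrow> ('a rep set \<Rightarrow> real) \<Rightarrow> bool" where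
  "central_weight G \<omega> \<longleftrightarrow> (\<exists>\<delta>>0. \<forall>\<pi>\<in>dual_group G. \<omega> \<pi> > \<delta>) \<and>
     (\<forall>\<pi>\<in>dual_group G. \<forall>\<pi>'\<in>dual_group G.
        \<forall>\<sigma>\<in>rep_supp G (tensor_rep (some_rep \<pi>) (some_rep \<pi>')). \<omega> \<sigma> \<le> \<omega> \<pi> * \<omega> \<pi>')"

definition symmetrization ::
    "('a, 'm) monoid_scheme \<Rightarrow> ('a rep set \<Rightarrow> real) \<Rightarrow> 'a rep set \<Rightarrow> real" where
  "symmetrization G \<omega> \<pi> = \<omega> \<pi> * \<omega> (conj_class G \<pi>)"

section \<open>Normed spaces and operator spaces of functions\<close>

text \<open>All vector spaces below are spaces of complex-valued functions on a type \<open>'x\<close> with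
  pointwise operations. In particular the dual of a space of functions on \<open>'x\<close> is a space of
  functions on \<open>'x \<Rightarrow> complex\<close>, where functionals are extended by zero outside the space.\<close>

record 'x fn_space =
  fn_carrier :: "('x \<Rightarrow> complex) set"
  fn_norm :: "('x \<Rightarrow> complex) \<Rightarrow> real"

definition fn_dual :: "'x fn_space \<Rightarrow> ('x \<Rightarrow> complex) fn_space" where
  "fn_dual X = \<lparr>
     fn_carrier = {F. (\<forall>u\<in>fn_carrier X. \<forall>v\<in>fn_carrier X. F (\<lambda>x. u x + v x) = F u + F v) \<and>
        (\<forall>c. \<forall>u\<in>fn_carrier X. F (\<lambda>x. c * u x) = c * F u) \<and>
        (\<exists>C. \<forall>u\<in>fn_carrier X. cmod (F u) \<le> C * fn_norm X u) \<and>
        (\<forall>u. u \<notin> fn_carrier X \<longrightarrow> F u = 0)},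
     fn_norm = (\<lambda>F. Sup {cmod (F u) | u. u \<in> fn_carrier X \<and> fn_norm X u \<le> 1})\<rparr>"

abbreviation fn_bidual :: "'x fn_space \<Rightarrow> (('x \<Rightarrow> complex) \<Rightarrow> complex) fn_space" where
  "fn_bidual X \<equiv> fn_dual (fn_dual X)"

text \<open>Canonical embedding into the bidual, the adjoint \<open>T\<^sup>*\<close> of an operator \<open>T\<close> with domain \<open>X\<close>,
  and the second adjoint of an operator \<open>T\<close> from \<open>X\<close> to \<open>Y\<close>.\<close>

definition fn_embed :: "'x fn_space \<Rightarrow> ('x \<Rightarrow> complex) \<Rightarrow> (('x \<Rightarrow> complex) \<Rightarrow> complex) \<Rightarrow> complex" where
  "fn_embed X u = (\<lambda>F. if F \<in> fn_carrier (fn_dual X) then F u else 0)"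

definition fn_adjoint :: "'x fn_space \<Rightarrow> (('x \<Rightarrow> complex) \<Rightarrow> ('y \<Rightarrow> complex)) \<Rightarrow>
    (('y \<Rightarrow> complex) \<Rightarrow> complex) \<Rightarrow> ('x \<Rightarrow> complex) \<Rightarrow> complex" where
  "fn_adjoint X T F = (\<lambda>u. if u \<in> fn_carrier X then F (T u) else 0)"

definition fn_biadjoint :: "'x fn_space \<Rightarrow> 'y fn_space \<Rightarrow> (('x \<Rightarrow> complex) \<Rightarrow> ('y \<Rightarrow> complex)) \<Rightarrow>
    ((('x \<Rightarrow> complex) \<Rightarrow> complex) \<Rightarrow> complex) \<Rightarrow> (('y \<Rightarrow> complex) \<Rightarrow> complex) \<Rightarrow> complex" where
  "fn_biadjoint X Y T = fn_adjoint (fn_dual Y) (fn_adjoint X T)"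

text \<open>\<open>os_norm V\<close> is meant for square matrices with entries in \<open>os_carrier V\<close>; its restriction
  to matrices of size \<open>n\<close> is the norm of \<open>M\<^sub>n(V)\<close>.\<close>

record 'x op_space =
  os_carrier :: "('x \<Rightarrow> complex) set"
  os_norm :: "('x \<Rightarrow> complex) mat \<Rightarrow> real"

definition os_fn_space :: "'x op_space \<Rightarrow> 'x fn_space" where
  "os_fn_space V = \<lparr>fn_carrier = os_carrier V, fn_norm = (\<lambda>u. os_norm V (mat 1 1 (\<lambda>_. u)))\<rparr>"

definition os_mats :: "'x op_space \<Rightarrow> nat \<Rightarrow> ('x \<Rightarrow> complex) mat set" where
  "os_mats V n = {v \<in> carrier_mat n n. elements_mat v \<subseteq> os_carrier V}"

section \<open>The operator space projective tensor product\<close>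

definition tensor_fun :: "('x \<Rightarrow> complex) \<Rightarrow> ('y \<Rightarrow> complex) \<Rightarrow> 'x \<times> 'y \<Rightarrow> complex" where
  "tensor_fun f g = (\<lambda>(x, y). f x * g y)"

text \<open>The algebraic tensor product of function spaces on \<open>'x\<close> and \<open>'y\<close>, realized (faithfully) as a
  space of functions on \<open>'x \<times> 'y\<close>, with the matrix norms
  \<open>inf {\<parallel>\<alpha>\<parallel> \<parallel>v\<parallel> \<parallel>w\<parallel> \<parallel>\<beta>\<parallel> : u = \<alpha> (v \<otimes> w) \<beta>}\<close>.
  The identity \<open>u = \<alpha> (v \<otimes> w) \<beta>\<close> between matrices of functions is expressed at every point \<open>z\<close>.
  The projective tensor product is the completion of this space; the completion is not taken,
  as it has the same dual and bidual (and is trivial in finite dimensions).\<close>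

definition proj_tensor :: "'x op_space \<Rightarrow> 'y op_space \<Rightarrow> ('x \<times> 'y) op_space" where
  "proj_tensor V W = \<lparr>
     os_carrier = {\<lambda>z. \<Sum>i<n. tensor_fun (f i) (g i) z | (n::nat) f g.
        \<forall>i<n. f i \<in> os_carrier V \<and> g i \<in> os_carrier W},
     os_norm = (\<lambda>u. Inf {mat_opnorm \<alpha> * os_norm V v * os_norm W w * mat_opnorm \<beta> | \<alpha> v w \<beta>.
        \<exists>p q. v \<in> os_mats V p \<and> w \<in> os_mats W q \<and>
          \<alpha> \<in> carrier_mat (dim_row u) (p * q) \<and> \<beta> \<in> carrier_mat (p * q) (dim_col u) \<and>
          (\<forall>z. map_mat (\<lambda>h. h z) u =
            \<alpha> * map_mat (\<lambda>h. h z) (kron_with tensor_fun v w) * \<beta>)})\<rparr>"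

section \<open>Operator amenability\<close>

text \<open>Here \<open>A\<close> is an algebra under pointwise multiplication. On functions of two
  variables the bimodule actions \<open>a \<cdot> (b \<otimes> c) = ab \<otimes> c\<close>, \<open>(b \<otimes> c) \<cdot> a = b \<otimes> ca\<close> and the
  multiplication \<open>b \<otimes> c \<mapsto> bc\<close> take the following form; they are extended to biduals by
  second adjoints.\<close>

definition left_act :: "('x \<Rightarrow> complex) \<Rightarrow> ('x \<times> 'x \<Rightarrow> complex) \<Rightarrow> 'x \<times> 'x \<Rightarrow> complex" where
  "left_act a u = (\<lambda>(x, y). a x * u (x, y))"

definition right_act :: "('x \<Rightarrow> complex) \<Rightarrow> ('x \<times> 'x \<Rightarrow> complex) \<Rightarrow> 'x \<times> 'x \<Rightarrow> complex" where
  "right_act a u = (\<lambda>(x, y). u (x, y) * a y)"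

definition mult_map :: "('x \<times> 'x \<Rightarrow> complex) \<Rightarrow> 'x \<Rightarrow> complex" where
  "mult_map u = (\<lambda>x. u (x, x))"

definition virtual_diagonal ::
    "'x op_space \<Rightarrow> ((('x \<times> 'x \<Rightarrow> complex) \<Rightarrow> complex) \<Rightarrow> complex) \<Rightarrow> bool" where
  "virtual_diagonal A M \<longleftrightarrow>
    (let X = os_fn_space A; P = os_fn_space (proj_tensor A A); N = fn_biadjoint P X mult_map M
     in M \<in> fn_carrier (fn_bidual P) \<and>
        (\<forall>a\<in>os_carrier A.
           fn_biadjoint P P (left_act a) M = fn_biadjoint P P (right_act a) M \<and>
           fn_biadjoint X X (\<lambda>b x. a x * b x) N = fn_embed X a \<and>
           fn_biadjoint X X (\<lambda>b x. b x * a x) N = fn_embed X a))"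

definition operator_amenable :: "'x op_space \<Rightarrow> bool" where
  "operator_amenable A \<longleftrightarrow> (\<exists>M. virtual_diagonal A M)"

definition K_operator_amenable :: "real \<Rightarrow> 'x op_space \<Rightarrow> bool" where
  "K_operator_amenable K A \<longleftrightarrow>
     (\<exists>M. virtual_diagonal A M \<and> fn_norm (fn_bidual (os_fn_space (proj_tensor A A))) M = K)"

definition is_operator_amenability_constant :: "'x op_space \<Rightarrow> real \<Rightarrow> bool" where
  "is_operator_amenability_constant A K \<longleftrightarrow>
     K_operator_amenable K A \<and> (\<forall>K'. K_operator_amenable K' A \<longrightarrow> K \<le> K')"

section \<open>The Fourier algebra of a finite group\<close>

text \<open>For finite \<open>G\<close>, this is both \<open>C(G)\<close> and \<open>\<ell>\<^sup>2(G)\<close> as a vector space.\<close>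

definition group_fun :: "('a, 'm) monoid_scheme \<Rightarrow> ('a \<Rightarrow> complex) set" where
  "group_fun G = {f. \<forall>x. x \<notin> carrier G \<longrightarrow> f x = 0}"

definition left_regular ::
    "('a, 'm) monoid_scheme \<Rightarrow> 'a \<Rightarrow> ('a \<Rightarrow> complex) \<Rightarrow> 'a \<Rightarrow> complex" where
  "left_regular G s \<xi> = (\<lambda>t. if t \<in> carrier G then \<xi> (inv\<^bsub>G\<^esub> s \<otimes>\<^bsub>G\<^esub> t) else 0)"

text \<open>The von Neumann algebra generated by the left regular representation is, for finite \<open>G\<close>,
  the linear span of the translation operators on \<open>\<ell>\<^sup>2(G)\<close>.\<close>

definition VN :: "('a, 'm) monoid_scheme \<Rightarrow> (('a \<Rightarrow> complex) \<Rightarrow> ('a \<Rightarrow> complex)) set" where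
  "VN G = {\<lambda>\<xi> t. \<Sum>s\<in>carrier G. c s * left_regular G s \<xi> t | c. True}"

text \<open>The norm of a matrix of operators, acting on a direct sum of copies of \<open>\<ell>\<^sup>2(G)\<close>.\<close>

definition VN_norm ::
    "('a, 'm) monoid_scheme \<Rightarrow> (('a \<Rightarrow> complex) \<Rightarrow> ('a \<Rightarrow> complex)) mat \<Rightarrow> real" where
  "VN_norm G T = Sup {sqrt (\<Sum>k<dim_row T. \<Sum>t\<in>carrier G.
        (cmod (\<Sum>l<dim_col T. (T $$ (k, l)) (\<xi> l) t))\<^sup>2) | \<xi>.
     (\<forall>l<dim_col T. \<xi> l \<in> group_fun G) \<and>
     (\<Sum>l<dim_col T. \<Sum>t\<in>carrier G. (cmod (\<xi> l t))\<^sup>2) \<le> 1}"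

text \<open>The duality of \<open>A(G)\<close> and \<open>VN(G)\<close>: the pairing of \<open>f\<close> with the translation operator by \<open>s\<close>
  is \<open>f(s)\<close>. An operator \<open>T = \<Sum>\<^sub>s c(s) \<lambda>(s)\<close> has coefficients \<open>c = T \<delta>\<^sub>e\<close>.\<close>

definition VN_pairing :: "('a, 'm) monoid_scheme \<Rightarrow> ('a \<Rightarrow> complex) \<Rightarrow>
    (('a \<Rightarrow> complex) \<Rightarrow> ('a \<Rightarrow> complex)) \<Rightarrow> complex" where
  "VN_pairing G f T = (\<Sum>s\<in>carrier G. f s * T (\<lambda>t. if t = \<one>\<^bsub>G\<^esub> then 1 else 0) s)"

text \<open>The operator space structure of the predual: a matrix over \<open>A(G)\<close> is normed as a completely
  bounded map from \<open>VN(G)\<close> to a matrix algebra. For finite \<open>G\<close> every function lies in \<open>A(G)\<close>.\<close>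

definition fourier_algebra :: "('a, 'm) monoid_scheme \<Rightarrow> 'a op_space" where
  "fourier_algebra G = \<lparr>
     os_carrier = group_fun G,
     os_norm = (\<lambda>f. Sup {mat_opnorm (kron_with (VN_pairing G) f T) | m T.
        T \<in> carrier_mat m m \<and> elements_mat T \<subseteq> VN G \<and> VN_norm G T \<le> 1})\<rparr>"

section \<open>Weighted Fourier algebras\<close>

definition fourier_coeff :: "('a, 'm) monoid_scheme \<Rightarrow> ('a \<Rightarrow> complex) \<Rightarrow> 'a rep \<Rightarrow> complex mat" where
  "fourier_coeff G f \<rho> = mat (rep_deg G \<rho>) (rep_deg G \<rho>)
     (\<lambda>(i, j). (\<Sum>t\<in>carrier G. f t * conj_rep \<rho> t $$ (i, j)) / of_nat (card (carrier G)))"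

text \<open>The function \<open>\<phi>\<close> with Fourier coefficients \<open>\<omega>(\<pi>)\<close> times those of \<open>f\<close>. The condition does not
  depend on the representative, hence is imposed on all of them.\<close>

definition weight_multiplier ::
    "('a, 'm) monoid_scheme \<Rightarrow> ('a rep set \<Rightarrow> real) \<Rightarrow> ('a \<Rightarrow> complex) \<Rightarrow> 'a \<Rightarrow> complex" where
  "weight_multiplier G \<omega> f = (THE \<phi>. \<phi> \<in> group_fun G \<and>
     (\<forall>\<pi>\<in>dual_group G. \<forall>\<rho>\<in>\<pi>.
        fourier_coeff G \<phi> \<rho> = complex_of_real (\<omega> \<pi>) \<cdot>\<^sub>m fourier_coeff G f \<rho>))"

text \<open>The matrix norms make \<open>weight_multiplier\<close> a complete isometry onto \<open>A(G)\<close>; the norm they give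
  to a single function is the sum defining the carrier.\<close>

definition weighted_fourier_algebra ::
    "('a, 'm) monoid_scheme \<Rightarrow> ('a rep set \<Rightarrow> real) \<Rightarrow> 'a op_space" where
  "weighted_fourier_algebra G \<omega> = \<lparr>
     os_carrier = {f \<in> group_fun G.
        (\<lambda>\<pi>. real (class_deg G \<pi>) * \<omega> \<pi> * trace_norm (fourier_coeff G f (some_rep \<pi>)))
          summable_on dual_group G},
     os_norm = (\<lambda>f. os_norm (fourier_algebra G) (map_mat (weight_multiplier G \<omega>) f))\<rparr>"

end

theory Submission
  imports Defs "Jordan_Normal_Form.Spectral_Radius" "HOL-Analysis.L2_Norm"
begin

text \<open>
  For a finite group \<open>G\<close> the algebra \<open>A(G, \<omega>)\<close> consists of all functions on \<open>G\<close>, and an element of a bidual is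
  determined by its values on the point evaluations. A virtual diagonal must commute with the point masses, so it is supported on
  the diagonal of \<open>G \<times> G\<close>, and acting as a unit forces its values there to be 1. Hence the only virtual
  diagonal is the indicator function of the diagonal (\<open>diag_virtual\<close>, \<open>virtual_diagonal_unique\<close>), and the
  amenability constant is the norm of this indicator in the projective tensor square. The norm is
  computed by exhibiting an optimal factorization and a functional that shows its optimality.

  Everything takes place in the centre of the convolution algebra. The functions
  \<open>e\<^sub>\<pi> = d\<^sub>\<pi> \<chi>\<^sub>\<pi> / |G|\<close> are orthogonal central idempotents, and they add up to the point mass at the
  identity. For a coefficient family \<open>a\<close> on the dual put \<open>W\<^sub>a = \<Sum> a(\<pi>) e\<^sub>\<pi>\<close>. Convolution of two such
  functions multiplies the coefficients, inversion of the variable passes from \<open>\<pi>\<close> to its conjugate, and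
  \<open>W\<^sub>a\<close> takes the value \<open>\<Sum> d\<^sub>\<pi>\<^sup>2 a(\<pi>) / |G|\<close> at the identity. Convolution with \<open>W\<^sub>\<omega>\<close> is the map that
  multiplies the Fourier coefficients by the weight. These facts rest on the Schur orthogonality relations
  and on the uniqueness of Fourier coefficients, which follows by decomposing the regular representation.

  For the lower bound, multiply a function of two variables by the weight in each variable and evaluate at
  the identity. Evaluation at a group element is the pairing with a translation operator,
  which has norm 1, so this is a contractive functional. Its value on the diagonal indicator is
  the value at the identity of the convolution of \<open>W\<^sub>\<omega>\<close> with its inverted copy, that is
  \<open>K = \<Sum> d\<^sub>\<pi>\<^sup>2 \<Omega>(\<pi>) / |G|\<close> (\<open>unit_functional_le\<close>, \<open>unit_functional_diag\<close>).

  For the upper bound, the coefficient matrix of the regular representation has norm 1 over the Fourier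
  algebra, since its pairing with an operator of \<open>VN(G)\<close> is the matrix of that operator. Let \<open>v\<close> be this matrix
  with every entry divided by the weight. The diagonal indicator is \<open>\<alpha> (v \<otimes> v) \<beta>\<close> with the column
  \<open>\<beta>(x, y) = Q(x\<^sup>-\<^sup>1 y)\<close> and its adjoint row \<open>\<alpha>\<close>, where \<open>Q = W\<^sub>q\<close> with \<open>q\<^sup>2 = \<Omega> / |G|\<close>: the convolution of the four
  factors has the coefficients \<open>q\<^sup>2 / \<Omega> = 1 / |G|\<close> (\<open>diag_identity\<close>). The squared Hilbert space norm of \<open>Q(x\<^sup>-\<^sup>1 y)\<close>
  on \<open>G \<times> G\<close> is again \<open>K\<close> (\<open>root_l2_norm\<close>, \<open>diag_norm_le\<close>). Finally \<open>\<Sum> d\<^sub>\<pi>\<^sup>2 = |G|\<close>, which is the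
  case of constant coefficients 1.
\<close>

section \<open>Adjoints and subspaces\<close>

lemma mat_adjoint_dim [simp]:
  "dim_row (mat_adjoint A) = dim_col A" "dim_col (mat_adjoint A) = dim_row A"
  by (auto simp: mat_adjoint_def)

lemma mat_adjoint_index [simp]:
  fixes A :: "complex mat"
  assumes "i < dim_col A" "j < dim_row A"
  shows "mat_adjoint A $$ (i, j) = cnj (A $$ (j, i))"
  using assms by (simp add: mat_adjoint_def mat_of_rows_def)

lemma mat_adjoint_carrier [simp, intro]:
  "A \<in> carrier_mat n m \<Longrightarrow> mat_adjoint A \<in> carrier_mat m n"
  by (intro carrier_matI) simp_all

lemma mat_adjoint_adjoint [simp]:
  fixes A :: "complex mat" shows "mat_adjoint (mat_adjoint A) = A"
  by (rule eq_matI) auto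

lemma mat_adjoint_mult:
  fixes A B :: "complex mat"
  assumes "A \<in> carrier_mat n m" "B \<in> carrier_mat m k"
  shows "mat_adjoint (A * B) = mat_adjoint B * mat_adjoint A"
  by (rule eq_matI) (use assms in \<open>auto simp: scalar_prod_def mult.commute\<close>)

lemma mat_adjoint_smult:
  fixes A :: "complex mat"
  shows "mat_adjoint (c \<cdot>\<^sub>m A) = cnj c \<cdot>\<^sub>m mat_adjoint A"
  by (rule eq_matI) auto

lemma mult_mat_index:
  assumes "A \<in> carrier_mat n m" "B \<in> carrier_mat m k" "i < n" "j < k"
  shows "(A * B) $$ (i, j) = (\<Sum>l<m. A $$ (i, l) * B $$ (l, j))"
  using assms by (auto simp: scalar_prod_def lessThan_atLeast0)

lemma mult_mat_vec_index:
  assumes "A \<in> carrier_mat n m" "v \<in> carrier_vec m" "i < n"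
  shows "(A *\<^sub>v v) $ i = (\<Sum>l<m. A $$ (i, l) * v $ l)"
  using assms by (auto simp: scalar_prod_def lessThan_atLeast0)

lemma subspace_vec_iff:
  "VectorSpace.subspace class_ring W (module_vec TYPE(complex) n) \<longleftrightarrow>
     W \<subseteq> carrier_vec n \<and> 0\<^sub>v n \<in> W \<and> (\<forall>v\<in>W. \<forall>w\<in>W. v + w \<in> W) \<and> (\<forall>c. \<forall>v\<in>W. c \<cdot>\<^sub>v v \<in> W)"
proof -
  interpret vec_space "TYPE(complex)" n .
  have "vectorspace class_ring (module_vec TYPE(complex) n)" by unfold_locales
  moreover have "Module.module class_ring (module_vec TYPE(complex) n)" by unfold_locales
  ultimately show ?thesis
    by (simp add: VectorSpace.subspace_def LinearCombinations.submodule_def module_vec_def Ball_def) blast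
qed

lemma mat_eq_by_vecI:
  fixes A B :: "complex mat"
  assumes "A \<in> carrier_mat n m" "B \<in> carrier_mat n m"
    and eq: "\<And>v. v \<in> carrier_vec m \<Longrightarrow> A *\<^sub>v v = B *\<^sub>v v"
  shows "A = B"
proof (rule eq_matI)
  fix i j assume "i < dim_row B" "j < dim_col B"
  hence ij: "i < n" "j < m" using assms by auto
  have "C $$ (i, j) = (C *\<^sub>v unit_vec m j) $ i" if "C \<in> carrier_mat n m" for C :: "complex mat"
    using ij that by (subst mult_mat_vec_index[OF that]) (auto simp: unit_vec_def if_distrib cong: if_cong)
  with eq[of "unit_vec m j"] assms show "A $$ (i, j) = B $$ (i, j)" by simp
qed (use assms in auto)

lemma isometry_dim_le:
  fixes V :: "complex mat"
  assumes V: "V \<in> carrier_mat n k" and iso: "mat_adjoint V * V = 1\<^sub>m k"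
  shows "k \<le> n"
proof (rule ccontr)
  assume "\<not> k \<le> n"
  hence nk: "n < k" by simp
  \<comment> \<open>Padding with zero rows gives a square isometry, which is unitary although its last row vanishes.\<close>
  define W where "W = mat k k (\<lambda>(i, j). if i < n then V $$ (i, j) else 0)"
  have W: "W \<in> carrier_mat k k" by (simp add: W_def)
  have "mat_adjoint W * W = 1\<^sub>m k"
  proof (rule eq_matI)
    fix i j assume "i < dim_row (1\<^sub>m k :: complex mat)" "j < dim_col (1\<^sub>m k :: complex mat)"
    hence i: "i < k" and j: "j < k" by auto
    have "(mat_adjoint W * W) $$ (i, j) = (\<Sum>l<k. mat_adjoint W $$ (i, l) * W $$ (l, j))"
      using i j by (intro mult_mat_index[OF mat_adjoint_carrier[OF W] W])
    also have "\<dots> = (\<Sum>l<k. if l < n then cnj (V $$ (l, i)) * V $$ (l, j) else 0)"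
      using W i j by (intro sum.cong) (auto simp: W_def)
    also have "\<dots> = (\<Sum>l<n. cnj (V $$ (l, i)) * V $$ (l, j))"
      using nk by (intro sum.mono_neutral_cong_right) auto
    also have "\<dots> = (mat_adjoint V * V) $$ (i, j)"
      using i j V by (subst mult_mat_index[OF mat_adjoint_carrier[OF V] V]) auto
    finally show "(mat_adjoint W * W) $$ (i, j) = 1\<^sub>m k $$ (i, j)" by (simp add: iso)
  qed (use W in auto)
  hence "W * mat_adjoint W = 1\<^sub>m k"
    using mat_mult_left_right_inverse[OF mat_adjoint_carrier[OF W] W] by simp
  hence "(W * mat_adjoint W) $$ (n, n) = 1" using nk by simp
  moreover have "(W * mat_adjoint W) $$ (n, n) = 0"
    using nk by (subst mult_mat_index[OF W mat_adjoint_carrier[OF W]]) (auto simp: W_def)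
  ultimately show False by simp
qed

text \<open>Take an isometry \<open>V\<close> with range in \<open>W\<close> and as many columns as possible. A vector of \<open>W\<close> that is not fixed
  by the projection \<open>V V\<^sup>*\<close> would give one more column.\<close>

lemma orthonormal_basis_of_subspace:
  fixes W :: "complex vec set"
  assumes W: "VectorSpace.subspace class_ring W (module_vec TYPE(complex) n)"
  obtains k V where "V \<in> carrier_mat n k" "mat_adjoint V * V = 1\<^sub>m k"
    "\<And>v. v \<in> carrier_vec k \<Longrightarrow> V *\<^sub>v v \<in> W"
    "\<And>w. w \<in> W \<Longrightarrow> V *\<^sub>v (mat_adjoint V *\<^sub>v w) = w"
proof -
  have sub: "W \<subseteq> carrier_vec n" "0\<^sub>v n \<in> W"
    "\<And>v w. v \<in> W \<Longrightarrow> w \<in> W \<Longrightarrow> v + w \<in> W" "\<And>c v. v \<in> W \<Longrightarrow> c \<cdot>\<^sub>v v \<in> W"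
    using W[unfolded subspace_vec_iff] by blast+
  define P where "P k V \<longleftrightarrow> V \<in> carrier_mat n k \<and> mat_adjoint V * V = 1\<^sub>m k \<and>
    (\<forall>v\<in>carrier_vec k. V *\<^sub>v v \<in> W)" for k V
  have 0: "P 0 (0\<^sub>m n 0)"
  proof -
    have "0\<^sub>m n 0 *\<^sub>v v = (0\<^sub>v n :: complex vec)" if "v \<in> carrier_vec 0" for v
      using that by (intro eq_vecI) (auto simp: scalar_prod_def)
    moreover have "mat_adjoint (0\<^sub>m n 0) * 0\<^sub>m n 0 = (1\<^sub>m 0 :: complex mat)"
      by (intro eq_matI) auto
    ultimately show ?thesis using sub(2) by (auto simp: P_def)
  qed
  have bound: "k \<le> n" if "P k V" for k V
    using that isometry_dim_le by (auto simp: P_def)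
  define k where "k = (GREATEST k. \<exists>V. P k V)"
  have "\<exists>V. P k V"
    unfolding k_def by (rule GreatestI_nat[where k = 0 and b = n]) (use 0 bound in auto)
  then obtain V where PV: "P k V" by blast
  have max: "k' \<le> k" if "P k' V'" for k' V'
    unfolding k_def by (rule Greatest_le_nat[where b = n]) (use that bound in auto)
  have V: "V \<in> carrier_mat n k" and iso: "mat_adjoint V * V = 1\<^sub>m k"
    and VW: "\<And>v. v \<in> carrier_vec k \<Longrightarrow> V *\<^sub>v v \<in> W"
    using PV by (auto simp: P_def)
  have "V *\<^sub>v (mat_adjoint V *\<^sub>v w) = w" if w: "w \<in> W" for w
  proof (rule ccontr)
    assume neq: "V *\<^sub>v (mat_adjoint V *\<^sub>v w) \<noteq> w"
    have wc: "w \<in> carrier_vec n" using w sub by auto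
    have aw: "mat_adjoint V *\<^sub>v w \<in> carrier_vec k"
      using V wc by (intro mult_mat_vec_carrier) auto
    have vaw: "V *\<^sub>v (mat_adjoint V *\<^sub>v w) \<in> carrier_vec n"
      by (rule mult_mat_vec_carrier[OF V aw])
    \<comment> \<open>The normalized component of \<open>w\<close> orthogonal to the columns of \<open>V\<close> is a further column.\<close>
    define y where "y = w + (-1) \<cdot>\<^sub>v (V *\<^sub>v (mat_adjoint V *\<^sub>v w))"
    have yW: "y \<in> W" unfolding y_def using w aw VW sub by blast
    have yc: "y \<in> carrier_vec n" using yW sub by auto
    have y0: "y \<noteq> 0\<^sub>v n"
    proof
      assume "y = 0\<^sub>v n"
      have "(V *\<^sub>v (mat_adjoint V *\<^sub>v w)) $ i = w $ i" if "i < n" for i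
        using arg_cong[OF \<open>y = 0\<^sub>v n\<close>, of "\<lambda>v. v $ i"] that V wc
        by (simp add: y_def)
      with neq V wc show False by (metis carrier_matD(1) carrier_vecD dim_mult_mat_vec eq_vecI)
    qed
    have orth: "mat_adjoint V *\<^sub>v y = 0\<^sub>v k"
    proof -
      have "mat_adjoint V *\<^sub>v y = mat_adjoint V *\<^sub>v w +
          mat_adjoint V *\<^sub>v ((-1) \<cdot>\<^sub>v (V *\<^sub>v (mat_adjoint V *\<^sub>v w)))"
        unfolding y_def using V wc vaw by (intro mult_add_distrib_mat_vec) auto
      also have "mat_adjoint V *\<^sub>v ((-1) \<cdot>\<^sub>v (V *\<^sub>v (mat_adjoint V *\<^sub>v w))) =
          (-1) \<cdot>\<^sub>v (mat_adjoint V *\<^sub>v (V *\<^sub>v (mat_adjoint V *\<^sub>v w)))"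
        using V wc vaw by (intro mult_mat_vec) auto
      also have "mat_adjoint V *\<^sub>v (V *\<^sub>v (mat_adjoint V *\<^sub>v w)) = (mat_adjoint V * V) *\<^sub>v (mat_adjoint V *\<^sub>v w)"
        using V aw by (intro assoc_mult_mat_vec[symmetric]) auto
      also have "\<dots> = mat_adjoint V *\<^sub>v w" using aw by (simp add: iso)
      finally have "mat_adjoint V *\<^sub>v y =
          mat_adjoint V *\<^sub>v w + (-1) \<cdot>\<^sub>v (mat_adjoint V *\<^sub>v w)" .
      moreover have "z + (-1) \<cdot>\<^sub>v z = 0\<^sub>v k" if "z \<in> carrier_vec k" for z :: "complex vec"
        using that by (intro eq_vecI) auto
      ultimately show ?thesis using aw by simp
    qed
    define r where "r = sqrt (\<Sum>i<n. (cmod (y $ i))\<^sup>2)"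
    have "\<exists>i<n. y $ i \<noteq> 0" using y0 yc by (metis carrier_vecD eq_vecI index_zero_vec)
    hence pos: "(\<Sum>i<n. (cmod (y $ i))\<^sup>2) > 0"
      by (intro sum_pos2[where i = "SOME i. i < n \<and> y $ i \<noteq> 0"])
         (auto dest!: someI_ex[where P = "\<lambda>i. i < n \<and> y $ i \<noteq> 0"])
    hence r: "r > 0" and r2: "r\<^sup>2 = (\<Sum>i<n. (cmod (y $ i))\<^sup>2)" by (auto simp: r_def)
    define u where "u = complex_of_real (1 / r) \<cdot>\<^sub>v y"
    have uW: "u \<in> W" and uc: "u \<in> carrier_vec n" using yW yc sub by (auto simp: u_def)
    have orthu: "mat_adjoint V *\<^sub>v u = 0\<^sub>v k"
      unfolding u_def mult_mat_vec[OF mat_adjoint_carrier[OF V] yc] orth by auto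
    have orthu': "(\<Sum>l<n. cnj (V $$ (l, i)) * u $ l) = 0" if "i < k" for i
    proof -
      have "(mat_adjoint V *\<^sub>v u) $ i = (\<Sum>l<n. cnj (V $$ (l, i)) * u $ l)"
        using V uc that by (subst mult_mat_vec_index[of _ k n]) auto
      thus ?thesis using orthu that by simp
    qed
    have orthu'': "(\<Sum>l<n. cnj (u $ l) * V $$ (l, i)) = 0" if "i < k" for i
      using arg_cong[OF orthu'[OF that], of cnj] by (simp add: mult.commute)
    have unit: "(\<Sum>l<n. cnj (u $ l) * u $ l) = 1"
    proof -
      have "(\<Sum>l<n. cnj (u $ l) * u $ l) = complex_of_real (\<Sum>l<n. (cmod (u $ l))\<^sup>2)"
        by (simp add: complex_norm_square mult.commute del: of_real_power)
      also have "(\<Sum>l<n. (cmod (u $ l))\<^sup>2) = (\<Sum>l<n. (cmod (y $ l))\<^sup>2) / r\<^sup>2"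
        using yc by (simp add: u_def norm_mult norm_divide power_divide sum_divide_distrib)
      finally show ?thesis using pos r r2 by simp
    qed
    define V' where "V' = mat n (Suc k) (\<lambda>(i, j). if j < k then V $$ (i, j) else u $ i)"
    have V': "V' \<in> carrier_mat n (Suc k)" by (simp add: V'_def)
    have "mat_adjoint V' * V' = 1\<^sub>m (Suc k)"
    proof (rule eq_matI)
      fix i j assume "i < dim_row (1\<^sub>m (Suc k) :: complex mat)" "j < dim_col (1\<^sub>m (Suc k) :: complex mat)"
      hence i: "i < Suc k" and j: "j < Suc k" by auto
      have isoe: "(\<Sum>l<n. cnj (V $$ (l, i)) * V $$ (l, j)) = (if i = j then 1 else 0)"
        if "i < k" "j < k"
      proof -
        have "(\<Sum>l<n. cnj (V $$ (l, i)) * V $$ (l, j)) = (mat_adjoint V * V) $$ (i, j)"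
          using V that by (subst mult_mat_index[OF mat_adjoint_carrier[OF V] V]) auto
        thus ?thesis using that by (simp add: iso)
      qed
      have "(mat_adjoint V' * V') $$ (i, j) = (\<Sum>l<n. cnj (V' $$ (l, i)) * V' $$ (l, j))"
        using V' i j by (subst mult_mat_index[OF mat_adjoint_carrier[OF V'] V']) auto
      also have "\<dots> = (\<Sum>l<n. cnj (if i < k then V $$ (l, i) else u $ l) * (if j < k then V $$ (l, j) else u $ l))"
        using i j by (intro sum.cong) (auto simp: V'_def)
      also have "\<dots> = (if i = j then 1 else 0)"
        using i j isoe orthu' orthu'' unit by (auto simp: less_Suc_eq)
      finally show "(mat_adjoint V' * V') $$ (i, j) = 1\<^sub>m (Suc k) $$ (i, j)" using i j by simp
    qed (use V' in auto)
    moreover have "V' *\<^sub>v v \<in> W" if v: "v \<in> carrier_vec (Suc k)" for v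
    proof -
      have "V' *\<^sub>v v = V *\<^sub>v (vec k (\<lambda>i. v $ i)) + v $ k \<cdot>\<^sub>v u"
      proof (rule eq_vecI)
        fix i assume "i < dim_vec (V *\<^sub>v (vec k (\<lambda>i. v $ i)) + v $ k \<cdot>\<^sub>v u)"
        hence i: "i < n" using V uc by simp
        have "(V' *\<^sub>v v) $ i = (\<Sum>l<Suc k. V' $$ (i, l) * v $ l)"
          by (rule mult_mat_vec_index[OF V' v i])
        also have "\<dots> = (\<Sum>l<k. V $$ (i, l) * v $ l) + u $ i * v $ k"
          using i by (simp add: V'_def)
        also have "(\<Sum>l<k. V $$ (i, l) * v $ l) = (V *\<^sub>v (vec k (\<lambda>i. v $ i))) $ i"
          by (subst mult_mat_vec_index[OF V _ i]) auto
        finally show "(V' *\<^sub>v v) $ i = (V *\<^sub>v (vec k (\<lambda>i. v $ i)) + v $ k \<cdot>\<^sub>v u) $ i"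
          using i V uc by simp
      qed (use V V' uc in auto)
      thus ?thesis using VW uW sub by simp
    qed
    ultimately have "P (Suc k) V'" using V' by (auto simp: P_def)
    from max[OF this] show False by simp
  qed
  with that V iso VW show ?thesis by blast
qed

text \<open>The range of \<open>V\<close> and the kernel of \<open>V\<^sup>*\<close> are orthogonal complements, so the projections onto them
  add up to the identity.\<close>

lemma orthonormal_basis_of_complement:
  fixes V :: "complex mat"
  assumes V: "V \<in> carrier_mat n k" and iso: "mat_adjoint V * V = 1\<^sub>m k"
  obtains k' V' where "V' \<in> carrier_mat n k'" "mat_adjoint V' * V' = 1\<^sub>m k'"
    "\<And>v. v \<in> carrier_vec k' \<Longrightarrow> mat_adjoint V *\<^sub>v (V' *\<^sub>v v) = 0\<^sub>v k"
    "\<And>w. w \<in> carrier_vec n \<Longrightarrow> mat_adjoint V *\<^sub>v w = 0\<^sub>v k \<Longrightarrow> V' *\<^sub>v (mat_adjoint V' *\<^sub>v w) = w"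
    "V * mat_adjoint V + V' * mat_adjoint V' = 1\<^sub>m n"
proof -
  note Va = mat_adjoint_carrier[OF V]
  define Z where "Z = {w \<in> carrier_vec n. mat_adjoint V *\<^sub>v w = 0\<^sub>v k}"
  have "VectorSpace.subspace class_ring Z (module_vec TYPE(complex) n)"
    unfolding subspace_vec_iff
  proof (intro conjI ballI allI)
    show "Z \<subseteq> carrier_vec n" by (auto simp: Z_def)
    have "mat_adjoint V *\<^sub>v 0\<^sub>v n = 0\<^sub>v k" using V by (intro eq_vecI) auto
    thus "0\<^sub>v n \<in> Z" by (simp add: Z_def)
    show "v + w \<in> Z" if "v \<in> Z" "w \<in> Z" for v w
      using that mult_add_distrib_mat_vec[OF Va, of v w] by (simp add: Z_def)
    show "c \<cdot>\<^sub>v v \<in> Z" if "v \<in> Z" for c v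
      using that mult_mat_vec[OF Va, of v c] by (auto simp: Z_def)
  qed
  then obtain k' V' where V': "V' \<in> carrier_mat n k'" and iso': "mat_adjoint V' * V' = 1\<^sub>m k'"
    and V'Z: "\<And>v. v \<in> carrier_vec k' \<Longrightarrow> V' *\<^sub>v v \<in> Z"
    and proj: "\<And>w. w \<in> Z \<Longrightarrow> V' *\<^sub>v (mat_adjoint V' *\<^sub>v w) = w"
    using orthonormal_basis_of_subspace by metis
  note V'a = mat_adjoint_carrier[OF V']
  have "mat_adjoint V * V' = 0\<^sub>m k k'"
  proof (rule mat_eq_by_vecI)
    fix v :: "complex vec" assume v: "v \<in> carrier_vec k'"
    have "(mat_adjoint V * V') *\<^sub>v v = 0\<^sub>v k"
      using assoc_mult_mat_vec[OF Va V' v] V'Z[OF v] by (simp add: Z_def)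
    also have "\<dots> = 0\<^sub>m k k' *\<^sub>v v" using v by (intro eq_vecI) auto
    finally show "(mat_adjoint V * V') *\<^sub>v v = 0\<^sub>m k k' *\<^sub>v v" .
  qed (use mult_carrier_mat[OF Va V'] in auto)
  hence "mat_adjoint (mat_adjoint V * V') = mat_adjoint (0\<^sub>m k k')" by simp
  also have "\<dots> = 0\<^sub>m k' k" by (rule eq_matI) auto
  finally have orth: "mat_adjoint V' * V = 0\<^sub>m k' k" using mat_adjoint_mult[OF Va V'] by simp
  let ?P = "V * mat_adjoint V" and ?P' = "V' * mat_adjoint V'"
  have P: "?P \<in> carrier_mat n n" "?P' \<in> carrier_mat n n"
    using mult_carrier_mat[OF V Va] mult_carrier_mat[OF V' V'a] by auto
  have one: "?P + ?P' = 1\<^sub>m n"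
  proof (rule mat_eq_by_vecI)
    fix w :: "complex vec" assume w: "w \<in> carrier_vec n"
    have aw: "mat_adjoint V *\<^sub>v w \<in> carrier_vec k" by (rule mult_mat_vec_carrier[OF Va w])
    define p where "p = V *\<^sub>v (mat_adjoint V *\<^sub>v w)"
    have pc: "p \<in> carrier_vec n" unfolding p_def by (rule mult_mat_vec_carrier[OF V aw])
    define y where "y = w + (-1) \<cdot>\<^sub>v p"
    have yc: "y \<in> carrier_vec n" using w pc by (simp add: y_def)
    have "mat_adjoint V *\<^sub>v p = mat_adjoint V *\<^sub>v w"
      unfolding p_def using assoc_mult_mat_vec[OF Va V aw] aw by (simp add: iso)
    hence "mat_adjoint V *\<^sub>v y = mat_adjoint V *\<^sub>v w + (-1) \<cdot>\<^sub>v (mat_adjoint V *\<^sub>v w)"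
      unfolding y_def using mult_add_distrib_mat_vec[OF Va w, of "(-1) \<cdot>\<^sub>v p"]
        mult_mat_vec[OF Va pc, of "-1"] pc by simp
    moreover have "z + (-1) \<cdot>\<^sub>v z = 0\<^sub>v k" if "z \<in> carrier_vec k" for z :: "complex vec"
      using that by (intro eq_vecI) auto
    ultimately have yZ: "y \<in> Z" using yc aw by (simp add: Z_def)
    have "mat_adjoint V' *\<^sub>v p = 0\<^sub>m k' k *\<^sub>v (mat_adjoint V *\<^sub>v w)"
      unfolding p_def using assoc_mult_mat_vec[OF V'a V aw] by (simp add: orth)
    also have "\<dots> = 0\<^sub>v k'" using aw by (intro eq_vecI) auto
    finally have a'p: "mat_adjoint V' *\<^sub>v p = 0\<^sub>v k'" .
    have wyp: "w = p + y" unfolding y_def using w pc by (intro eq_vecI) auto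
    have "mat_adjoint V' *\<^sub>v w = mat_adjoint V' *\<^sub>v y"
      by (subst wyp, subst mult_add_distrib_mat_vec[OF V'a pc yc])
         (use a'p mult_mat_vec_carrier[OF V'a yc] in simp)
    hence "?P' *\<^sub>v w = y" using assoc_mult_mat_vec[OF V' V'a w] proj[OF yZ] by simp
    moreover have "?P *\<^sub>v w = p" unfolding p_def by (rule assoc_mult_mat_vec[OF V Va w])
    ultimately have "(?P + ?P') *\<^sub>v w = p + y" using add_mult_distrib_mat_vec[OF P w] by simp
    thus "(?P + ?P') *\<^sub>v w = 1\<^sub>m n *\<^sub>v w" using wyp w by simp
  qed (use P in auto)
  show ?thesis by (rule that[OF V' iso' _ _ one]) (use V'Z proj in \<open>auto simp: Z_def\<close>)
qed

lemma sandwich_index: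
  fixes V R :: "complex mat"
  assumes "V \<in> carrier_mat n k" "R \<in> carrier_mat k k" "i < n" "j < n"
  shows "(V * R * mat_adjoint V) $$ (i, j) =
    (\<Sum>b<k. \<Sum>a<k. V $$ (i, a) * R $$ (a, b) * cnj (V $$ (j, b)))"
proof -
  have VR: "V * R \<in> carrier_mat n k" using assms by auto
  have "(V * R * mat_adjoint V) $$ (i, j) = (\<Sum>b<k. (V * R) $$ (i, b) * mat_adjoint V $$ (b, j))"
    by (rule mult_mat_index[OF VR mat_adjoint_carrier[OF assms(1)] assms(3,4)])
  also have "\<dots> = (\<Sum>b<k. (\<Sum>a<k. V $$ (i, a) * R $$ (a, b)) * cnj (V $$ (j, b)))"
    using assms by (intro sum.cong refl arg_cong2[where f = "(*)"] mult_mat_index) auto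
  finally show ?thesis by (simp add: sum_distrib_right)
qed

locale fin_group = group G for G (structure) +
  assumes fin: "finite (carrier G)"
begin

lemma card_pos: "card (carrier G) > 0"
  using fin one_closed by (auto simp: card_gt_0_iff)

lemma sum_left_translate:
  assumes "h \<in> carrier G"
  shows "(\<Sum>g\<in>carrier G. f (h \<otimes> g)) = (\<Sum>g\<in>carrier G. f g)"
  by (rule sum.reindex_bij_witness[of _ "\<lambda>g. inv h \<otimes> g" "\<lambda>g. h \<otimes> g"])
     (use assms in \<open>auto simp: m_assoc[symmetric]\<close>)

section \<open>Unitary representations\<close>

abbreviation deg :: "'a rep \<Rightarrow> nat" where "deg \<equiv> rep_deg G"

lemma urep_carrier: "unitary_rep G \<rho> \<Longrightarrow> g \<in> carrier G \<Longrightarrow> \<rho> g \<in> carrier_mat (deg \<rho>) (deg \<rho>)"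
  by (auto simp: unitary_rep_def)

lemma urep_mult:
  "unitary_rep G \<rho> \<Longrightarrow> g \<in> carrier G \<Longrightarrow> h \<in> carrier G \<Longrightarrow> \<rho> (g \<otimes> h) = \<rho> g * \<rho> h"
  by (auto simp: unitary_rep_def)

lemma urep_adjoint_mult:
  "unitary_rep G \<rho> \<Longrightarrow> g \<in> carrier G \<Longrightarrow> mat_adjoint (\<rho> g) * \<rho> g = 1\<^sub>m (deg \<rho>)"
  by (auto simp: unitary_rep_def)

lemma urep_mult_adjoint:
  assumes "unitary_rep G \<rho>" "g \<in> carrier G"
  shows "\<rho> g * mat_adjoint (\<rho> g) = 1\<^sub>m (deg \<rho>)"
  using mat_mult_left_right_inverse[OF mat_adjoint_carrier[OF urep_carrier[OF assms]]
    urep_carrier[OF assms] urep_adjoint_mult[OF assms]] .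

lemma urep_one:
  assumes "unitary_rep G \<rho>"
  shows "\<rho> \<one> = 1\<^sub>m (deg \<rho>)"
proof -
  note c = urep_carrier[OF assms one_closed]
  have "1\<^sub>m (deg \<rho>) = mat_adjoint (\<rho> \<one>) * \<rho> (\<one> \<otimes> \<one>)"
    using urep_adjoint_mult[OF assms one_closed] by simp
  also have "\<dots> = mat_adjoint (\<rho> \<one>) * (\<rho> \<one> * \<rho> \<one>)"
    using urep_mult[OF assms, of \<one> \<one>] by simp
  also have "\<dots> = (mat_adjoint (\<rho> \<one>) * \<rho> \<one>) * \<rho> \<one>"
    by (rule assoc_mult_mat[OF mat_adjoint_carrier[OF c] c c, symmetric])
  also have "\<dots> = \<rho> \<one>" using urep_adjoint_mult[OF assms one_closed] c by simp
  finally show ?thesis by simp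
qed

lemma urep_inv:
  assumes "unitary_rep G \<rho>" "g \<in> carrier G"
  shows "\<rho> (inv g) = mat_adjoint (\<rho> g)"
proof -
  note c = urep_carrier[OF assms] and ci = urep_carrier[OF assms(1) inv_closed[OF assms(2)]]
  have "\<rho> (inv g) = \<rho> (inv g) * (\<rho> g * mat_adjoint (\<rho> g))"
    using urep_mult_adjoint[OF assms] ci by simp
  also have "\<dots> = \<rho> (inv g) * \<rho> g * mat_adjoint (\<rho> g)"
    by (rule assoc_mult_mat[OF ci c mat_adjoint_carrier[OF c], symmetric])
  also have "\<rho> (inv g) * \<rho> g = 1\<^sub>m (deg \<rho>)"
    using urep_mult[OF assms(1), of "inv g" g] assms urep_one[OF assms(1)] by simp
  finally show ?thesis by (simp add: left_mult_one_mat[OF mat_adjoint_carrier[OF c]])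
qed

lemma urep_mult_index:
  assumes "unitary_rep G \<rho>" "g \<in> carrier G" "h \<in> carrier G" "i < deg \<rho>" "j < deg \<rho>"
  shows "\<rho> (g \<otimes> h) $$ (i, j) = (\<Sum>l<deg \<rho>. \<rho> g $$ (i, l) * \<rho> h $$ (l, j))"
  unfolding urep_mult[OF assms(1-3)]
  by (rule mult_mat_index[OF urep_carrier urep_carrier]) (use assms in auto)

lemma urep_inv_index:
  assumes "unitary_rep G \<rho>" "g \<in> carrier G" "i < deg \<rho>" "j < deg \<rho>"
  shows "\<rho> (inv g) $$ (i, j) = cnj (\<rho> g $$ (j, i))"
  unfolding urep_inv[OF assms(1,2)]
  using urep_carrier[OF assms(1,2)] assms by (intro mat_adjoint_index) auto

lemma urep_intertwine_adjoint:
  assumes "unitary_rep G \<rho>" "unitary_rep G \<sigma>" "A \<in> carrier_mat (deg \<sigma>) (deg \<rho>)"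
    and "\<And>g. g \<in> carrier G \<Longrightarrow> \<sigma> g * A = A * \<rho> g" and g: "g \<in> carrier G"
  shows "\<rho> g * mat_adjoint A = mat_adjoint A * \<sigma> g"
proof -
  have "mat_adjoint (\<sigma> (inv g) * A) = mat_adjoint (A * \<rho> (inv g))"
    using assms(4)[of "inv g"] g by simp
  hence "mat_adjoint A * mat_adjoint (\<sigma> (inv g)) = mat_adjoint (\<rho> (inv g)) * mat_adjoint A"
    using mat_adjoint_mult[OF urep_carrier[OF assms(2), of "inv g"] assms(3)]
      mat_adjoint_mult[OF assms(3) urep_carrier[OF assms(1), of "inv g"]] g by simp
  thus ?thesis using urep_inv[OF assms(1) g] urep_inv[OF assms(2) g] by simp
qed

section \<open>Schur's lemma and the orthogonality relations\<close>

lemma irrep_unitary: "irreducible_rep G \<rho> \<Longrightarrow> unitary_rep G \<rho>"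
  by (simp add: irreducible_rep_def)

lemma irrep_deg_pos: "irreducible_rep G \<rho> \<Longrightarrow> deg \<rho> > 0"
  by (simp add: irreducible_rep_def)

lemma irrep_invariant_subspace:
  assumes "irreducible_rep G \<rho>" "W \<subseteq> carrier_vec (deg \<rho>)" "0\<^sub>v (deg \<rho>) \<in> W"
    "\<And>v w. v \<in> W \<Longrightarrow> w \<in> W \<Longrightarrow> v + w \<in> W" "\<And>c v. v \<in> W \<Longrightarrow> c \<cdot>\<^sub>v v \<in> W"
    "\<And>g w. g \<in> carrier G \<Longrightarrow> w \<in> W \<Longrightarrow> \<rho> g *\<^sub>v w \<in> W"
  shows "W = {0\<^sub>v (deg \<rho>)} \<or> W = carrier_vec (deg \<rho>)"
proof -
  have "VectorSpace.subspace class_ring W (module_vec TYPE(complex) (deg \<rho>))"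
    using assms(2-5) by (simp add: subspace_vec_iff)
  with assms(1,6) show ?thesis by (simp add: irreducible_rep_def)
qed

text \<open>An eigenspace of \<open>B\<close> is invariant, hence it is the whole space.\<close>

lemma irrep_commutant:
  assumes irr: "irreducible_rep G \<rho>" and B: "B \<in> carrier_mat (deg \<rho>) (deg \<rho>)"
    and comm: "\<And>g. g \<in> carrier G \<Longrightarrow> \<rho> g * B = B * \<rho> g"
  obtains c where "B = c \<cdot>\<^sub>m 1\<^sub>m (deg \<rho>)"
proof -
  let ?n = "deg \<rho>"
  note u = irrep_unitary[OF irr]
  obtain c v where ev: "eigenvector B v c"
    using spectrum_non_empty[OF B irrep_deg_pos[OF irr]] by (auto simp: spectrum_def eigenvalue_def)
  define W where "W = {v \<in> carrier_vec ?n. B *\<^sub>v v = c \<cdot>\<^sub>v v}"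
  have v: "v \<in> W" "v \<noteq> 0\<^sub>v ?n" using ev B by (auto simp: eigenvector_def W_def)
  have "W = {0\<^sub>v ?n} \<or> W = carrier_vec ?n"
  proof (rule irrep_invariant_subspace[OF irr])
    show "0\<^sub>v ?n \<in> W" using B by (auto simp: W_def)
  next
    fix x y assume "x \<in> W" "y \<in> W"
    thus "x + y \<in> W"
      using mult_add_distrib_mat_vec[OF B, of x y] smult_add_distrib_vec[of x ?n y c] by (auto simp: W_def)
  next
    fix d x assume "x \<in> W"
    thus "d \<cdot>\<^sub>v x \<in> W"
      using mult_mat_vec[OF B, of x d] by (auto simp: W_def smult_smult_assoc mult.commute)
  next
    fix g x assume g: "g \<in> carrier G" and x: "x \<in> W"
    note c = urep_carrier[OF u g]
    have xc: "x \<in> carrier_vec ?n" using x by (simp add: W_def)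
    have "B *\<^sub>v (\<rho> g *\<^sub>v x) = \<rho> g *\<^sub>v (B *\<^sub>v x)"
      using assoc_mult_mat_vec[OF B c xc] assoc_mult_mat_vec[OF c B xc] comm[OF g] by simp
    also have "\<dots> = c \<cdot>\<^sub>v (\<rho> g *\<^sub>v x)" using x mult_mat_vec[OF c xc] by (simp add: W_def)
    finally show "\<rho> g *\<^sub>v x \<in> W" using mult_mat_vec_carrier[OF c xc] by (simp add: W_def)
  qed (auto simp: W_def)
  with v have W: "W = carrier_vec ?n" by blast
  have "B = c \<cdot>\<^sub>m 1\<^sub>m ?n"
  proof (rule mat_eq_by_vecI[OF B])
    fix x :: "complex vec" assume x: "x \<in> carrier_vec ?n"
    have "(c \<cdot>\<^sub>m 1\<^sub>m ?n) *\<^sub>v x = c \<cdot>\<^sub>v x"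
      using x by (intro eq_vecI)
        (auto simp: mult_mat_vec_index[OF smult_carrier_mat[OF one_carrier_mat]] if_distrib
          cong: if_cong)
    thus "B *\<^sub>v x = (c \<cdot>\<^sub>m 1\<^sub>m ?n) *\<^sub>v x" using x W by (auto simp: W_def)
  qed auto
  thus ?thesis using that by blast
qed

text \<open>The products \<open>A\<^sup>* A\<close> and \<open>A A\<^sup>*\<close> commute with the representations and are therefore scalar, and
  \<open>A (A\<^sup>* A) = (A A\<^sup>*) A\<close> shows that they are the same scalar. So \<open>A\<close> is unitary up to a factor.\<close>

lemma schur_equivalence:
  assumes irr: "irreducible_rep G \<rho>" "irreducible_rep G \<sigma>"
    and A: "A \<in> carrier_mat (deg \<sigma>) (deg \<rho>)" "A \<noteq> 0\<^sub>m (deg \<sigma>) (deg \<rho>)"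
    and inter: "\<And>g. g \<in> carrier G \<Longrightarrow> \<sigma> g * A = A * \<rho> g"
  shows "rep_equiv G \<rho> \<sigma>"
proof -
  let ?A = "mat_adjoint A"
  note u = irrep_unitary[OF irr(1)] irrep_unitary[OF irr(2)]
  note A' = mat_adjoint_carrier[OF A(1)]
  have inter': "\<rho> g * ?A = ?A * \<sigma> g" if "g \<in> carrier G" for g
    using urep_intertwine_adjoint[OF u A(1) _ that] inter by blast
  have comm1: "\<rho> g * (?A * A) = ?A * A * \<rho> g" if g: "g \<in> carrier G" for g
  proof -
    note c = urep_carrier[OF u(1) g] urep_carrier[OF u(2) g]
    have "\<rho> g * (?A * A) = ?A * \<sigma> g * A"
      using assoc_mult_mat[OF c(1) A' A(1)] inter'[OF g] by simp
    also have "\<dots> = ?A * (A * \<rho> g)" using assoc_mult_mat[OF A' c(2) A(1)] inter[OF g] by simp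
    finally show ?thesis using assoc_mult_mat[OF A' A(1) c(1)] by simp
  qed
  have comm2: "\<sigma> g * (A * ?A) = A * ?A * \<sigma> g" if g: "g \<in> carrier G" for g
  proof -
    note c = urep_carrier[OF u(1) g] urep_carrier[OF u(2) g]
    have "\<sigma> g * (A * ?A) = A * \<rho> g * ?A"
      using assoc_mult_mat[OF c(2) A(1) A'] inter[OF g] by simp
    also have "\<dots> = A * (?A * \<sigma> g)" using assoc_mult_mat[OF A(1) c(1) A'] inter'[OF g] by simp
    finally show ?thesis using assoc_mult_mat[OF A(1) A' c(2)] by simp
  qed
  obtain a where a: "?A * A = a \<cdot>\<^sub>m 1\<^sub>m (deg \<rho>)"
    using irrep_commutant[OF irr(1) _ comm1] A(1) A' by auto
  obtain b where b: "A * ?A = b \<cdot>\<^sub>m 1\<^sub>m (deg \<sigma>)"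
    using irrep_commutant[OF irr(2) _ comm2] A(1) A' by auto
  \<comment> \<open>The trace of \<open>A\<^sup>* A\<close> equals that of \<open>A A\<^sup>*\<close>. As the scalars agree, so do the degrees.\<close>
  obtain i0 j0 where ij0: "i0 < deg \<sigma>" "j0 < deg \<rho>" "A $$ (i0, j0) \<noteq> 0"
    using A by (metis carrier_matD eq_matI index_zero_mat)
  have aj: "a = complex_of_real (\<Sum>l<deg \<sigma>. (cmod (A $$ (l, j)))\<^sup>2)" if "j < deg \<rho>" for j
  proof -
    have "a = (?A * A) $$ (j, j)" using that by (simp add: a)
    also have "\<dots> = (\<Sum>l<deg \<sigma>. ?A $$ (j, l) * A $$ (l, j))"
      by (rule mult_mat_index[OF A' A(1) that that])
    also have "\<dots> = (\<Sum>l<deg \<sigma>. cnj (A $$ (l, j)) * A $$ (l, j))"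
      using A(1) that by (intro sum.cong) auto
    finally show ?thesis by (simp add: complex_norm_square mult.commute del: of_real_power)
  qed
  have bj: "b = complex_of_real (\<Sum>l<deg \<rho>. (cmod (A $$ (j, l)))\<^sup>2)" if "j < deg \<sigma>" for j
  proof -
    have "b = (A * ?A) $$ (j, j)" using that by (simp add: b)
    also have "\<dots> = (\<Sum>l<deg \<rho>. A $$ (j, l) * ?A $$ (l, j))"
      by (rule mult_mat_index[OF A(1) A' that that])
    also have "\<dots> = (\<Sum>l<deg \<rho>. A $$ (j, l) * cnj (A $$ (j, l)))"
      using A(1) that by (intro sum.cong) auto
    finally show ?thesis by (simp add: complex_norm_square mult.commute del: of_real_power)
  qed
  define r where "r = (\<Sum>l<deg \<sigma>. (cmod (A $$ (l, j0)))\<^sup>2)"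
  have ar: "a = complex_of_real r" using aj ij0 by (simp add: r_def)
  have r: "r > 0" unfolding r_def using ij0 by (intro sum_pos2[of _ i0]) auto
  have "a \<cdot>\<^sub>m A = A * (?A * A)" using A(1) by (simp add: a mult_smult_distrib[OF A(1) one_carrier_mat])
  also have "\<dots> = A * ?A * A" using assoc_mult_mat[OF A(1) A' A(1)] by simp
  also have "\<dots> = b \<cdot>\<^sub>m A" using A(1) by (simp add: b mult_smult_assoc_mat[OF one_carrier_mat A(1)])
  finally have "(a \<cdot>\<^sub>m A) $$ (i0, j0) = (b \<cdot>\<^sub>m A) $$ (i0, j0)" by simp
  hence ab: "a = b" using ij0 A(1) by simp
  have "of_nat (deg \<rho>) * a = (\<Sum>j<deg \<rho>. a)" by simp
  also have "\<dots> = (\<Sum>j<deg \<rho>. complex_of_real (\<Sum>l<deg \<sigma>. (cmod (A $$ (l, j)))\<^sup>2))"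
    by (intro sum.cong) (use aj in auto)
  also have "\<dots> = complex_of_real (\<Sum>j<deg \<rho>. \<Sum>l<deg \<sigma>. (cmod (A $$ (l, j)))\<^sup>2)" by simp
  also have "\<dots> = complex_of_real (\<Sum>l<deg \<sigma>. \<Sum>j<deg \<rho>. (cmod (A $$ (l, j)))\<^sup>2)"
    by (subst sum.swap) simp
  also have "\<dots> = (\<Sum>l<deg \<sigma>. complex_of_real (\<Sum>j<deg \<rho>. (cmod (A $$ (l, j)))\<^sup>2))" by simp
  also have "\<dots> = (\<Sum>l<deg \<sigma>. b)"
    by (intro sum.cong) (use bj in auto)
  also have "\<dots> = of_nat (deg \<sigma>) * b" by simp
  finally have d: "deg \<rho> = deg \<sigma>" using ab ar r by auto
  \<comment> \<open>Now \<open>A\<close> is a multiple of a unitary matrix.\<close>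
  define U where "U = complex_of_real (1 / sqrt r) \<cdot>\<^sub>m A"
  have U: "U \<in> carrier_mat (deg \<rho>) (deg \<rho>)" using A(1) d by (simp add: U_def)
  have "mat_adjoint U * U = complex_of_real (1 / sqrt r) \<cdot>\<^sub>m (complex_of_real (1 / sqrt r) \<cdot>\<^sub>m (?A * A))"
    unfolding U_def mat_adjoint_smult
    by (simp add: mult_smult_distrib[OF A' A(1)] mult_smult_assoc_mat[OF A' smult_carrier_mat[OF A(1)]])
  also have "\<dots> = 1\<^sub>m (deg \<rho>)"
  proof -
    have "complex_of_real (1 / sqrt r) * (complex_of_real (1 / sqrt r) * a) = 1"
      unfolding ar of_real_mult[symmetric] using r
      by (simp add: power2_eq_square[symmetric] power_divide field_simps del: of_real_mult)
    thus ?thesis unfolding a by (intro eq_matI) (auto simp: mult.assoc)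
  qed
  finally have UU: "mat_adjoint U * U = 1\<^sub>m (deg \<rho>)" .
  have "\<sigma> g * U = U * \<rho> g" if g: "g \<in> carrier G" for g
    using inter[OF g] mult_smult_distrib[OF urep_carrier[OF u(2) g] A(1)]
      mult_smult_assoc_mat[OF A(1) urep_carrier[OF u(1) g]] by (simp add: U_def)
  with d U UU show ?thesis by (auto simp: rep_equiv_def)
qed

text \<open>The matrix \<open>A\<close> is the average \<open>\<Sum>\<^sub>g \<sigma>(g) E \<rho>(g)\<^sup>*\<close> of the matrix unit \<open>E\<close> at position \<open>(k, l)\<close>.
  Replacing \<open>g\<close> by \<open>h g\<close> in the sum gives the intertwining property.\<close>

lemma averaged_intertwiner:
  assumes u: "unitary_rep G \<rho>" "unitary_rep G \<sigma>" and kl: "k < deg \<sigma>" "l < deg \<rho>"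
    and h: "h \<in> carrier G"
  defines "A \<equiv> mat (deg \<sigma>) (deg \<rho>) (\<lambda>(i, j). \<Sum>g\<in>carrier G. \<sigma> g $$ (i, k) * cnj (\<rho> g $$ (j, l)))"
  shows "\<sigma> h * A = A * \<rho> h"
proof (rule eq_matI)
  have A: "A \<in> carrier_mat (deg \<sigma>) (deg \<rho>)" by (simp add: A_def)
  note c = urep_carrier[OF u(1) h] urep_carrier[OF u(2) h]
  fix i j assume "i < dim_row (A * \<rho> h)" "j < dim_col (A * \<rho> h)"
  hence ij: "i < deg \<sigma>" "j < deg \<rho>" using A c by auto
  have "(\<sigma> h * A) $$ (i, j) = (\<Sum>m<deg \<sigma>. \<sigma> h $$ (i, m) * (\<Sum>g\<in>carrier G. \<sigma> g $$ (m, k) * cnj (\<rho> g $$ (j, l))))"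
    using ij by (subst mult_mat_index[OF c(2) A]) (auto simp: A_def)
  also have "\<dots> = (\<Sum>g\<in>carrier G. (\<Sum>m<deg \<sigma>. \<sigma> h $$ (i, m) * \<sigma> g $$ (m, k)) * cnj (\<rho> g $$ (j, l)))"
    unfolding sum_distrib_left sum_distrib_right by (subst sum.swap) (simp add: mult.assoc)
  also have "\<dots> = (\<Sum>g\<in>carrier G. \<sigma> (h \<otimes> g) $$ (i, k) * cnj (\<rho> g $$ (j, l)))"
    using ij kl h by (intro sum.cong) (auto simp: urep_mult_index[OF u(2)])
  also have "\<dots> = (\<Sum>g\<in>carrier G. \<sigma> (h \<otimes> g) $$ (i, k) * cnj (\<rho> (inv h \<otimes> (h \<otimes> g)) $$ (j, l)))"
    using h by (intro sum.cong) (auto simp: m_assoc[symmetric])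
  also have "\<dots> = (\<Sum>g\<in>carrier G. \<sigma> g $$ (i, k) * cnj (\<rho> (inv h \<otimes> g) $$ (j, l)))"
    by (rule sum_left_translate[OF h])
  also have "\<dots> = (\<Sum>g\<in>carrier G. \<sigma> g $$ (i, k) * (\<Sum>m<deg \<rho>. \<rho> h $$ (m, j) * cnj (\<rho> g $$ (m, l))))"
    using ij kl h by (intro sum.cong) (auto simp: urep_mult_index[OF u(1)] urep_inv_index[OF u(1)])
  also have "\<dots> = (\<Sum>m<deg \<rho>. (\<Sum>g\<in>carrier G. \<sigma> g $$ (i, k) * cnj (\<rho> g $$ (m, l))) * \<rho> h $$ (m, j))"
    unfolding sum_distrib_left sum_distrib_right by (subst sum.swap) (simp add: mult_ac)
  also have "\<dots> = (A * \<rho> h) $$ (i, j)"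
    using ij by (subst mult_mat_index[OF A c(1)]) (auto simp: A_def)
  finally show "(\<sigma> h * A) $$ (i, j) = (A * \<rho> h) $$ (i, j)" .
qed (use urep_carrier[OF u(1) h] urep_carrier[OF u(2) h] in \<open>auto simp: A_def\<close>)

lemma schur_orthogonality_inequivalent:
  assumes irr: "irreducible_rep G \<rho>" "irreducible_rep G \<sigma>" and neq: "\<not> rep_equiv G \<rho> \<sigma>"
    and "i < deg \<sigma>" "k < deg \<sigma>" "j < deg \<rho>" "l < deg \<rho>"
  shows "(\<Sum>g\<in>carrier G. \<sigma> g $$ (i, k) * cnj (\<rho> g $$ (j, l))) = 0"
proof -
  let ?A = "mat (deg \<sigma>) (deg \<rho>) (\<lambda>(i, j). \<Sum>g\<in>carrier G. \<sigma> g $$ (i, k) * cnj (\<rho> g $$ (j, l)))"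
  have "?A = 0\<^sub>m (deg \<sigma>) (deg \<rho>)"
    using schur_equivalence[OF irr, of ?A] neq
      averaged_intertwiner[OF irr[THEN irrep_unitary] assms(5,7)] by auto
  from arg_cong[OF this, of "\<lambda>A. A $$ (i, j)"] assms(4,6) show ?thesis by simp
qed

text \<open>Here the averaged matrix is scalar, and its trace determines the scalar.\<close>

lemma schur_orthogonality:
  assumes irr: "irreducible_rep G \<rho>"
    and ij: "i < deg \<rho>" "j < deg \<rho>" and kl: "k < deg \<rho>" "l < deg \<rho>"
  shows "(\<Sum>g\<in>carrier G. \<rho> g $$ (i, k) * cnj (\<rho> g $$ (j, l))) =
    (if i = j \<and> k = l then of_nat (card (carrier G)) / of_nat (deg \<rho>) else 0)"
proof -
  note u = irrep_unitary[OF irr]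
  let ?A = "mat (deg \<rho>) (deg \<rho>) (\<lambda>(i, j). \<Sum>g\<in>carrier G. \<rho> g $$ (i, k) * cnj (\<rho> g $$ (j, l)))"
  obtain c where c: "?A = c \<cdot>\<^sub>m 1\<^sub>m (deg \<rho>)"
    using irrep_commutant[OF irr, of ?A] averaged_intertwiner[OF u u kl] by auto
  have entry: "(\<Sum>g\<in>carrier G. \<rho> g $$ (i, k) * cnj (\<rho> g $$ (j, l))) = (if i = j then c else 0)"
    if "i < deg \<rho>" "j < deg \<rho>" for i j
    using arg_cong[OF c, of "\<lambda>A. A $$ (i, j)"] that by simp
  have "of_nat (deg \<rho>) * c = (\<Sum>i<deg \<rho>. \<Sum>g\<in>carrier G. \<rho> g $$ (i, k) * cnj (\<rho> g $$ (i, l)))"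
    using entry by simp
  also have "\<dots> = (\<Sum>g\<in>carrier G. \<Sum>i<deg \<rho>. \<rho> g $$ (i, k) * cnj (\<rho> g $$ (i, l)))"
    by (rule sum.swap)
  also have "\<dots> = (\<Sum>g\<in>carrier G. if k = l then 1 else 0)"
  proof (intro sum.cong refl)
    fix g assume g: "g \<in> carrier G"
    have "(\<Sum>i<deg \<rho>. \<rho> g $$ (i, k) * cnj (\<rho> g $$ (i, l))) =
        (\<Sum>i<deg \<rho>. \<rho> (inv g) $$ (l, i) * \<rho> g $$ (i, k))"
      using g kl by (intro sum.cong) (auto simp: urep_inv_index[OF u])
    also have "\<dots> = \<rho> (inv g \<otimes> g) $$ (l, k)"
      using g kl by (intro urep_mult_index[OF u, symmetric]) auto
    finally show "(\<Sum>i<deg \<rho>. \<rho> g $$ (i, k) * cnj (\<rho> g $$ (i, l))) = (if k = l then 1 else 0)"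
      using g kl by (simp add: urep_one[OF u])
  qed
  also have "\<dots> = (if k = l then of_nat (card (carrier G)) else 0)" by simp
  finally have "c = (if k = l then of_nat (card (carrier G)) / of_nat (deg \<rho>) else 0)"
    using irrep_deg_pos[OF irr] by (auto simp: field_simps)
  thus ?thesis using entry[OF ij] by simp
qed


section \<open>Completeness of the irreducible representations\<close>

text \<open>Invariance of the range of \<open>V\<close> makes the compression of \<open>\<rho>\<close> to it multiplicative and isometric.\<close>

lemma subrepresentation:
  assumes u: "unitary_rep G \<rho>" and V: "V \<in> carrier_mat (deg \<rho>) k"
    and iso: "mat_adjoint V * V = 1\<^sub>m k"
    and inv: "\<And>g. g \<in> carrier G \<Longrightarrow> \<rho> g * V = V * (mat_adjoint V * (\<rho> g * V))"
  shows "unitary_rep G (\<lambda>g. mat_adjoint V * (\<rho> g * V))"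
    and "deg (\<lambda>g. mat_adjoint V * (\<rho> g * V)) = k"
proof -
  let ?\<tau> = "\<lambda>g. mat_adjoint V * (\<rho> g * V)"
  note V' = mat_adjoint_carrier[OF V]
  show d: "deg ?\<tau> = k" using V by (simp add: rep_deg_def)
  have rV: "\<rho> g * V \<in> carrier_mat (deg \<rho>) k" if "g \<in> carrier G" for g
    using urep_carrier[OF u that] V by (rule mult_carrier_mat)
  have t: "?\<tau> g \<in> carrier_mat k k" if "g \<in> carrier G" for g
    using V' rV[OF that] by (rule mult_carrier_mat)
  have "mat_adjoint (?\<tau> g) * ?\<tau> g = 1\<^sub>m k" if g: "g \<in> carrier G" for g
  proof -
    note c = urep_carrier[OF u g]
    note rV' = mat_adjoint_carrier[OF rV[OF g]]
    have "mat_adjoint (?\<tau> g) = mat_adjoint (\<rho> g * V) * V"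
      using mat_adjoint_mult[OF V' rV[OF g]] by simp
    hence "mat_adjoint (?\<tau> g) * ?\<tau> g = mat_adjoint (\<rho> g * V) * (V * ?\<tau> g)"
      using assoc_mult_mat[OF rV' V t[OF g]] by simp
    also have "\<dots> = mat_adjoint (\<rho> g * V) * (\<rho> g * V)" using inv[OF g] by simp
    also have "\<dots> = mat_adjoint V * mat_adjoint (\<rho> g) * (\<rho> g * V)"
      using mat_adjoint_mult[OF c V] by simp
    also have "\<dots> = mat_adjoint V * (mat_adjoint (\<rho> g) * (\<rho> g * V))"
      by (rule assoc_mult_mat[OF V' mat_adjoint_carrier[OF c] rV[OF g]])
    also have "mat_adjoint (\<rho> g) * (\<rho> g * V) = mat_adjoint (\<rho> g) * \<rho> g * V"
      by (rule assoc_mult_mat[OF mat_adjoint_carrier[OF c] c V, symmetric])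
    also have "\<dots> = V" using urep_adjoint_mult[OF u g] V by simp
    finally show ?thesis using iso by simp
  qed
  moreover have "?\<tau> (g \<otimes> h) = ?\<tau> g * ?\<tau> h" if g: "g \<in> carrier G" and h: "h \<in> carrier G" for g h
  proof -
    note c = urep_carrier[OF u g] urep_carrier[OF u h]
    have "?\<tau> g * ?\<tau> h = mat_adjoint V * (\<rho> g * V * ?\<tau> h)"
      by (rule assoc_mult_mat[OF V' rV[OF g] t[OF h]])
    also have "\<rho> g * V * ?\<tau> h = \<rho> g * (V * ?\<tau> h)" by (rule assoc_mult_mat[OF c(1) V t[OF h]])
    also have "V * ?\<tau> h = \<rho> h * V" using inv[OF h] by simp
    also have "\<rho> g * (\<rho> h * V) = \<rho> (g \<otimes> h) * V"
      using assoc_mult_mat[OF c V] urep_mult[OF u g h] by simp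
    finally show ?thesis by simp
  qed
  ultimately show "unitary_rep G ?\<tau>" using t by (simp add: unitary_rep_def d)
qed

lemma invariant_range:
  assumes u: "unitary_rep G \<rho>" and g: "g \<in> carrier G" and V: "V \<in> carrier_mat (deg \<rho>) k"
    and VW: "\<And>v. v \<in> carrier_vec k \<Longrightarrow> V *\<^sub>v v \<in> W"
    and proj: "\<And>w. w \<in> W \<Longrightarrow> V *\<^sub>v (mat_adjoint V *\<^sub>v w) = w"
    and inv: "\<And>w. w \<in> W \<Longrightarrow> \<rho> g *\<^sub>v w \<in> W"
  shows "\<rho> g * V = V * (mat_adjoint V * (\<rho> g * V))"
proof (rule mat_eq_by_vecI)
  note c = urep_carrier[OF u g] and V' = mat_adjoint_carrier[OF V]
  show rV: "\<rho> g * V \<in> carrier_mat (deg \<rho>) k" using c V by (rule mult_carrier_mat)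
  have m: "mat_adjoint V * (\<rho> g * V) \<in> carrier_mat k k" using V' rV by (rule mult_carrier_mat)
  thus "V * (mat_adjoint V * (\<rho> g * V)) \<in> carrier_mat (deg \<rho>) k" by (rule mult_carrier_mat[OF V])
  fix v :: "complex vec" assume v: "v \<in> carrier_vec k"
  have w: "(\<rho> g * V) *\<^sub>v v \<in> W"
    unfolding assoc_mult_mat_vec[OF c V v] using inv[OF VW[OF v]] .
  show "(\<rho> g * V) *\<^sub>v v = (V * (mat_adjoint V * (\<rho> g * V))) *\<^sub>v v"
    unfolding assoc_mult_mat_vec[OF V m v] assoc_mult_mat_vec[OF V' rV v] proj[OF w] ..
qed

text \<open>Since \<open>\<rho>(g)\<close> is the adjoint of \<open>\<rho>(g\<^sup>-\<^sup>1)\<close>, invariance of the range of \<open>V\<close> under \<open>\<rho>(g\<^sup>-\<^sup>1)\<close> passes to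
  invariance of the kernel of \<open>V\<^sup>*\<close> under \<open>\<rho>(g)\<close>.\<close>

lemma orthogonal_complement_invariant:
  assumes u: "unitary_rep G \<rho>" and g: "g \<in> carrier G" and V: "V \<in> carrier_mat (deg \<rho>) k"
    and inv: "\<And>g. g \<in> carrier G \<Longrightarrow> \<rho> g * V = V * (mat_adjoint V * (\<rho> g * V))"
    and w: "w \<in> carrier_vec (deg \<rho>)" "mat_adjoint V *\<^sub>v w = 0\<^sub>v k"
  shows "mat_adjoint V *\<^sub>v (\<rho> g *\<^sub>v w) = 0\<^sub>v k"
proof -
  have ig: "inv g \<in> carrier G" using g by simp
  note c = urep_carrier[OF u g] and ci = urep_carrier[OF u ig] and V' = mat_adjoint_carrier[OF V]
  define X where "X = mat_adjoint V * (\<rho> (inv g) * V)"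
  have X: "X \<in> carrier_mat k k"
    unfolding X_def by (rule mult_carrier_mat[OF V' mult_carrier_mat[OF ci V]])
  have "mat_adjoint (\<rho> (inv g) * V) = mat_adjoint (V * X)" using inv[OF ig] by (simp add: X_def)
  hence eq: "mat_adjoint V * \<rho> g = mat_adjoint X * mat_adjoint V"
    using mat_adjoint_mult[OF ci V] mat_adjoint_mult[OF V X] urep_inv[OF u g] by simp
  have "mat_adjoint V *\<^sub>v (\<rho> g *\<^sub>v w) = mat_adjoint X *\<^sub>v (mat_adjoint V *\<^sub>v w)"
    using assoc_mult_mat_vec[OF V' c w(1)] assoc_mult_mat_vec[OF mat_adjoint_carrier[OF X] V' w(1)] eq
    by simp
  thus ?thesis using w X by auto
qed

text \<open>An invariant subspace and its orthogonal complement carry representations of smaller degree.\<close>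

lemma reducible_decomposition:
  assumes u: "unitary_rep G \<rho>" and red: "\<not> irreducible_rep G \<rho>" and pos: "deg \<rho> > 0"
  obtains k1 k2 V1 V2 \<rho>1 \<rho>2 where "k1 < deg \<rho>" "k2 < deg \<rho>"
    "V1 \<in> carrier_mat (deg \<rho>) k1" "V2 \<in> carrier_mat (deg \<rho>) k2"
    "unitary_rep G \<rho>1" "deg \<rho>1 = k1" "unitary_rep G \<rho>2" "deg \<rho>2 = k2"
    "\<And>g. g \<in> carrier G \<Longrightarrow> \<rho> g = V1 * \<rho>1 g * mat_adjoint V1 + V2 * \<rho>2 g * mat_adjoint V2"
proof -
  let ?n = "deg \<rho>"
  have "\<exists>W. VectorSpace.subspace class_ring W (module_vec TYPE(complex) ?n) \<and>
      (\<forall>g\<in>carrier G. \<forall>w\<in>W. \<rho> g *\<^sub>v w \<in> W) \<and> W \<noteq> {0\<^sub>v ?n} \<and> W \<noteq> carrier_vec ?n"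
    using u red pos unfolding irreducible_rep_def by blast
  then obtain W where sub: "VectorSpace.subspace class_ring W (module_vec TYPE(complex) ?n)"
    and Winv: "\<forall>g\<in>carrier G. \<forall>w\<in>W. \<rho> g *\<^sub>v w \<in> W"
    and nontriv: "W \<noteq> {0\<^sub>v ?n}" "W \<noteq> carrier_vec ?n" by blast
  note sub' = sub[unfolded subspace_vec_iff]
  have Wsub: "W \<subseteq> carrier_vec ?n" and W0: "0\<^sub>v ?n \<in> W" using sub' by blast+
  obtain k1 V1 where V1: "V1 \<in> carrier_mat ?n k1" and iso1: "mat_adjoint V1 * V1 = 1\<^sub>m k1"
    and V1W: "\<And>v. v \<in> carrier_vec k1 \<Longrightarrow> V1 *\<^sub>v v \<in> W"
    and proj1: "\<And>w. w \<in> W \<Longrightarrow> V1 *\<^sub>v (mat_adjoint V1 *\<^sub>v w) = w"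
    using orthonormal_basis_of_subspace[OF sub] by metis
  note V1' = mat_adjoint_carrier[OF V1]
  have inv1: "\<rho> g * V1 = V1 * (mat_adjoint V1 * (\<rho> g * V1))" if g: "g \<in> carrier G" for g
    by (rule invariant_range[OF u g V1 V1W proj1]) (use Winv g in auto)
  obtain k2 V2 where V2: "V2 \<in> carrier_mat ?n k2" and iso2: "mat_adjoint V2 * V2 = 1\<^sub>m k2"
    and V2Z: "\<And>v. v \<in> carrier_vec k2 \<Longrightarrow> mat_adjoint V1 *\<^sub>v (V2 *\<^sub>v v) = 0\<^sub>v k1"
    and proj2: "\<And>w. w \<in> carrier_vec ?n \<Longrightarrow> mat_adjoint V1 *\<^sub>v w = 0\<^sub>v k1 \<Longrightarrow> V2 *\<^sub>v (mat_adjoint V2 *\<^sub>v w) = w"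
    and one: "V1 * mat_adjoint V1 + V2 * mat_adjoint V2 = 1\<^sub>m ?n"
    using orthonormal_basis_of_complement[OF V1 iso1] by metis
  note V2' = mat_adjoint_carrier[OF V2]
  have inv2: "\<rho> g * V2 = V2 * (mat_adjoint V2 * (\<rho> g * V2))" if g: "g \<in> carrier G" for g
  proof (rule invariant_range[OF u g V2])
    let ?Z = "{w \<in> carrier_vec ?n. mat_adjoint V1 *\<^sub>v w = 0\<^sub>v k1}"
    show "V2 *\<^sub>v v \<in> ?Z" if "v \<in> carrier_vec k2" for v
      using V2Z[OF that] mult_mat_vec_carrier[OF V2 that] by simp
    show "V2 *\<^sub>v (mat_adjoint V2 *\<^sub>v w) = w" if "w \<in> ?Z" for w using proj2 that by simp
    show "\<rho> g *\<^sub>v w \<in> ?Z" if "w \<in> ?Z" for w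
      using orthogonal_complement_invariant[OF u g V1 inv1, of w] that
        mult_mat_vec_carrier[OF urep_carrier[OF u g], of w] by simp
  qed
  let ?\<rho>1 = "\<lambda>g. mat_adjoint V1 * (\<rho> g * V1)" and ?\<rho>2 = "\<lambda>g. mat_adjoint V2 * (\<rho> g * V2)"
  note s1 = subrepresentation[OF u V1 iso1 inv1] and s2 = subrepresentation[OF u V2 iso2 inv2]
  have split: "\<rho> g = V1 * ?\<rho>1 g * mat_adjoint V1 + V2 * ?\<rho>2 g * mat_adjoint V2" if g: "g \<in> carrier G" for g
  proof -
    note c = urep_carrier[OF u g]
    have "\<rho> g = \<rho> g * (V1 * mat_adjoint V1 + V2 * mat_adjoint V2)" using c by (simp add: one)
    also have "\<dots> = \<rho> g * (V1 * mat_adjoint V1) + \<rho> g * (V2 * mat_adjoint V2)"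
      by (rule mult_add_distrib_mat[OF c mult_carrier_mat[OF V1 V1'] mult_carrier_mat[OF V2 V2']])
    also have "\<rho> g * (V1 * mat_adjoint V1) = \<rho> g * V1 * mat_adjoint V1"
      by (rule assoc_mult_mat[OF c V1 V1', symmetric])
    also have "\<rho> g * (V2 * mat_adjoint V2) = \<rho> g * V2 * mat_adjoint V2"
      by (rule assoc_mult_mat[OF c V2 V2', symmetric])
    finally show ?thesis using inv1[OF g] inv2[OF g] by simp
  qed
  have "k1 \<noteq> ?n"
  proof
    assume k: "k1 = ?n"
    have "V1 * mat_adjoint V1 = 1\<^sub>m ?n"
      using mat_mult_left_right_inverse[of "mat_adjoint V1" ?n V1] V1 V1' iso1 k by auto
    hence "w \<in> W" if w: "w \<in> carrier_vec ?n" for w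
      using assoc_mult_mat_vec[OF V1 V1' w] V1W[OF mult_mat_vec_carrier[OF V1' w]] w by simp
    with nontriv Wsub show False by blast
  qed
  moreover have "k2 \<noteq> ?n"
  proof
    assume k: "k2 = ?n"
    have P2: "V2 * mat_adjoint V2 = 1\<^sub>m ?n"
      using mat_mult_left_right_inverse[of "mat_adjoint V2" ?n V2] V2 V2' iso2 k by auto
    have "w = 0\<^sub>v ?n" if w: "w \<in> W" for w
    proof -
      have wc: "w \<in> carrier_vec ?n" using w Wsub by auto
      have "mat_adjoint V1 *\<^sub>v w = 0\<^sub>v k1"
        using assoc_mult_mat_vec[OF V2 V2' wc] V2Z[OF mult_mat_vec_carrier[OF V2' wc]] wc P2 by simp
      hence "V1 *\<^sub>v 0\<^sub>v k1 = w" using proj1[OF w] by simp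
      moreover have "V1 *\<^sub>v 0\<^sub>v k1 = 0\<^sub>v ?n" using V1 by (intro eq_vecI) auto
      ultimately show ?thesis by simp
    qed
    with nontriv W0 show False by blast
  qed
  moreover have "k1 \<le> ?n" "k2 \<le> ?n"
    using isometry_dim_le[OF V1 iso1] isometry_dim_le[OF V2 iso2] by auto
  ultimately have "k1 < ?n" "k2 < ?n" by auto
  from that[OF this V1 V2 s1 s2 split] show ?thesis .
qed

text \<open>Induction on the degree: a reducible representation splits into two of smaller degree, and its
  entries are linear combinations of theirs.\<close>

lemma vanishing_on_all_representations:
  assumes van: "\<And>\<sigma> i j. irreducible_rep G \<sigma> \<Longrightarrow> i < deg \<sigma> \<Longrightarrow> j < deg \<sigma> \<Longrightarrow>
      (\<Sum>t\<in>carrier G. \<phi> t * \<sigma> t $$ (i, j)) = 0"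
  shows "unitary_rep G \<rho> \<Longrightarrow> i < deg \<rho> \<Longrightarrow> j < deg \<rho> \<Longrightarrow> (\<Sum>t\<in>carrier G. \<phi> t * \<rho> t $$ (i, j)) = 0"
proof (induction "deg \<rho>" arbitrary: \<rho> i j rule: less_induct)
  case less
  show ?case
  proof (cases "irreducible_rep G \<rho>")
    case True
    thus ?thesis using van less by blast
  next
    case False
    have "deg \<rho> > 0" using less by simp
    obtain k1 k2 V1 V2 \<rho>1 \<rho>2 where k: "k1 < deg \<rho>" "k2 < deg \<rho>"
      and V: "V1 \<in> carrier_mat (deg \<rho>) k1" "V2 \<in> carrier_mat (deg \<rho>) k2"
      and r: "unitary_rep G \<rho>1" "deg \<rho>1 = k1" "unitary_rep G \<rho>2" "deg \<rho>2 = k2"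
      and split: "\<And>g. g \<in> carrier G \<Longrightarrow> \<rho> g = V1 * \<rho>1 g * mat_adjoint V1 + V2 * \<rho>2 g * mat_adjoint V2"
      using reducible_decomposition[OF less(2) False \<open>deg \<rho> > 0\<close>] by metis
    have part: "(\<Sum>t\<in>carrier G. \<phi> t * (V * \<tau> t * mat_adjoint V) $$ (i, j)) = 0"
      if \<tau>: "unitary_rep G \<tau>" "deg \<tau> < deg \<rho>" and V: "V \<in> carrier_mat (deg \<rho>) (deg \<tau>)" for \<tau> V
    proof -
      have "(\<Sum>t\<in>carrier G. \<phi> t * (V * \<tau> t * mat_adjoint V) $$ (i, j)) =
          (\<Sum>t\<in>carrier G. \<Sum>b<deg \<tau>. \<Sum>a<deg \<tau>. V $$ (i, a) * cnj (V $$ (j, b)) * (\<phi> t * \<tau> t $$ (a, b)))"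
        using less(3,4) by (intro sum.cong refl)
          (simp add: sandwich_index[OF V urep_carrier[OF \<tau>(1)]] sum_distrib_left mult_ac)
      also have "\<dots> = (\<Sum>b<deg \<tau>. \<Sum>a<deg \<tau>. V $$ (i, a) * cnj (V $$ (j, b)) * (\<Sum>t\<in>carrier G. \<phi> t * \<tau> t $$ (a, b)))"
        unfolding sum_distrib_left by (subst sum.swap, rule sum.cong[OF refl], rule sum.swap)
      also have "\<dots> = 0" using less(1)[OF \<tau>(2,1)] by simp
      finally show ?thesis .
    qed
    have "(\<Sum>t\<in>carrier G. \<phi> t * \<rho> t $$ (i, j)) =
        (\<Sum>t\<in>carrier G. \<phi> t * (V1 * \<rho>1 t * mat_adjoint V1) $$ (i, j) + \<phi> t * (V2 * \<rho>2 t * mat_adjoint V2) $$ (i, j))"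
      using less(3,4) V by (intro sum.cong refl) (auto simp: split distrib_left)
    also have "\<dots> = 0" using part[OF r(1)] part[OF r(3)] r k V by (simp add: sum.distrib)
    finally show ?thesis .
  qed
qed

text \<open>The coefficients of \<open>\<phi>\<close> vanish on the regular representation as well, and one of its entries picks out a
  single value of \<open>\<phi>\<close>.\<close>

lemma fourier_uniqueness:
  assumes van: "\<And>\<sigma> i j. irreducible_rep G \<sigma> \<Longrightarrow> i < deg \<sigma> \<Longrightarrow> j < deg \<sigma> \<Longrightarrow>
      (\<Sum>t\<in>carrier G. \<phi> t * cnj (\<sigma> t $$ (i, j))) = 0"
    and s: "s \<in> carrier G"
  shows "\<phi> s = 0"
proof -
  obtain e where e: "bij_betw e {..<card (carrier G)} (carrier G)"
    using ex_bij_betw_nat_finite[OF fin] by (auto simp: lessThan_atLeast0)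
  let ?N = "card (carrier G)"
  have ec: "e i \<in> carrier G" if "i < ?N" for i using e that by (auto simp: bij_betw_def)
  have einj: "e i = e j \<longleftrightarrow> i = j" if "i < ?N" "j < ?N" for i j
    using e that by (auto simp: bij_betw_def inj_on_def)
  have sum_e: "(\<Sum>l<?N. f (e l)) = (\<Sum>x\<in>carrier G. f x)" for f :: "'a \<Rightarrow> complex"
    by (rule sum.reindex_bij_betw[OF e])
  \<comment> \<open>The regular representation: its entry in the row of \<open>s\<close> and the column of the identity
    is 1 at \<open>s\<close> and 0 elsewhere.\<close>
  define \<Lambda> where "\<Lambda> g = mat ?N ?N (\<lambda>(i, j). if e i = g \<otimes> e j then 1 else 0 :: complex)" for g
  have l: "\<Lambda> g \<in> carrier_mat ?N ?N" for g by (simp add: \<Lambda>_def)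
  have d: "deg \<Lambda> = ?N" by (simp add: rep_deg_def \<Lambda>_def)
  have "\<Lambda> (g \<otimes> h) = \<Lambda> g * \<Lambda> h" if gh: "g \<in> carrier G" "h \<in> carrier G" for g h
  proof (rule eq_matI)
    fix i j assume "i < dim_row (\<Lambda> g * \<Lambda> h)" "j < dim_col (\<Lambda> g * \<Lambda> h)"
    hence ij: "i < ?N" "j < ?N" using l[of g] l[of h] by auto
    have "(\<Lambda> g * \<Lambda> h) $$ (i, j) = (\<Sum>k<?N. \<Lambda> g $$ (i, k) * \<Lambda> h $$ (k, j))"
      by (rule mult_mat_index[OF l l ij])
    also have "\<dots> = (\<Sum>k<?N. (\<lambda>x. if x = h \<otimes> e j then if e i = g \<otimes> x then 1 else 0 else 0) (e k))"
      using ij by (intro sum.cong) (auto simp: \<Lambda>_def)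
    also have "\<dots> = (\<Sum>x\<in>carrier G. if x = h \<otimes> e j then if e i = g \<otimes> x then 1 else 0 else 0)"
      by (rule sum_e)
    also have "\<dots> = \<Lambda> (g \<otimes> h) $$ (i, j)"
      using ij gh ec[of j] fin by (simp add: \<Lambda>_def m_assoc)
    finally show "\<Lambda> (g \<otimes> h) $$ (i, j) = (\<Lambda> g * \<Lambda> h) $$ (i, j)" by simp
  qed (use l[of g] l[of h] in \<open>auto simp: \<Lambda>_def\<close>)
  moreover have "mat_adjoint (\<Lambda> g) * \<Lambda> g = 1\<^sub>m ?N" if g: "g \<in> carrier G" for g
  proof (rule eq_matI)
    fix i j assume "i < dim_row (1\<^sub>m ?N :: complex mat)" "j < dim_col (1\<^sub>m ?N :: complex mat)"
    hence ij: "i < ?N" "j < ?N" by auto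
    have "(mat_adjoint (\<Lambda> g) * \<Lambda> g) $$ (i, j) = (\<Sum>k<?N. mat_adjoint (\<Lambda> g) $$ (i, k) * \<Lambda> g $$ (k, j))"
      by (rule mult_mat_index[OF mat_adjoint_carrier[OF l] l ij])
    also have "\<dots> = (\<Sum>k<?N. (\<lambda>x. if x = g \<otimes> e j then if x = g \<otimes> e i then 1 else 0 else 0) (e k))"
      using ij l[of g] by (intro sum.cong) (auto simp: \<Lambda>_def)
    also have "\<dots> = (\<Sum>x\<in>carrier G. if x = g \<otimes> e j then if x = g \<otimes> e i then 1 else 0 else 0)"
      by (rule sum_e)
    also have "\<dots> = (if g \<otimes> e j = g \<otimes> e i then 1 else 0)"
      using ij g ec[of j] fin by simp
    also have "\<dots> = 1\<^sub>m ?N $$ (i, j)" using ij g ec einj by auto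
    finally show "(mat_adjoint (\<Lambda> g) * \<Lambda> g) $$ (i, j) = 1\<^sub>m ?N $$ (i, j)" .
  qed (use l[of g] in auto)
  ultimately have u: "unitary_rep G \<Lambda>" using l d by (simp add: unitary_rep_def)
  have surj: "\<exists>i<?N. e i = x" if "x \<in> carrier G" for x
    using e that unfolding bij_betw_def image_iff by (metis imageE lessThan_iff)
  obtain i where i: "i < ?N" "e i = s" using surj[OF s] by blast
  obtain j where j: "j < ?N" "e j = \<one>" using surj[OF one_closed] by blast
  have van': "(\<Sum>t\<in>carrier G. cnj (\<phi> t) * \<sigma> t $$ (i, j)) = 0"
    if "irreducible_rep G \<sigma>" "i < deg \<sigma>" "j < deg \<sigma>" for \<sigma> i j
    using arg_cong[OF van[OF that], of cnj] by simp
  have "(\<Sum>t\<in>carrier G. cnj (\<phi> t) * \<Lambda> t $$ (i, j)) = 0"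
    by (rule vanishing_on_all_representations[OF van' u]) (use i j d in auto)
  moreover have "(\<Sum>t\<in>carrier G. cnj (\<phi> t) * \<Lambda> t $$ (i, j)) = (\<Sum>t\<in>carrier G. if t = s then cnj (\<phi> t) else 0)"
    using i j by (intro sum.cong) (auto simp: \<Lambda>_def)
  ultimately show ?thesis using s fin by simp
qed

end

lemma map_mat_cnj_mult:
  fixes A B :: "complex mat"
  assumes "A \<in> carrier_mat n m" "B \<in> carrier_mat m k"
  shows "map_mat cnj (A * B) = map_mat cnj A * map_mat cnj B"
  by (rule eq_matI) (use assms in \<open>auto simp: scalar_prod_def\<close>)

lemma map_mat_cnj_adjoint:
  fixes A :: "complex mat"
  shows "mat_adjoint (map_mat cnj A) = map_mat cnj (mat_adjoint A)"
  by (rule eq_matI) auto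

context fin_group
begin

section \<open>Equivalence classes of irreducible representations\<close>

lemma rep_equiv_refl:
  assumes "unitary_rep G \<rho>" shows "rep_equiv G \<rho> \<rho>"
proof -
  have "\<rho> g * 1\<^sub>m (deg \<rho>) = 1\<^sub>m (deg \<rho>) * \<rho> g" if "g \<in> carrier G" for g
    using urep_carrier[OF assms that] by simp
  thus ?thesis
    unfolding rep_equiv_def by (intro conjI refl bexI[of _ "1\<^sub>m (deg \<rho>)"]) auto
qed

lemma rep_equiv_sym:
  assumes u: "unitary_rep G \<rho>" "unitary_rep G \<sigma>" and "rep_equiv G \<rho> \<sigma>"
  shows "rep_equiv G \<sigma> \<rho>"
proof -
  obtain U where d: "deg \<rho> = deg \<sigma>" and U: "U \<in> carrier_mat (deg \<rho>) (deg \<rho>)"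
    "mat_adjoint U * U = 1\<^sub>m (deg \<rho>)" "\<And>g. g \<in> carrier G \<Longrightarrow> \<sigma> g * U = U * \<rho> g"
    using assms(3) by (auto simp: rep_equiv_def)
  have "U * mat_adjoint U = 1\<^sub>m (deg \<rho>)"
    by (rule mat_mult_left_right_inverse[OF mat_adjoint_carrier[OF U(1)] U(1,2)])
  moreover have "\<rho> g * mat_adjoint U = mat_adjoint U * \<sigma> g" if "g \<in> carrier G" for g
    using urep_intertwine_adjoint[OF u _ _ that, of U] U d by simp
  ultimately show ?thesis
    using d mat_adjoint_carrier[OF U(1)] unfolding rep_equiv_def
    by (intro conjI bexI[of _ "mat_adjoint U"]) auto
qed

lemma rep_equiv_trans:
  assumes u: "unitary_rep G \<rho>" "unitary_rep G \<sigma>" "unitary_rep G \<tau>"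
    and "rep_equiv G \<rho> \<sigma>" "rep_equiv G \<sigma> \<tau>"
  shows "rep_equiv G \<rho> \<tau>"
proof -
  let ?n = "deg \<rho>"
  obtain U where d: "deg \<rho> = deg \<sigma>" and U: "U \<in> carrier_mat ?n ?n"
    "mat_adjoint U * U = 1\<^sub>m ?n" "\<And>g. g \<in> carrier G \<Longrightarrow> \<sigma> g * U = U * \<rho> g"
    using assms(4) by (auto simp: rep_equiv_def)
  obtain V where d': "deg \<sigma> = deg \<tau>" and V: "V \<in> carrier_mat ?n ?n"
    "mat_adjoint V * V = 1\<^sub>m ?n" "\<And>g. g \<in> carrier G \<Longrightarrow> \<tau> g * V = V * \<sigma> g"
    using assms(5) d by (auto simp: rep_equiv_def)
  note U' = mat_adjoint_carrier[OF U(1)] and V' = mat_adjoint_carrier[OF V(1)]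
  have VU: "V * U \<in> carrier_mat ?n ?n" using V U by auto
  have "mat_adjoint (V * U) * (V * U) = mat_adjoint U * (mat_adjoint V * (V * U))"
    using mat_adjoint_mult[OF V(1) U(1)] assoc_mult_mat[OF U' V' VU] by simp
  also have "mat_adjoint V * (V * U) = U" using assoc_mult_mat[OF V' V(1) U(1)] V(2) U(1) by simp
  finally have 1: "mat_adjoint (V * U) * (V * U) = 1\<^sub>m ?n" using U(2) by simp
  have 2: "\<tau> g * (V * U) = V * U * \<rho> g" if g: "g \<in> carrier G" for g
  proof -
    have c: "\<rho> g \<in> carrier_mat ?n ?n" "\<sigma> g \<in> carrier_mat ?n ?n" "\<tau> g \<in> carrier_mat ?n ?n"
      using urep_carrier[OF u(1) g] urep_carrier[OF u(2) g] urep_carrier[OF u(3) g] d d' by auto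
    have "\<tau> g * (V * U) = V * \<sigma> g * U" using assoc_mult_mat[OF c(3) V(1) U(1)] V(3)[OF g] by simp
    also have "\<dots> = V * (U * \<rho> g)" using assoc_mult_mat[OF V(1) c(2) U(1)] U(3)[OF g] by simp
    finally show ?thesis using assoc_mult_mat[OF V(1) U(1) c(1)] by simp
  qed
  show ?thesis
    unfolding rep_equiv_def using d d' VU 1 2 by (intro conjI bexI[of _ "V * U"]) auto
qed

lemma equiv_irrep_rel: "equiv {\<rho>. irreducible_rep G \<rho>} (irrep_rel G)"
proof (rule equivI)
  show "refl_on {\<rho>. irreducible_rep G \<rho>} (irrep_rel G)"
    by (auto simp: refl_on_def irrep_rel_def intro: rep_equiv_refl irrep_unitary)
  show "sym (irrep_rel G)"
    by (auto simp: sym_def irrep_rel_def intro: rep_equiv_sym irrep_unitary)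
  show "trans (irrep_rel G)"
    unfolding trans_def irrep_rel_def by (blast intro: rep_equiv_trans irrep_unitary)
qed (auto simp: irrep_rel_def)

abbreviation rep_class :: "'a rep \<Rightarrow> 'a rep set" where
  "rep_class \<rho> \<equiv> irrep_rel G `` {\<rho>}"

lemma rep_class_in_dual: "irreducible_rep G \<rho> \<Longrightarrow> rep_class \<rho> \<in> dual_group G"
  by (simp add: dual_group_def quotientI)

lemma in_rep_class: "irreducible_rep G \<rho> \<Longrightarrow> \<rho> \<in> rep_class \<rho>"
  by (auto simp: irrep_rel_def intro: rep_equiv_refl irrep_unitary)

lemma dual_class_eq:
  assumes "\<pi> \<in> dual_group G" "\<rho> \<in> \<pi>"
  shows "\<pi> = rep_class \<rho>" "irreducible_rep G \<rho>"
proof -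
  obtain \<sigma> where \<sigma>: "irreducible_rep G \<sigma>" "\<pi> = rep_class \<sigma>"
    using assms(1) by (auto simp: dual_group_def elim: quotientE)
  with assms(2) have r: "(\<sigma>, \<rho>) \<in> irrep_rel G" by auto
  thus "\<pi> = rep_class \<rho>" using \<sigma> equiv_class_eq[OF equiv_irrep_rel] by blast
  show "irreducible_rep G \<rho>" using r by (auto simp: irrep_rel_def)
qed

lemma some_rep_in: "\<pi> \<in> dual_group G \<Longrightarrow> some_rep \<pi> \<in> \<pi>"
proof -
  assume "\<pi> \<in> dual_group G"
  then obtain \<sigma> where "irreducible_rep G \<sigma>" "\<pi> = rep_class \<sigma>"
    by (auto simp: dual_group_def elim: quotientE)
  hence "\<sigma> \<in> \<pi>" using in_rep_class by simp
  thus ?thesis unfolding some_rep_def by (rule someI[of "\<lambda>\<rho>. \<rho> \<in> \<pi>"])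
qed

lemma dual_equiv:
  assumes "\<pi> \<in> dual_group G" "\<rho> \<in> \<pi>" "\<sigma> \<in> \<pi>"
  shows "rep_equiv G \<rho> \<sigma>"
  using dual_class_eq[OF assms(1,2)] assms(3) by (auto simp: irrep_rel_def)

lemma dual_inequiv:
  assumes "\<pi> \<in> dual_group G" "\<pi>' \<in> dual_group G" "\<pi> \<noteq> \<pi>'" "\<rho> \<in> \<pi>" "\<sigma> \<in> \<pi>'"
  shows "\<not> rep_equiv G \<rho> \<sigma>"
proof
  assume "rep_equiv G \<rho> \<sigma>"
  hence "(\<rho>, \<sigma>) \<in> irrep_rel G"
    using dual_class_eq(2)[OF assms(1,4)] dual_class_eq(2)[OF assms(2,5)] by (simp add: irrep_rel_def)
  hence "rep_class \<rho> = rep_class \<sigma>" by (rule equiv_class_eq[OF equiv_irrep_rel])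
  thus False using assms dual_class_eq(1)[OF assms(1,4)] dual_class_eq(1)[OF assms(2,5)] by simp
qed

section \<open>Characters and central idempotents\<close>

definition character :: "'a rep \<Rightarrow> 'a \<Rightarrow> complex" where
  "character \<rho> g = (\<Sum>i<deg \<rho>. \<rho> g $$ (i, i))"

lemma character_equiv:
  assumes u: "unitary_rep G \<rho>" "unitary_rep G \<sigma>" and eq: "rep_equiv G \<rho> \<sigma>" and g: "g \<in> carrier G"
  shows "character \<rho> g = character \<sigma> g"
proof -
  let ?n = "deg \<rho>"
  obtain U where d: "deg \<rho> = deg \<sigma>" and U: "U \<in> carrier_mat ?n ?n"
    "mat_adjoint U * U = 1\<^sub>m ?n" "\<sigma> g * U = U * \<rho> g"
    using eq g by (auto simp: rep_equiv_def)
  note U' = mat_adjoint_carrier[OF U(1)] and c = urep_carrier[OF u(1) g]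
  have c': "\<sigma> g \<in> carrier_mat ?n ?n" using urep_carrier[OF u(2) g] d by simp
  have "U * mat_adjoint U = 1\<^sub>m ?n" by (rule mat_mult_left_right_inverse[OF U' U(1,2)])
  hence \<sigma>: "\<sigma> g = U * \<rho> g * mat_adjoint U"
    using assoc_mult_mat[OF c' U(1) U'] c' U(3) by simp
  have "character \<sigma> g = (\<Sum>i<?n. \<Sum>b<?n. \<Sum>a<?n. U $$ (i, a) * \<rho> g $$ (a, b) * cnj (U $$ (i, b)))"
    unfolding character_def d[symmetric] by (intro sum.cong refl) (simp add: \<sigma> sandwich_index[OF U(1) c])
  also have "\<dots> = (\<Sum>b<?n. \<Sum>i<?n. \<Sum>a<?n. U $$ (i, a) * \<rho> g $$ (a, b) * cnj (U $$ (i, b)))"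
    by (rule sum.swap)
  also have "\<dots> = (\<Sum>b<?n. \<Sum>a<?n. \<Sum>i<?n. U $$ (i, a) * \<rho> g $$ (a, b) * cnj (U $$ (i, b)))"
    by (intro sum.cong refl sum.swap)
  also have "\<dots> = (\<Sum>b<?n. \<Sum>a<?n. \<rho> g $$ (a, b) * (mat_adjoint U * U) $$ (b, a))"
  proof (intro sum.cong refl)
    fix a b assume "b \<in> {..<?n}" "a \<in> {..<?n}"
    hence "(mat_adjoint U * U) $$ (b, a) = (\<Sum>i<?n. mat_adjoint U $$ (b, i) * U $$ (i, a))"
      by (intro mult_mat_index[OF U' U(1)]) auto
    also have "\<dots> = (\<Sum>i<?n. cnj (U $$ (i, b)) * U $$ (i, a))"
      using \<open>b \<in> {..<?n}\<close> U(1) by (intro sum.cong refl) auto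
    finally show "(\<Sum>i<?n. U $$ (i, a) * \<rho> g $$ (a, b) * cnj (U $$ (i, b))) =
        \<rho> g $$ (a, b) * (mat_adjoint U * U) $$ (b, a)"
      by (simp add: sum_distrib_left mult_ac)
  qed
  also have "\<dots> = (\<Sum>b<?n. \<Sum>a<?n. if a = b then \<rho> g $$ (b, b) else 0)"
    unfolding U(2) by (intro sum.cong refl) auto
  also have "\<dots> = character \<rho> g" by (simp add: character_def)
  finally show ?thesis by simp
qed

lemma character_one: "unitary_rep G \<rho> \<Longrightarrow> character \<rho> \<one> = of_nat (deg \<rho>)"
  by (simp add: character_def urep_one)

lemma character_inv: "unitary_rep G \<rho> \<Longrightarrow> g \<in> carrier G \<Longrightarrow> character \<rho> (inv g) = cnj (character \<rho> g)"
  by (simp add: character_def urep_inv_index)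

lemma character_mult_inv:
  assumes u: "unitary_rep G \<rho>" and g: "g \<in> carrier G" and h: "h \<in> carrier G"
  shows "character \<rho> (inv g \<otimes> h) = (\<Sum>i<deg \<rho>. \<Sum>l<deg \<rho>. cnj (\<rho> g $$ (l, i)) * \<rho> h $$ (l, i))"
  using g h by (simp add: character_def urep_mult_index[OF u] urep_inv_index[OF u])

lemma character_central:
  assumes u: "unitary_rep G \<rho>" and g: "g \<in> carrier G" and h: "h \<in> carrier G"
  shows "character \<rho> (g \<otimes> h) = character \<rho> (h \<otimes> g)"
proof -
  have "character \<rho> (g \<otimes> h) = (\<Sum>i<deg \<rho>. \<Sum>l<deg \<rho>. \<rho> g $$ (i, l) * \<rho> h $$ (l, i))"
    using g h by (simp add: character_def urep_mult_index[OF u])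
  also have "\<dots> = (\<Sum>l<deg \<rho>. \<Sum>i<deg \<rho>. \<rho> h $$ (l, i) * \<rho> g $$ (i, l))"
    by (subst sum.swap) (simp add: mult.commute)
  also have "\<dots> = character \<rho> (h \<otimes> g)"
    using g h by (simp add: character_def urep_mult_index[OF u])
  finally show ?thesis .
qed

text \<open>The minimal central idempotent of the convolution algebra that belongs to \<open>\<pi>\<close>.\<close>

definition idem :: "'a rep set \<Rightarrow> 'a \<Rightarrow> complex" where
  "idem \<pi> g = of_nat (class_deg G \<pi>) / of_nat (card (carrier G)) * character (some_rep \<pi>) g"

lemma idem_rep:
  assumes "\<pi> \<in> dual_group G" "\<rho> \<in> \<pi>" "g \<in> carrier G"
  shows "idem \<pi> g = of_nat (deg \<rho>) / of_nat (card (carrier G)) * character \<rho> g"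
proof -
  note s = some_rep_in[OF assms(1)]
  have e: "rep_equiv G (some_rep \<pi>) \<rho>" by (rule dual_equiv[OF assms(1) s assms(2)])
  hence d: "deg (some_rep \<pi>) = deg \<rho>" by (simp add: rep_equiv_def)
  have "unitary_rep G (some_rep \<pi>)" "unitary_rep G \<rho>"
    using dual_class_eq(2)[OF assms(1)] s assms(2) irrep_unitary by auto
  thus ?thesis
    using character_equiv[OF _ _ e assms(3)] by (simp add: idem_def class_deg_def d)
qed

text \<open>By the orthogonality relations, the Fourier coefficient of \<open>idem \<pi>'\<close> at a representative of \<open>\<pi>\<close> is the
  identity matrix or zero. This is the source of all later computations with the functions \<open>idem\<close>.\<close>

lemma idem_fourier:
  assumes \<pi>: "\<pi> \<in> dual_group G" and \<pi>': "\<pi>' \<in> dual_group G" and \<sigma>: "\<sigma> \<in> \<pi>" and ij: "i < deg \<sigma>" "j < deg \<sigma>"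
  shows "(\<Sum>g\<in>carrier G. idem \<pi>' g * cnj (\<sigma> g $$ (i, j))) = (if \<pi>' = \<pi> \<and> i = j then 1 else 0)"
proof -
  have swap: "(\<Sum>g\<in>carrier G. idem \<pi>' g * cnj (\<sigma> g $$ (i, j))) =
      of_nat (deg \<rho>) / of_nat (card (carrier G)) *
      (\<Sum>k<deg \<rho>. \<Sum>g\<in>carrier G. \<rho> g $$ (k, k) * cnj (\<sigma> g $$ (i, j)))" if "\<rho> \<in> \<pi>'" for \<rho>
  proof -
    have "(\<Sum>g\<in>carrier G. idem \<pi>' g * cnj (\<sigma> g $$ (i, j))) =
        (\<Sum>g\<in>carrier G. of_nat (deg \<rho>) / of_nat (card (carrier G)) *
          (\<Sum>k<deg \<rho>. \<rho> g $$ (k, k) * cnj (\<sigma> g $$ (i, j))))"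
      by (intro sum.cong refl) (simp add: idem_rep[OF \<pi>' that] character_def sum_distrib_right)
    also have "\<dots> = of_nat (deg \<rho>) / of_nat (card (carrier G)) *
        (\<Sum>g\<in>carrier G. \<Sum>k<deg \<rho>. \<rho> g $$ (k, k) * cnj (\<sigma> g $$ (i, j)))"
      by (rule sum_distrib_left[symmetric])
    finally show ?thesis by (subst (asm) sum.swap)
  qed
  note irr = dual_class_eq(2)[OF \<pi> \<sigma>]
  show ?thesis
  proof (cases "\<pi>' = \<pi>")
    case True
    have "(\<Sum>k<deg \<sigma>. \<Sum>g\<in>carrier G. \<sigma> g $$ (k, k) * cnj (\<sigma> g $$ (i, j))) =
        (\<Sum>k<deg \<sigma>. if k = i then if i = j then of_nat (card (carrier G)) / of_nat (deg \<sigma>) else 0 else 0)"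
      using ij by (intro sum.cong refl) (auto simp: schur_orthogonality[OF irr])
    also have "\<dots> = (if i = j then of_nat (card (carrier G)) / of_nat (deg \<sigma>) else 0)"
      using ij by simp
    finally show ?thesis
      using True card_pos irrep_deg_pos[OF irr] swap[of \<sigma>] \<sigma> by simp
  next
    case False
    note s = some_rep_in[OF \<pi>']
    note irr' = dual_class_eq(2)[OF \<pi>' s]
    have "\<not> rep_equiv G \<sigma> (some_rep \<pi>')"
      using dual_inequiv[OF \<pi> \<pi>' _ \<sigma> s] False by blast
    from schur_orthogonality_inequivalent[OF irr irr' this] ij
    show ?thesis using False by (simp add: swap[OF s])
  qed
qed

lemma idem_one: "\<pi> \<in> dual_group G \<Longrightarrow> idem \<pi> \<one> = of_real ((real (class_deg G \<pi>))\<^sup>2 / card (carrier G))"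
  using character_one[OF irrep_unitary[OF dual_class_eq(2)[OF _ some_rep_in], of \<pi>]]
  by (simp add: idem_def class_deg_def power2_eq_square)

lemma idem_inv: "\<pi> \<in> dual_group G \<Longrightarrow> g \<in> carrier G \<Longrightarrow> idem \<pi> (inv g) = cnj (idem \<pi> g)"
  using character_inv[OF irrep_unitary[OF dual_class_eq(2)[OF _ some_rep_in], of \<pi>]]
  by (simp add: idem_def)

lemma idem_central:
  "\<pi> \<in> dual_group G \<Longrightarrow> g \<in> carrier G \<Longrightarrow> h \<in> carrier G \<Longrightarrow> idem \<pi> (g \<otimes> h) = idem \<pi> (h \<otimes> g)"
  using character_central[OF irrep_unitary[OF dual_class_eq(2)[OF _ some_rep_in], of \<pi>]]
  by (simp add: idem_def)

text \<open>Expanding the character at \<open>y\<^sup>-\<^sup>1 x\<close> into matrix entries reduces the convolution to Fourier coefficients.\<close>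

lemma idem_convolution:
  assumes \<pi>: "\<pi> \<in> dual_group G" and \<pi>': "\<pi>' \<in> dual_group G" and x: "x \<in> carrier G"
  shows "(\<Sum>y\<in>carrier G. idem \<pi> y * idem \<pi>' (inv y \<otimes> x)) = (if \<pi> = \<pi>' then idem \<pi> x else 0)"
proof -
  note s = some_rep_in[OF \<pi>']
  define \<sigma> where "\<sigma> = some_rep \<pi>'"
  have \<sigma>: "\<sigma> \<in> \<pi>'" using s by (simp add: \<sigma>_def)
  note u = irrep_unitary[OF dual_class_eq(2)[OF \<pi>' \<sigma>]]
  let ?c = "of_nat (deg \<sigma>) / of_nat (card (carrier G)) :: complex"
  have "(\<Sum>y\<in>carrier G. idem \<pi> y * idem \<pi>' (inv y \<otimes> x)) =
      (\<Sum>y\<in>carrier G. ?c * (\<Sum>i<deg \<sigma>. \<Sum>l<deg \<sigma>. \<sigma> x $$ (l, i) * (idem \<pi> y * cnj (\<sigma> y $$ (l, i)))))"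
    using x by (intro sum.cong refl)
      (simp add: idem_rep[OF \<pi>' \<sigma>] character_mult_inv[OF u] sum_distrib_left mult_ac)
  also have "\<dots> = ?c * (\<Sum>y\<in>carrier G. \<Sum>i<deg \<sigma>. \<Sum>l<deg \<sigma>. \<sigma> x $$ (l, i) * (idem \<pi> y * cnj (\<sigma> y $$ (l, i))))"
    by (rule sum_distrib_left[symmetric])
  also have "(\<Sum>y\<in>carrier G. \<Sum>i<deg \<sigma>. \<Sum>l<deg \<sigma>. \<sigma> x $$ (l, i) * (idem \<pi> y * cnj (\<sigma> y $$ (l, i)))) =
      (\<Sum>i<deg \<sigma>. \<Sum>l<deg \<sigma>. \<sigma> x $$ (l, i) * (\<Sum>y\<in>carrier G. idem \<pi> y * cnj (\<sigma> y $$ (l, i))))"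
    unfolding sum_distrib_left by (subst sum.swap, rule sum.cong[OF refl], rule sum.swap)
  also have "\<dots> = (\<Sum>i<deg \<sigma>. \<Sum>l<deg \<sigma>. if l = i then if \<pi> = \<pi>' then \<sigma> x $$ (i, i) else 0 else 0)"
    by (intro sum.cong refl) (auto simp: idem_fourier[OF \<pi>' \<pi> \<sigma>])
  also have "?c * \<dots> = (if \<pi> = \<pi>' then idem \<pi> x else 0)"
    using idem_rep[OF \<pi>' \<sigma> x] by (simp add: character_def)
  finally show ?thesis .
qed

section \<open>Finiteness of the dual\<close>

lemma class_deg_pos: "\<pi> \<in> dual_group G \<Longrightarrow> class_deg G \<pi> > 0"
  using irrep_deg_pos[OF dual_class_eq(2)[OF _ some_rep_in], of \<pi>] by (simp add: class_deg_def)

lemma sum_delta_one: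
  fixes f :: "'a \<Rightarrow> complex"
  shows "(\<Sum>x\<in>carrier G. (if x = \<one> then 1 else 0) * f x) = f \<one>"
    and "(\<Sum>x\<in>carrier G. f x * (if x = \<one> then 1 else 0)) = f \<one>"
proof -
  have "(\<Sum>x\<in>carrier G. f x * (if x = \<one> then 1 else 0)) = (\<Sum>x\<in>carrier G. if x = \<one> then f x else 0)"
    by (intro sum.cong) auto
  thus 1: "(\<Sum>x\<in>carrier G. f x * (if x = \<one> then 1 else 0)) = f \<one>" using fin by simp
  show "(\<Sum>x\<in>carrier G. (if x = \<one> then 1 else 0) * f x) = f \<one>"
    unfolding 1[symmetric] by (simp only: mult.commute)
qed

text \<open>Finiteness of the dual: the point mass at the identity minus the idempotents of \<open>S\<close> is a self-adjoint
  idempotent, so its value \<open>1 - \<Sum> d\<^sub>\<pi>\<^sup>2 / |G|\<close> at the identity is nonnegative.\<close>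

lemma card_dual_subset:
  assumes S: "S \<subseteq> dual_group G" "finite S"
  shows "card S \<le> card (carrier G)"
proof -
  define P where "P x = (\<Sum>\<pi>\<in>S. idem \<pi> x)" for x
  \<comment> \<open>A self-adjoint idempotent for convolution, so its value at the identity is a sum of squares.\<close>
  define f where "f x = (if x = \<one> then 1 else 0) - P x" for x
  have Pc: "P (inv x) = cnj (P x)" if "x \<in> carrier G" for x
    using S that by (auto simp: P_def intro!: sum.cong idem_inv)
  have fc: "f (inv x) = cnj (f x)" if "x \<in> carrier G" for x
    using Pc[OF that] that by (auto simp: f_def inv_eq_1_iff)
  have PP: "(\<Sum>x\<in>carrier G. P x * P (inv x)) = P \<one>"
  proof -
    have "(\<Sum>x\<in>carrier G. P x * P (inv x)) =
        (\<Sum>x\<in>carrier G. \<Sum>\<pi>\<in>S. \<Sum>\<pi>'\<in>S. idem \<pi> x * idem \<pi>' (inv x \<otimes> \<one>))"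
      by (intro sum.cong refl) (simp add: P_def sum_product)
    also have "\<dots> = (\<Sum>\<pi>\<in>S. \<Sum>\<pi>'\<in>S. \<Sum>x\<in>carrier G. idem \<pi> x * idem \<pi>' (inv x \<otimes> \<one>))"
      by (subst sum.swap, rule sum.cong[OF refl], rule sum.swap)
    also have "\<dots> = (\<Sum>\<pi>\<in>S. \<Sum>\<pi>'\<in>S. if \<pi> = \<pi>' then idem \<pi> \<one> else 0)"
      using S by (intro sum.cong refl idem_convolution) auto
    finally show ?thesis using S by (simp add: P_def)
  qed
  have "complex_of_real (\<Sum>x\<in>carrier G. (cmod (f x))\<^sup>2) = (\<Sum>x\<in>carrier G. f x * f (inv x))"
    by (simp add: fc complex_norm_square del: of_real_power)
  also have "\<dots> = (\<Sum>x\<in>carrier G. (if x = \<one> then 1 else 0) * ((if inv x = \<one> then 1 else 0) - P (inv x))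
      - P x * (if x = \<one> then 1 else 0) + P x * P (inv x))"
    by (intro sum.cong refl) (auto simp: f_def algebra_simps)
  also have "\<dots> = 1 - P \<one>"
    by (simp only: sum.distrib sum_subtractf sum_delta_one PP) simp
  also have "P \<one> = complex_of_real (\<Sum>\<pi>\<in>S. (real (class_deg G \<pi>))\<^sup>2 / card (carrier G))"
    using S by (auto simp: P_def idem_one simp del: of_real_divide of_real_power intro!: sum.cong)
  finally have "complex_of_real (\<Sum>x\<in>carrier G. (cmod (f x))\<^sup>2) =
      complex_of_real (1 - (\<Sum>\<pi>\<in>S. (real (class_deg G \<pi>))\<^sup>2 / card (carrier G)))"
    by simp
  hence eq: "(\<Sum>x\<in>carrier G. (cmod (f x))\<^sup>2) = 1 - (\<Sum>\<pi>\<in>S. (real (class_deg G \<pi>))\<^sup>2 / card (carrier G))"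
    by (simp only: of_real_eq_iff)
  have "real (card S) / card (carrier G) = (\<Sum>\<pi>\<in>S. 1\<^sup>2 / card (carrier G))" by simp
  also have "\<dots> \<le> (\<Sum>\<pi>\<in>S. (real (class_deg G \<pi>))\<^sup>2 / card (carrier G))"
  proof (intro sum_mono divide_right_mono power_mono)
    fix \<pi> assume "\<pi> \<in> S"
    with class_deg_pos[of \<pi>] S show "1 \<le> real (class_deg G \<pi>)" by auto
  qed auto
  also have "\<dots> \<le> 1" using eq sum_nonneg[of "carrier G" "\<lambda>x. (cmod (f x))\<^sup>2"] by simp
  finally show ?thesis using card_pos by (simp add: field_simps)
qed

lemma finite_dual: "finite (dual_group G)"
  using finite_if_finite_subsets_card_bdd[of "dual_group G" "card (carrier G)"] card_dual_subset by blast


section \<open>Conjugate representations\<close>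

lemma conj_rep_deg: "unitary_rep G \<rho> \<Longrightarrow> deg (conj_rep \<rho>) = deg \<rho>"
  by (simp add: conj_rep_def rep_deg_def)

lemma conj_rep_unitary:
  assumes u: "unitary_rep G \<rho>" shows "unitary_rep G (conj_rep \<rho>)"
proof -
  have "mat_adjoint (conj_rep \<rho> g) * conj_rep \<rho> g = 1\<^sub>m (deg \<rho>)" if g: "g \<in> carrier G" for g
  proof -
    note c = urep_carrier[OF u g]
    have "mat_adjoint (conj_rep \<rho> g) * conj_rep \<rho> g = map_mat cnj (1\<^sub>m (deg \<rho>))"
      unfolding conj_rep_def map_mat_cnj_adjoint urep_adjoint_mult[OF u g, symmetric]
      by (rule map_mat_cnj_mult[OF mat_adjoint_carrier[OF c] c, symmetric])
    also have "\<dots> = 1\<^sub>m (deg \<rho>)" by (rule eq_matI) auto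
    finally show ?thesis .
  qed
  moreover have "conj_rep \<rho> (g \<otimes> h) = conj_rep \<rho> g * conj_rep \<rho> h"
    if "g \<in> carrier G" "h \<in> carrier G" for g h
    unfolding conj_rep_def urep_mult[OF u that]
    by (rule map_mat_cnj_mult[OF urep_carrier[OF u that(1)] urep_carrier[OF u that(2)]])
  moreover have "conj_rep \<rho> g \<in> carrier_mat (deg \<rho>) (deg \<rho>)" if "g \<in> carrier G" for g
    using urep_carrier[OF u that] by (simp add: conj_rep_def)
  ultimately show ?thesis by (simp add: unitary_rep_def conj_rep_deg[OF u])
qed

lemma conj_conj_rep: "conj_rep (conj_rep \<rho>) = \<rho>"
  by (rule ext, rule eq_matI) (auto simp: conj_rep_def)

lemma conj_rep_irreducible:
  assumes irr: "irreducible_rep G \<rho>" shows "irreducible_rep G (conj_rep \<rho>)"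
proof -
  let ?n = "deg \<rho>"
  note u = irrep_unitary[OF irr]
  note d = conj_rep_deg[OF u]
  have "W = {0\<^sub>v ?n} \<or> W = carrier_vec ?n"
    if sub: "VectorSpace.subspace class_ring W (module_vec TYPE(complex) ?n)"
    and inv: "\<forall>g\<in>carrier G. \<forall>w\<in>W. conj_rep \<rho> g *\<^sub>v w \<in> W" for W
  proof -
    note sub' = sub[unfolded subspace_vec_iff]
    define W' where "W' = {v \<in> carrier_vec ?n. conjugate v \<in> W}"
    have "W' = {0\<^sub>v ?n} \<or> W' = carrier_vec ?n"
    proof (rule irrep_invariant_subspace[OF irr])
      show "0\<^sub>v ?n \<in> W'" using sub' by (simp add: W'_def)
      show "v + w \<in> W'" if "v \<in> W'" "w \<in> W'" for v w
        using that sub' conjugate_add_vec[of v ?n w] by (simp add: W'_def)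
      show "c \<cdot>\<^sub>v v \<in> W'" if "v \<in> W'" for c v
        using that sub' by (simp add: W'_def conjugate_smult_vec)
      fix g w assume g: "g \<in> carrier G" and w: "w \<in> W'"
      note c = urep_carrier[OF u g]
      have wc: "w \<in> carrier_vec ?n" using w by (simp add: W'_def)
      have "conjugate (\<rho> g *\<^sub>v w) = conj_rep \<rho> g *\<^sub>v conjugate w"
        using c wc by (intro eq_vecI) (auto simp: conj_rep_def scalar_prod_def)
      moreover have "conj_rep \<rho> g *\<^sub>v conjugate w \<in> W" using inv g w by (simp add: W'_def)
      ultimately show "\<rho> g *\<^sub>v w \<in> W'" using mult_mat_vec_carrier[OF c wc] by (simp add: W'_def)
    qed (auto simp: W'_def)
    moreover have W: "w \<in> W \<longleftrightarrow> conjugate w \<in> W'" if "w \<in> carrier_vec ?n" for w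
      using that by (simp add: W'_def)
    moreover have "W = {0\<^sub>v ?n}" if "W' = {0\<^sub>v ?n}"
    proof -
      have "w = 0\<^sub>v ?n" if "w \<in> W" for w
      proof -
        have "w \<in> carrier_vec ?n" using that sub' by blast
        hence "conjugate w = 0\<^sub>v ?n" using W that \<open>W' = {0\<^sub>v ?n}\<close> by blast
        thus ?thesis using \<open>w \<in> carrier_vec ?n\<close> by simp
      qed
      thus ?thesis using sub' by blast
    qed
    moreover have "W = carrier_vec ?n" if "W' = carrier_vec ?n"
      using that sub' W by (metis carrier_vec_conjugate subsetI subset_antisym)
    ultimately show ?thesis by blast
  qed
  thus ?thesis
    using irrep_deg_pos[OF irr] conj_rep_unitary[OF u] by (simp add: irreducible_rep_def d)
qed

lemma conj_rep_equiv:
  assumes u: "unitary_rep G \<rho>" "unitary_rep G \<sigma>" and eq: "rep_equiv G \<rho> \<sigma>"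
  shows "rep_equiv G (conj_rep \<rho>) (conj_rep \<sigma>)"
proof -
  let ?n = "deg \<rho>"
  obtain U where d: "deg \<rho> = deg \<sigma>" and U: "U \<in> carrier_mat ?n ?n"
    "mat_adjoint U * U = 1\<^sub>m ?n" "\<And>g. g \<in> carrier G \<Longrightarrow> \<sigma> g * U = U * \<rho> g"
    using eq by (auto simp: rep_equiv_def)
  let ?U = "map_mat cnj U"
  have "mat_adjoint ?U * ?U = map_mat cnj (1\<^sub>m ?n)"
    unfolding map_mat_cnj_adjoint U(2)[symmetric]
    by (rule map_mat_cnj_mult[OF mat_adjoint_carrier[OF U(1)] U(1), symmetric])
  also have "\<dots> = 1\<^sub>m ?n" by (rule eq_matI) auto
  finally have "mat_adjoint ?U * ?U = 1\<^sub>m ?n" .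
  moreover have "conj_rep \<sigma> g * ?U = ?U * conj_rep \<rho> g" if g: "g \<in> carrier G" for g
    using map_mat_cnj_mult[OF _ U(1), of "\<sigma> g"] urep_carrier[OF u(2) g] d
      map_mat_cnj_mult[OF U(1) urep_carrier[OF u(1) g]] U(3)[OF g]
    by (simp add: conj_rep_def)
  moreover have "?U \<in> carrier_mat ?n ?n" using U(1) by simp
  ultimately show ?thesis
    using d unfolding rep_equiv_def conj_rep_deg[OF u(1)] conj_rep_deg[OF u(2)] by blast
qed

text \<open>The class of the conjugate can be computed from any representative.\<close>

lemma conj_class_rep:
  assumes "\<pi> \<in> dual_group G" "\<rho> \<in> \<pi>"
  shows "conj_class G \<pi> = rep_class (conj_rep \<rho>)"
proof -
  have eq: "rep_class (conj_rep \<sigma>) = rep_class (conj_rep \<rho>)" if "\<sigma> \<in> \<pi>" for \<sigma>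
  proof (rule equiv_class_eq[OF equiv_irrep_rel])
    note i = dual_class_eq(2)[OF assms(1) that] dual_class_eq(2)[OF assms]
    show "(conj_rep \<sigma>, conj_rep \<rho>) \<in> irrep_rel G"
      using conj_rep_equiv[OF irrep_unitary[OF i(1)] irrep_unitary[OF i(2)] dual_equiv[OF assms(1) that assms(2)]]
        conj_rep_irreducible[OF i(1)] conj_rep_irreducible[OF i(2)]
      by (simp add: irrep_rel_def)
  qed
  have "conj_class G \<pi> = (\<Union>\<sigma>\<in>\<pi>. rep_class (conj_rep \<sigma>))"
    by (auto simp: conj_class_def)
  also have "\<dots> = (\<Union>\<sigma>\<in>\<pi>. rep_class (conj_rep \<rho>))" by (intro SUP_cong refl eq)
  also have "\<dots> = rep_class (conj_rep \<rho>)" using assms(2) by blast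
  finally show ?thesis .
qed

lemma conj_class_in_dual:
  assumes "\<pi> \<in> dual_group G" shows "conj_class G \<pi> \<in> dual_group G"
  using conj_class_rep[OF assms some_rep_in[OF assms]]
    rep_class_in_dual[OF conj_rep_irreducible[OF dual_class_eq(2)[OF assms some_rep_in[OF assms]]]]
  by simp

lemma conj_rep_in_conj_class:
  assumes "\<pi> \<in> dual_group G" "\<rho> \<in> \<pi>" shows "conj_rep \<rho> \<in> conj_class G \<pi>"
  using conj_class_rep[OF assms] in_rep_class[OF conj_rep_irreducible[OF dual_class_eq(2)[OF assms]]]
  by simp

lemma conj_conj_class:
  assumes "\<pi> \<in> dual_group G" shows "conj_class G (conj_class G \<pi>) = \<pi>"
proof -
  note s = some_rep_in[OF assms]
  have "conj_class G (conj_class G \<pi>) = rep_class (some_rep \<pi>)"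
    using conj_class_rep[OF conj_class_in_dual[OF assms] conj_rep_in_conj_class[OF assms s]]
    by (simp add: conj_conj_rep)
  thus ?thesis using dual_class_eq(1)[OF assms s] by simp
qed

lemma idem_conj_class:
  assumes "\<pi> \<in> dual_group G" "g \<in> carrier G"
  shows "idem (conj_class G \<pi>) g = cnj (idem \<pi> g)"
proof -
  note s = some_rep_in[OF assms(1)]
  note u = irrep_unitary[OF dual_class_eq(2)[OF assms(1) s]]
  have "character (conj_rep (some_rep \<pi>)) g = cnj (character (some_rep \<pi>) g)"
    using urep_carrier[OF u assms(2)]
    by (simp add: character_def conj_rep_deg[OF u]) (simp add: conj_rep_def)
  thus ?thesis
    using idem_rep[OF conj_class_in_dual[OF assms(1)] conj_rep_in_conj_class[OF assms(1) s] assms(2)]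
      idem_rep[OF assms(1) s assms(2)] by (simp add: conj_rep_deg[OF u])
qed

section \<open>Central functions\<close>

text \<open>The function \<open>W\<^sub>a\<close> with the scalar matrix \<open>a(\<pi>)\<close> as its Fourier coefficient at \<open>\<pi>\<close>, up to normalization.\<close>

definition central_fun :: "('a rep set \<Rightarrow> complex) \<Rightarrow> 'a \<Rightarrow> complex" where
  "central_fun a x = (\<Sum>\<pi>\<in>dual_group G. a \<pi> * idem \<pi> x)"

lemma central_fun_fourier:
  assumes \<pi>: "\<pi> \<in> dual_group G" and \<sigma>: "\<sigma> \<in> \<pi>" and ij: "i < deg \<sigma>" "j < deg \<sigma>"
  shows "(\<Sum>g\<in>carrier G. central_fun a g * cnj (\<sigma> g $$ (i, j))) = (if i = j then a \<pi> else 0)"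
proof -
  have "(\<Sum>g\<in>carrier G. central_fun a g * cnj (\<sigma> g $$ (i, j))) =
      (\<Sum>\<pi>'\<in>dual_group G. a \<pi>' * (\<Sum>g\<in>carrier G. idem \<pi>' g * cnj (\<sigma> g $$ (i, j))))"
    unfolding central_fun_def sum_distrib_right sum_distrib_left by (subst sum.swap) (simp add: mult_ac)
  also have "\<dots> = (\<Sum>\<pi>'\<in>dual_group G. if \<pi>' = \<pi> then if i = j then a \<pi> else 0 else 0)"
    by (intro sum.cong refl) (auto simp: idem_fourier[OF \<pi> _ \<sigma> ij])
  also have "\<dots> = (if i = j then a \<pi> else 0)" using \<pi> finite_dual by simp
  finally show ?thesis .
qed

text \<open>Both sides have identity matrices as Fourier coefficients. This is the decomposition of the point mass
  at the identity into central idempotents.\<close>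

lemma central_fun_1:
  assumes "x \<in> carrier G"
  shows "central_fun (\<lambda>_. 1) x = (if x = \<one> then 1 else 0)"
proof -
  have "(if x = \<one> then 1 else 0) - central_fun (\<lambda>_. 1) x = 0"
  proof (rule fourier_uniqueness[OF _ assms, where \<phi> = "\<lambda>x. (if x = \<one> then 1 else 0) - central_fun (\<lambda>_. 1) x"])
    fix \<sigma> i j assume \<sigma>: "irreducible_rep G \<sigma>" "i < deg \<sigma>" "j < deg \<sigma>"
    have "(\<Sum>t\<in>carrier G. (if t = \<one> then 1 else 0) * cnj (\<sigma> t $$ (i, j))) = (if i = j then 1 else 0)"
      using sum_delta_one(1)[of "\<lambda>t. cnj (\<sigma> t $$ (i, j))"] \<sigma> by (simp add: urep_one[OF irrep_unitary])
    thus "(\<Sum>t\<in>carrier G. ((if t = \<one> then 1 else 0) - central_fun (\<lambda>_. 1) t) * cnj (\<sigma> t $$ (i, j))) = 0"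
      using central_fun_fourier[OF rep_class_in_dual[OF \<sigma>(1)] in_rep_class[OF \<sigma>(1)] \<sigma>(2,3), of "\<lambda>_. 1"]
      by (simp add: left_diff_distrib sum_subtractf)
  qed
  thus ?thesis by simp
qed

lemma central_fun_one:
  "central_fun (\<lambda>\<pi>. complex_of_real (a \<pi>)) \<one> =
    complex_of_real ((\<Sum>\<pi>\<in>dual_group G. (real (class_deg G \<pi>))\<^sup>2 * a \<pi>) / card (carrier G))"
proof -
  have "central_fun (\<lambda>\<pi>. complex_of_real (a \<pi>)) \<one> =
      (\<Sum>\<pi>\<in>dual_group G. complex_of_real ((real (class_deg G \<pi>))\<^sup>2 * a \<pi> / card (carrier G)))"
    unfolding central_fun_def by (intro sum.cong refl) (simp add: idem_one)
  thus ?thesis by (simp add: sum_divide_distrib)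
qed

lemma sum_deg_squares: "(\<Sum>\<pi>\<in>dual_group G. (real (class_deg G \<pi>))\<^sup>2) = card (carrier G)"
proof -
  have "complex_of_real ((\<Sum>\<pi>\<in>dual_group G. (real (class_deg G \<pi>))\<^sup>2 * 1) / card (carrier G)) = complex_of_real 1"
    using central_fun_one[of "\<lambda>_. 1"] central_fun_1[OF one_closed] by simp
  hence "(\<Sum>\<pi>\<in>dual_group G. (real (class_deg G \<pi>))\<^sup>2) / card (carrier G) = 1"
    by (simp only: of_real_eq_iff mult_1_right)
  thus ?thesis using card_pos by simp
qed

lemma central_fun_central:
  "x \<in> carrier G \<Longrightarrow> y \<in> carrier G \<Longrightarrow> central_fun a (x \<otimes> y) = central_fun a (y \<otimes> x)"
  unfolding central_fun_def by (intro sum.cong refl) (simp add: idem_central)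

text \<open>On the idempotents, inversion of the variable is complex conjugation, hence passage to the
  conjugate class.\<close>

lemma central_fun_inv:
  assumes "x \<in> carrier G"
  shows "central_fun a (inv x) = central_fun (\<lambda>\<pi>. a (conj_class G \<pi>)) x"
proof -
  have "central_fun a (inv x) = (\<Sum>\<pi>\<in>dual_group G. a \<pi> * idem (conj_class G \<pi>) x)"
    unfolding central_fun_def using assms by (intro sum.cong refl) (simp add: idem_inv idem_conj_class)
  also have "\<dots> = central_fun (\<lambda>\<pi>. a (conj_class G \<pi>)) x"
    unfolding central_fun_def
    by (rule sum.reindex_bij_witness[of _ "conj_class G" "conj_class G"])
       (auto simp: conj_class_in_dual conj_conj_class)
  finally show ?thesis .
qed

lemma central_fun_cnj:
  assumes "x \<in> carrier G"
  shows "cnj (central_fun a x) = central_fun (\<lambda>\<pi>. cnj (a \<pi>)) (inv x)"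
  unfolding central_fun_def cnj_sum using assms by (intro sum.cong refl) (simp add: idem_inv)

lemma central_fun_convolution:
  assumes x: "x \<in> carrier G"
  shows "(\<Sum>y\<in>carrier G. central_fun a y * central_fun b (inv y \<otimes> x)) = central_fun (\<lambda>\<pi>. a \<pi> * b \<pi>) x"
proof -
  have "(\<Sum>y\<in>carrier G. central_fun a y * central_fun b (inv y \<otimes> x)) =
      (\<Sum>y\<in>carrier G. \<Sum>\<pi>\<in>dual_group G. \<Sum>\<pi>'\<in>dual_group G.
         a \<pi> * b \<pi>' * (idem \<pi> y * idem \<pi>' (inv y \<otimes> x)))"
    by (intro sum.cong refl) (simp add: central_fun_def sum_product mult_ac)
  also have "\<dots> = (\<Sum>\<pi>\<in>dual_group G. \<Sum>\<pi>'\<in>dual_group G.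
         a \<pi> * b \<pi>' * (\<Sum>y\<in>carrier G. idem \<pi> y * idem \<pi>' (inv y \<otimes> x)))"
    unfolding sum_distrib_left by (subst sum.swap, rule sum.cong[OF refl], rule sum.swap)
  also have "\<dots> = (\<Sum>\<pi>\<in>dual_group G. \<Sum>\<pi>'\<in>dual_group G. if \<pi>' = \<pi> then a \<pi> * b \<pi> * idem \<pi> x else 0)"
    by (intro sum.cong refl) (simp add: idem_convolution[OF _ _ x])
  also have "\<dots> = central_fun (\<lambda>\<pi>. a \<pi> * b \<pi>) x"
    using finite_dual by (simp add: central_fun_def)
  finally show ?thesis .
qed

text \<open>The convolution rule in the translated form in which it is applied to kernels \<open>(x, z) \<mapsto> a(x z)\<close>.\<close>

lemma central_fun_convolution':
  assumes x: "x \<in> carrier G" and z: "z \<in> carrier G"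
  shows "(\<Sum>y\<in>carrier G. central_fun a (x \<otimes> y) * central_fun b (inv y \<otimes> z)) =
    central_fun (\<lambda>\<pi>. a \<pi> * b \<pi>) (x \<otimes> z)"
proof -
  have "(\<Sum>y\<in>carrier G. central_fun a (x \<otimes> y) * central_fun b (inv y \<otimes> z)) =
      (\<Sum>y\<in>carrier G. central_fun a (x \<otimes> y) * central_fun b (inv (x \<otimes> y) \<otimes> (x \<otimes> z)))"
  proof (intro sum.cong refl)
    fix y assume y: "y \<in> carrier G"
    have "inv (x \<otimes> y) \<otimes> (x \<otimes> z) = inv y \<otimes> z"
      using x y z by (simp add: inv_mult_group m_assoc) (simp add: m_assoc[symmetric])
    thus "central_fun a (x \<otimes> y) * central_fun b (inv y \<otimes> z) =
        central_fun a (x \<otimes> y) * central_fun b (inv (x \<otimes> y) \<otimes> (x \<otimes> z))" by simp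
  qed
  also have "\<dots> = (\<Sum>y\<in>carrier G. central_fun a y * central_fun b (inv y \<otimes> (x \<otimes> z)))"
    by (rule sum_left_translate[OF x])
  also have "\<dots> = central_fun (\<lambda>\<pi>. a \<pi> * b \<pi>) (x \<otimes> z)"
    by (rule central_fun_convolution) (use x z in auto)
  finally show ?thesis .
qed

section \<open>Central multipliers\<close>

text \<open>Convolution with a central function, which acts on the Fourier coefficients as a scalar for each \<open>\<pi>\<close>.\<close>

definition multiplier :: "('a rep set \<Rightarrow> complex) \<Rightarrow> ('a \<Rightarrow> complex) \<Rightarrow> 'a \<Rightarrow> complex" where
  "multiplier a f x = (if x \<in> carrier G then \<Sum>y\<in>carrier G. f y * central_fun a (inv y \<otimes> x) else 0)"

lemma multiplier_group_fun: "multiplier a f \<in> group_fun G"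
  by (simp add: multiplier_def group_fun_def)

text \<open>Translation by \<open>y\<close> multiplies a Fourier coefficient by a matrix of the representation, and the coefficient of
  a central function is scalar.\<close>

lemma multiplier_fourier:
  assumes \<pi>: "\<pi> \<in> dual_group G" and \<sigma>: "\<sigma> \<in> \<pi>" and ij: "i < deg \<sigma>" "j < deg \<sigma>"
  shows "(\<Sum>x\<in>carrier G. multiplier a f x * cnj (\<sigma> x $$ (i, j))) =
    a \<pi> * (\<Sum>x\<in>carrier G. f x * cnj (\<sigma> x $$ (i, j)))"
proof -
  note u = irrep_unitary[OF dual_class_eq(2)[OF \<pi> \<sigma>]]
  have inner: "(\<Sum>x\<in>carrier G. central_fun a (inv y \<otimes> x) * cnj (\<sigma> x $$ (i, j))) = a \<pi> * cnj (\<sigma> y $$ (i, j))"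
    if y: "y \<in> carrier G" for y
  proof -
    have "(\<Sum>x\<in>carrier G. central_fun a (inv y \<otimes> x) * cnj (\<sigma> x $$ (i, j))) =
        (\<Sum>z\<in>carrier G. central_fun a (inv y \<otimes> (y \<otimes> z)) * cnj (\<sigma> (y \<otimes> z) $$ (i, j)))"
      by (rule sum_left_translate[OF y, symmetric])
    also have "\<dots> = (\<Sum>z\<in>carrier G. \<Sum>k<deg \<sigma>. cnj (\<sigma> y $$ (i, k)) * (central_fun a z * cnj (\<sigma> z $$ (k, j))))"
      using y ij by (intro sum.cong refl)
        (simp add: urep_mult_index[OF u] m_assoc[symmetric] sum_distrib_left mult_ac)
    also have "\<dots> = (\<Sum>k<deg \<sigma>. cnj (\<sigma> y $$ (i, k)) * (\<Sum>z\<in>carrier G. central_fun a z * cnj (\<sigma> z $$ (k, j))))"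
      unfolding sum_distrib_left by (rule sum.swap)
    also have "\<dots> = (\<Sum>k<deg \<sigma>. if k = j then cnj (\<sigma> y $$ (i, j)) * a \<pi> else 0)"
      using ij by (intro sum.cong refl) (simp add: central_fun_fourier[OF \<pi> \<sigma>])
    also have "\<dots> = a \<pi> * cnj (\<sigma> y $$ (i, j))" using ij by simp
    finally show ?thesis .
  qed
  have "(\<Sum>x\<in>carrier G. multiplier a f x * cnj (\<sigma> x $$ (i, j))) =
      (\<Sum>x\<in>carrier G. \<Sum>y\<in>carrier G. f y * (central_fun a (inv y \<otimes> x) * cnj (\<sigma> x $$ (i, j))))"
    by (intro sum.cong refl) (simp add: multiplier_def sum_distrib_left mult_ac)
  also have "\<dots> = (\<Sum>y\<in>carrier G. f y * (\<Sum>x\<in>carrier G. central_fun a (inv y \<otimes> x) * cnj (\<sigma> x $$ (i, j))))"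
    unfolding sum_distrib_left by (rule sum.swap)
  also have "\<dots> = (\<Sum>y\<in>carrier G. f y * (a \<pi> * cnj (\<sigma> y $$ (i, j))))"
    by (intro sum.cong refl) (simp add: inner)
  finally show ?thesis by (simp add: sum_distrib_left mult_ac)
qed

lemma fourier_coeff_index:
  assumes "unitary_rep G \<sigma>" "i < deg \<sigma>" "j < deg \<sigma>"
  shows "fourier_coeff G f \<sigma> $$ (i, j) = (\<Sum>t\<in>carrier G. f t * cnj (\<sigma> t $$ (i, j))) / of_nat (card (carrier G))"
proof -
  have "conj_rep \<sigma> t $$ (i, j) = cnj (\<sigma> t $$ (i, j))" if "t \<in> carrier G" for t
    using urep_carrier[OF assms(1) that] assms by (simp add: conj_rep_def)
  thus ?thesis using assms by (simp add: fourier_coeff_def)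
qed

text \<open>The Fourier coefficients identify the convolution operator with the multiplier of the
  weighted algebra, for which only a characterization is given.\<close>

lemma weight_multiplier_eq:
  "weight_multiplier G \<omega> f = multiplier (\<lambda>\<pi>. complex_of_real (\<omega> \<pi>)) f"
  unfolding weight_multiplier_def
proof (rule the_equality)
  let ?\<omega> = "\<lambda>\<pi>. complex_of_real (\<omega> \<pi>)"
  have m: "fourier_coeff G (multiplier ?\<omega> f) \<rho> = ?\<omega> \<pi> \<cdot>\<^sub>m fourier_coeff G f \<rho>"
    if \<pi>: "\<pi> \<in> dual_group G" and \<rho>: "\<rho> \<in> \<pi>" for \<pi> \<rho>
  proof (rule eq_matI)
    note u = irrep_unitary[OF dual_class_eq(2)[OF \<pi> \<rho>]]
    fix i j assume "i < dim_row (?\<omega> \<pi> \<cdot>\<^sub>m fourier_coeff G f \<rho>)" "j < dim_col (?\<omega> \<pi> \<cdot>\<^sub>m fourier_coeff G f \<rho>)"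
    hence ij: "i < deg \<rho>" "j < deg \<rho>" by (auto simp: fourier_coeff_def)
    have "fourier_coeff G (multiplier ?\<omega> f) \<rho> $$ (i, j) = ?\<omega> \<pi> * fourier_coeff G f \<rho> $$ (i, j)"
      by (simp add: fourier_coeff_index[OF u ij] multiplier_fourier[OF \<pi> \<rho> ij])
    thus "fourier_coeff G (multiplier ?\<omega> f) \<rho> $$ (i, j) = (?\<omega> \<pi> \<cdot>\<^sub>m fourier_coeff G f \<rho>) $$ (i, j)"
      using ij by (simp add: fourier_coeff_def)
  qed (auto simp: fourier_coeff_def)
  thus "multiplier ?\<omega> f \<in> group_fun G \<and> (\<forall>\<pi>\<in>dual_group G. \<forall>\<rho>\<in>\<pi>.
      fourier_coeff G (multiplier ?\<omega> f) \<rho> = ?\<omega> \<pi> \<cdot>\<^sub>m fourier_coeff G f \<rho>)"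
    using multiplier_group_fun by blast
  fix \<phi> assume \<phi>: "\<phi> \<in> group_fun G \<and> (\<forall>\<pi>\<in>dual_group G. \<forall>\<rho>\<in>\<pi>.
      fourier_coeff G \<phi> \<rho> = ?\<omega> \<pi> \<cdot>\<^sub>m fourier_coeff G f \<rho>)"
  show "\<phi> = multiplier ?\<omega> f"
  proof
    fix x show "\<phi> x = multiplier ?\<omega> f x"
    proof (cases "x \<in> carrier G")
      case True
      have "\<phi> x - multiplier ?\<omega> f x = 0"
      proof (rule fourier_uniqueness[OF _ True, where \<phi> = "\<lambda>x. \<phi> x - multiplier ?\<omega> f x"])
        fix \<sigma> i j assume \<sigma>: "irreducible_rep G \<sigma>" "i < deg \<sigma>" "j < deg \<sigma>"
        note u = irrep_unitary[OF \<sigma>(1)]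
        have "fourier_coeff G \<phi> \<sigma> $$ (i, j) = fourier_coeff G (multiplier ?\<omega> f) \<sigma> $$ (i, j)"
          using \<phi> m rep_class_in_dual[OF \<sigma>(1)] in_rep_class[OF \<sigma>(1)] by simp
        thus "(\<Sum>t\<in>carrier G. (\<phi> t - multiplier ?\<omega> f t) * cnj (\<sigma> t $$ (i, j))) = 0"
          using card_pos by (simp add: fourier_coeff_index[OF u \<sigma>(2,3)] left_diff_distrib sum_subtractf)
      qed
      thus ?thesis by simp
    next
      case False
      thus ?thesis using \<phi> by (simp add: group_fun_def multiplier_def)
    qed
  qed
qed

lemma multiplier_multiplier:
  assumes "x \<in> carrier G"
  shows "multiplier a (multiplier b f) x = multiplier (\<lambda>\<pi>. b \<pi> * a \<pi>) f x"
proof -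
  have "multiplier a (multiplier b f) x =
      (\<Sum>y\<in>carrier G. \<Sum>z\<in>carrier G. f z * (central_fun b (inv z \<otimes> y) * central_fun a (inv y \<otimes> x)))"
    using assms by (simp add: multiplier_def sum_distrib_left mult_ac)
  also have "\<dots> = (\<Sum>z\<in>carrier G. f z * (\<Sum>y\<in>carrier G. central_fun b (inv z \<otimes> y) * central_fun a (inv y \<otimes> x)))"
    unfolding sum_distrib_left by (rule sum.swap)
  also have "\<dots> = multiplier (\<lambda>\<pi>. b \<pi> * a \<pi>) f x"
    using assms by (simp add: multiplier_def central_fun_convolution')
  finally show ?thesis .
qed

lemma central_fun_cong:
  "(\<And>\<pi>. \<pi> \<in> dual_group G \<Longrightarrow> a \<pi> = b \<pi>) \<Longrightarrow> central_fun a x = central_fun b x"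
  unfolding central_fun_def by (intro sum.cong) auto

lemma multiplier_inverse:
  assumes "\<And>\<pi>. \<pi> \<in> dual_group G \<Longrightarrow> a \<pi> * b \<pi> = 1" and f: "f \<in> group_fun G"
  shows "multiplier b (multiplier a f) = f"
proof
  fix x show "multiplier b (multiplier a f) x = f x"
  proof (cases "x \<in> carrier G")
    case True
    have delta: "central_fun (\<lambda>\<pi>. a \<pi> * b \<pi>) (inv y \<otimes> x) = (if y = x then 1 else 0)" if "y \<in> carrier G" for y
    proof -
      have "inv y \<otimes> x = \<one> \<longleftrightarrow> y = x" using that True
        by (metis inv_closed inv_inv inv_unique' l_inv r_inv inv_equality)
      thus ?thesis
        using central_fun_cong[of "\<lambda>\<pi>. a \<pi> * b \<pi>" "\<lambda>_. 1"] assms(1) central_fun_1 that True by simp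
    qed
    hence "multiplier (\<lambda>\<pi>. a \<pi> * b \<pi>) f x = (\<Sum>y\<in>carrier G. if y = x then f y else 0)"
      using True unfolding multiplier_def by (auto intro!: sum.cong simp: delta)
    thus ?thesis using True fin by (simp add: multiplier_multiplier)
  next
    case False
    thus ?thesis using f by (simp add: multiplier_def group_fun_def)
  qed
qed

end

section \<open>Operator norms of matrices\<close>

lemma vec_l2_L2_set: "vec_l2 v = L2_set (\<lambda>i. cmod (v $ i)) {..<dim_vec v}"
  by (simp add: vec_l2_def L2_set_def)

lemma vec_l2_nonneg [simp]: "vec_l2 v \<ge> 0"
  by (simp add: vec_l2_L2_set)

lemma vec_l2_power2: "(vec_l2 v)\<^sup>2 = (\<Sum>i<dim_vec v. (cmod (v $ i))\<^sup>2)"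
  by (simp add: vec_l2_def sum_nonneg)

lemma vec_l2_smult: "vec_l2 (c \<cdot>\<^sub>v v) = cmod c * vec_l2 v"
proof -
  have "vec_l2 (c \<cdot>\<^sub>v v) = L2_set (\<lambda>i. cmod c * cmod (v $ i)) {..<dim_vec v}"
    unfolding vec_l2_L2_set by (intro L2_set_cong) (auto simp: norm_mult)
  thus ?thesis by (simp add: vec_l2_L2_set L2_set_right_distrib)
qed

lemma norm_index_le_vec_l2: "i < dim_vec v \<Longrightarrow> cmod (v $ i) \<le> vec_l2 v"
  unfolding vec_l2_L2_set by (rule member_le_L2_set) auto

lemma L2_set_sum_le:
  assumes "finite S"
  shows "L2_set (\<lambda>i. \<Sum>s\<in>S. f s i) A \<le> (\<Sum>s\<in>S. L2_set (f s) A)"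
  using assms
proof (induction S rule: finite_induct)
  case empty
  show ?case by (simp add: L2_set_def)
next
  case (insert x F)
  have "L2_set (\<lambda>i. \<Sum>s\<in>insert x F. f s i) A = L2_set (\<lambda>i. f x i + (\<Sum>s\<in>F. f s i)) A"
    using insert by simp
  also have "\<dots> \<le> L2_set (f x) A + L2_set (\<lambda>i. \<Sum>s\<in>F. f s i) A"
    by (rule L2_set_triangle_ineq)
  finally show ?case using insert by simp
qed

lemma mat_vec_l2_bound:
  assumes A: "A \<in> carrier_mat n m" and v: "v \<in> carrier_vec m"
  shows "vec_l2 (A *\<^sub>v v) \<le> (\<Sum>i<n. \<Sum>j<m. cmod (A $$ (i, j))) * vec_l2 v"
proof -
  have "vec_l2 (A *\<^sub>v v) \<le> (\<Sum>i<n. cmod ((A *\<^sub>v v) $ i))"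
    using L2_set_le_sum[of "{..<n}" "\<lambda>i. cmod ((A *\<^sub>v v) $ i)"] A by (simp add: vec_l2_L2_set)
  also have "\<dots> \<le> (\<Sum>i<n. \<Sum>j<m. cmod (A $$ (i, j)) * vec_l2 v)"
  proof (intro sum_mono)
    fix i assume "i \<in> {..<n}"
    hence "cmod ((A *\<^sub>v v) $ i) \<le> (\<Sum>j<m. cmod (A $$ (i, j) * v $ j))"
      using A v by (subst mult_mat_vec_index[OF A v]) (auto intro: norm_sum)
    also have "\<dots> \<le> (\<Sum>j<m. cmod (A $$ (i, j)) * vec_l2 v)"
      unfolding norm_mult using v by (intro sum_mono mult_left_mono norm_index_le_vec_l2) auto
    finally show "cmod ((A *\<^sub>v v) $ i) \<le> (\<Sum>j<m. cmod (A $$ (i, j)) * vec_l2 v)" .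
  qed
  finally show ?thesis by (simp add: sum_distrib_right)
qed

lemma mat_opnorm_bdd:
  "bdd_above {vec_l2 (A *\<^sub>v v) | v. v \<in> carrier_vec (dim_col A) \<and> vec_l2 v \<le> 1}"
proof (rule bdd_aboveI, safe)
  fix v assume v: "v \<in> carrier_vec (dim_col A)" "vec_l2 v \<le> 1"
  let ?C = "\<Sum>i<dim_row A. \<Sum>j<dim_col A. cmod (A $$ (i, j))"
  have "vec_l2 (A *\<^sub>v v) \<le> ?C * vec_l2 v" by (rule mat_vec_l2_bound) (use v in auto)
  also have "\<dots> \<le> ?C * 1" by (intro mult_left_mono v sum_nonneg) auto
  finally show "vec_l2 (A *\<^sub>v v) \<le> ?C" by simp
qed

lemma vec_l2_zero [simp]: "vec_l2 (0\<^sub>v n) = 0"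
  by (simp add: vec_l2_def)

lemma mat_opnorm_nonneg [simp]: "mat_opnorm A \<ge> 0"
proof -
  have "vec_l2 (A *\<^sub>v 0\<^sub>v (dim_col A)) \<le> mat_opnorm A"
    unfolding mat_opnorm_def
    by (rule cSup_upper[OF _ mat_opnorm_bdd]) (auto intro!: exI[of _ "0\<^sub>v (dim_col A)"])
  thus ?thesis using vec_l2_nonneg order_trans by blast
qed

lemma mat_opnorm_apply:
  assumes A: "A \<in> carrier_mat n m" and v: "v \<in> carrier_vec m"
  shows "vec_l2 (A *\<^sub>v v) \<le> mat_opnorm A * vec_l2 v"
proof (cases "vec_l2 v = 0")
  case True
  hence "vec_l2 (A *\<^sub>v v) \<le> 0" using mat_vec_l2_bound[OF A v] by simp
  thus ?thesis using True by simp
next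
  case False
  define w where "w = complex_of_real (1 / vec_l2 v) \<cdot>\<^sub>v v"
  have pos: "vec_l2 v > 0" using False vec_l2_nonneg[of v] by linarith
  have w: "w \<in> carrier_vec m" "vec_l2 w \<le> 1"
    using v pos by (auto simp: w_def vec_l2_smult norm_divide)
  have "vec_l2 (A *\<^sub>v w) \<le> mat_opnorm A"
    unfolding mat_opnorm_def using A w by (intro cSup_upper[OF _ mat_opnorm_bdd]) auto
  moreover have "A *\<^sub>v w = complex_of_real (1 / vec_l2 v) \<cdot>\<^sub>v (A *\<^sub>v v)"
    unfolding w_def by (rule mult_mat_vec[OF A v])
  ultimately show ?thesis using pos by (simp add: vec_l2_smult norm_divide field_simps)
qed

lemma mat_opnorm_le:
  assumes A: "A \<in> carrier_mat n m" and C: "C \<ge> 0"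
    and le: "\<And>v. v \<in> carrier_vec m \<Longrightarrow> vec_l2 (A *\<^sub>v v) \<le> C * vec_l2 v"
  shows "mat_opnorm A \<le> C"
  unfolding mat_opnorm_def
proof (rule cSup_least)
  show "{vec_l2 (A *\<^sub>v v) | v. v \<in> carrier_vec (dim_col A) \<and> vec_l2 v \<le> 1} \<noteq> {}"
    by (auto intro!: exI[of _ "0\<^sub>v (dim_col A)"])
  fix x assume "x \<in> {vec_l2 (A *\<^sub>v v) | v. v \<in> carrier_vec (dim_col A) \<and> vec_l2 v \<le> 1}"
  then obtain v where v: "v \<in> carrier_vec m" "vec_l2 v \<le> 1" and x: "x = vec_l2 (A *\<^sub>v v)"
    using A by auto
  have "x \<le> C * vec_l2 v" using le v x by simp
  also have "\<dots> \<le> C" using v C by (simp add: mult_left_le)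
  finally show "x \<le> C" .
qed

lemma mat_opnorm_mult:
  assumes A: "A \<in> carrier_mat n m" and B: "B \<in> carrier_mat m k"
  shows "mat_opnorm (A * B) \<le> mat_opnorm A * mat_opnorm B"
proof (rule mat_opnorm_le)
  show "A * B \<in> carrier_mat n k" using A B by (rule mult_carrier_mat)
  show "0 \<le> mat_opnorm A * mat_opnorm B" by simp
  fix v :: "complex vec" assume v: "v \<in> carrier_vec k"
  have "vec_l2 ((A * B) *\<^sub>v v) = vec_l2 (A *\<^sub>v (B *\<^sub>v v))" by (simp add: assoc_mult_mat_vec[OF A B v])
  also have "\<dots> \<le> mat_opnorm A * vec_l2 (B *\<^sub>v v)"
    by (rule mat_opnorm_apply[OF A mult_mat_vec_carrier[OF B v]])
  also have "\<dots> \<le> mat_opnorm A * (mat_opnorm B * vec_l2 v)"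
    by (intro mult_left_mono mat_opnorm_apply[OF B v]) simp
  finally show "vec_l2 ((A * B) *\<^sub>v v) \<le> mat_opnorm A * mat_opnorm B * vec_l2 v" by (simp add: mult.assoc)
qed

lemma mat_opnorm_combination_le:
  assumes S: "finite S" and X: "X \<in> carrier_mat n m" and M: "\<And>s. s \<in> S \<Longrightarrow> M s \<in> carrier_mat n m"
    and eq: "\<And>i j. i < n \<Longrightarrow> j < m \<Longrightarrow> X $$ (i, j) = (\<Sum>s\<in>S. c s * M s $$ (i, j))"
  shows "mat_opnorm X \<le> (\<Sum>s\<in>S. cmod (c s) * mat_opnorm (M s))"
proof (rule mat_opnorm_le[OF X])
  show "0 \<le> (\<Sum>s\<in>S. cmod (c s) * mat_opnorm (M s))" by (intro sum_nonneg) simp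
  fix v :: "complex vec" assume v: "v \<in> carrier_vec m"
  have comp: "(X *\<^sub>v v) $ i = (\<Sum>s\<in>S. c s * (M s *\<^sub>v v) $ i)" if i: "i < n" for i
  proof -
    have "(X *\<^sub>v v) $ i = (\<Sum>l<m. \<Sum>s\<in>S. c s * (M s $$ (i, l) * v $ l))"
      using i by (subst mult_mat_vec_index[OF X v i]) (simp add: eq sum_distrib_right mult.assoc)
    also have "\<dots> = (\<Sum>s\<in>S. c s * (\<Sum>l<m. M s $$ (i, l) * v $ l))"
      unfolding sum_distrib_left by (rule sum.swap)
    also have "\<dots> = (\<Sum>s\<in>S. c s * (M s *\<^sub>v v) $ i)"
      by (intro sum.cong refl) (simp add: mult_mat_vec_index[OF M v i])
    finally show ?thesis .
  qed
  have "vec_l2 (X *\<^sub>v v) = L2_set (\<lambda>i. cmod (\<Sum>s\<in>S. c s * (M s *\<^sub>v v) $ i)) {..<n}"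
    unfolding vec_l2_L2_set using X by (intro L2_set_cong) (auto simp: comp simp del: index_mult_mat_vec)
  also have "\<dots> \<le> L2_set (\<lambda>i. \<Sum>s\<in>S. cmod (c s) * cmod ((M s *\<^sub>v v) $ i)) {..<n}"
    by (intro L2_set_mono) (auto intro!: sum_norm_le simp: norm_mult)
  also have "\<dots> \<le> (\<Sum>s\<in>S. L2_set (\<lambda>i. cmod (c s) * cmod ((M s *\<^sub>v v) $ i)) {..<n})"
    by (rule L2_set_sum_le[OF S])
  also have "\<dots> = (\<Sum>s\<in>S. cmod (c s) * vec_l2 (M s *\<^sub>v v))"
  proof (intro sum.cong refl)
    fix s assume "s \<in> S"
    thus "L2_set (\<lambda>i. cmod (c s) * cmod ((M s *\<^sub>v v) $ i)) {..<n} = cmod (c s) * vec_l2 (M s *\<^sub>v v)"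
      using M[of s] by (simp add: vec_l2_L2_set L2_set_right_distrib)
  qed
  also have "\<dots> \<le> (\<Sum>s\<in>S. cmod (c s) * (mat_opnorm (M s) * vec_l2 v))"
    by (intro sum_mono mult_left_mono mat_opnorm_apply[OF M v]) auto
  finally show "vec_l2 (X *\<^sub>v v) \<le> (\<Sum>s\<in>S. cmod (c s) * mat_opnorm (M s)) * vec_l2 v"
    by (simp add: sum_distrib_right mult.assoc)
qed

lemma pair_index_less:
  fixes m :: nat
  assumes "i < n" "k < m"
  shows "i * m + k < n * m"
proof -
  have "i * m + k < Suc i * m" using assms by simp
  also have "\<dots> \<le> n * m" using assms by (intro mult_le_mono1) simp
  finally show ?thesis .
qed

text \<open>Sums over the index set of a Kronecker product, where the pair \<open>(i, k)\<close> is encoded as \<open>i * m + k\<close>.\<close>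

lemma sum_div_mod:
  fixes f :: "nat \<Rightarrow> nat \<Rightarrow> 'b::comm_monoid_add"
  shows "(\<Sum>x<n * m. f (x div m) (x mod m)) = (\<Sum>i<n. \<Sum>k<m. f i k)"
proof (cases "m = 0")
  case False
  have "(\<Sum>x<n * m. f (x div m) (x mod m)) = (\<Sum>(i, k)\<in>{..<n} \<times> {..<m}. f i k)"
    by (rule sum.reindex_bij_witness[of _ "\<lambda>(i, k). i * m + k" "\<lambda>x. (x div m, x mod m)"])
       (use False in \<open>auto simp: less_mult_imp_div_less pair_index_less\<close>)
  thus ?thesis by (simp add: sum.cartesian_product)
qed simp

lemma kron_with_carrier:
  "A \<in> carrier_mat n n' \<Longrightarrow> B \<in> carrier_mat m m' \<Longrightarrow> kron_with p A B \<in> carrier_mat (n * m) (n' * m')"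
  by (simp add: kron_with_def)

lemma kron_with_index:
  assumes "A \<in> carrier_mat n n'" "B \<in> carrier_mat m m'" "x < n * m" "y < n' * m'"
  shows "kron_with p A B $$ (x, y) = p (A $$ (x div m, y div m')) (B $$ (x mod m, y mod m'))"
  using assms by (simp add: kron_with_def)

lemma kron_with_mult_vec:
  assumes A: "A \<in> carrier_mat n n'" and B: "B \<in> carrier_mat m m'" and v: "v \<in> carrier_vec (n' * m')"
    and i: "i < n" and k: "k < m"
  shows "(kron_with p A B *\<^sub>v v) $ (i * m + k) =
    (\<Sum>j<n'. \<Sum>l<m'. p (A $$ (i, j)) (B $$ (k, l)) * v $ (j * m' + l))"
proof -
  note x = pair_index_less[OF i k]
  have "(kron_with p A B *\<^sub>v v) $ (i * m + k) = (\<Sum>y<n' * m'. kron_with p A B $$ (i * m + k, y) * v $ y)"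
    by (rule mult_mat_vec_index[OF kron_with_carrier[OF A B] v x])
  also have "\<dots> = (\<Sum>y<n' * m'. (\<lambda>j l. p (A $$ (i, j)) (B $$ (k, l)) * v $ (j * m' + l)) (y div m') (y mod m'))"
    using k by (intro sum.cong refl) (simp add: kron_with_index[OF A B x])
  also have "\<dots> = (\<Sum>j<n'. \<Sum>l<m'. p (A $$ (i, j)) (B $$ (k, l)) * v $ (j * m' + l))"
    by (rule sum_div_mod)
  finally show ?thesis .
qed

lemma vec_l2_pairs:
  assumes "v \<in> carrier_vec (n * m)"
  shows "(vec_l2 v)\<^sup>2 = (\<Sum>i<n. \<Sum>k<m. (cmod (v $ (i * m + k)))\<^sup>2)"
  using sum_div_mod[where f = "\<lambda>i k. (cmod (v $ (i * m + k)))\<^sup>2" and n = n and m = m] assms by (simp add: vec_l2_power2)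

text \<open>Read a vector as a matrix: \<open>B\<close> acts on each of its rows and then \<open>A\<close> on each of the resulting columns.\<close>

lemma mat_opnorm_kron:
  assumes A: "A \<in> carrier_mat n n'" and B: "B \<in> carrier_mat m m'"
  shows "mat_opnorm (kron_with (*) A B) \<le> mat_opnorm A * mat_opnorm B"
proof (rule mat_opnorm_le[OF kron_with_carrier[OF A B]])
  show "0 \<le> mat_opnorm A * mat_opnorm B" by simp
  fix v :: "complex vec" assume v: "v \<in> carrier_vec (n' * m')"
  define row where "row j = vec m' (\<lambda>l. v $ (j * m' + l))" for j
  define w where "w k = vec n' (\<lambda>j. (B *\<^sub>v row j) $ k)" for k
  have row: "row j \<in> carrier_vec m'" for j by (simp add: row_def)
  have w: "w k \<in> carrier_vec n'" for k by (simp add: w_def)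
  have comp: "(kron_with (*) A B *\<^sub>v v) $ (i * m + k) = (A *\<^sub>v w k) $ i" if i: "i < n" and k: "k < m" for i k
  proof -
    have "(A *\<^sub>v w k) $ i = (\<Sum>j<n'. A $$ (i, j) * (B *\<^sub>v row j) $ k)"
      by (subst mult_mat_vec_index[OF A w i]) (simp add: w_def)
    also have "\<dots> = (\<Sum>j<n'. \<Sum>l<m'. A $$ (i, j) * B $$ (k, l) * v $ (j * m' + l))"
      by (intro sum.cong refl, subst mult_mat_vec_index[OF B row k])
         (simp add: row_def sum_distrib_left mult.assoc)
    finally show ?thesis by (simp add: kron_with_mult_vec[OF A B v i k])
  qed
  have "(vec_l2 (kron_with (*) A B *\<^sub>v v))\<^sup>2 = (\<Sum>i<n. \<Sum>k<m. (cmod ((A *\<^sub>v w k) $ i))\<^sup>2)"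
    by (subst vec_l2_pairs[OF mult_mat_vec_carrier[OF kron_with_carrier[OF A B] v]]) (simp add: comp)
  also have "\<dots> = (\<Sum>k<m. (vec_l2 (A *\<^sub>v w k))\<^sup>2)"
    using A by (subst sum.swap) (simp add: vec_l2_power2)
  also have "\<dots> \<le> (\<Sum>k<m. (mat_opnorm A * vec_l2 (w k))\<^sup>2)"
    by (intro sum_mono power_mono mat_opnorm_apply[OF A w]) simp
  also have "\<dots> = (mat_opnorm A)\<^sup>2 * (\<Sum>k<m. \<Sum>j<n'. (cmod ((B *\<^sub>v row j) $ k))\<^sup>2)"
    by (simp add: power_mult_distrib sum_distrib_left[symmetric] vec_l2_power2 w_def)
  also have "(\<Sum>k<m. \<Sum>j<n'. (cmod ((B *\<^sub>v row j) $ k))\<^sup>2) = (\<Sum>j<n'. (vec_l2 (B *\<^sub>v row j))\<^sup>2)"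
    using B by (subst sum.swap) (simp add: vec_l2_power2)
  also have "(mat_opnorm A)\<^sup>2 * \<dots> \<le> (mat_opnorm A)\<^sup>2 * (\<Sum>j<n'. (mat_opnorm B * vec_l2 (row j))\<^sup>2)"
    by (intro mult_left_mono sum_mono power_mono mat_opnorm_apply[OF B row]) simp_all
  also have "(\<Sum>j<n'. (mat_opnorm B * vec_l2 (row j))\<^sup>2) = (mat_opnorm B)\<^sup>2 * (vec_l2 v)\<^sup>2"
    unfolding vec_l2_pairs[OF v]
    by (simp add: power_mult_distrib sum_distrib_left[symmetric] vec_l2_power2 row_def)
  finally have "(vec_l2 (kron_with (*) A B *\<^sub>v v))\<^sup>2 \<le> (mat_opnorm A * mat_opnorm B * vec_l2 v)\<^sup>2"
    by (simp add: power_mult_distrib mult.assoc)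
  thus "vec_l2 (kron_with (*) A B *\<^sub>v v) \<le> mat_opnorm A * mat_opnorm B * vec_l2 v"
    by (rule power2_le_imp_le) simp
qed

lemma mat_opnorm_1x1: "mat_opnorm (mat 1 1 (\<lambda>_. c)) = cmod c"
proof (rule antisym)
  have A: "mat 1 1 (\<lambda>_. c) \<in> carrier_mat 1 1" by simp
  have eq: "vec_l2 (mat 1 1 (\<lambda>_. c) *\<^sub>v v) = cmod c * vec_l2 v" if "v \<in> carrier_vec 1" for v
  proof -
    have "mat 1 1 (\<lambda>_. c) *\<^sub>v v = c \<cdot>\<^sub>v v"
      using that by (intro eq_vecI) (auto simp: scalar_prod_def)
    thus ?thesis by (simp add: vec_l2_smult)
  qed
  show "mat_opnorm (mat 1 1 (\<lambda>_. c)) \<le> cmod c"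
    by (rule mat_opnorm_le[OF A]) (simp_all add: eq del: One_nat_def)
  have "vec_l2 (mat 1 1 (\<lambda>_. c) *\<^sub>v vec 1 (\<lambda>_. 1)) \<le> mat_opnorm (mat 1 1 (\<lambda>_. c)) * vec_l2 (vec 1 (\<lambda>_. 1))"
    by (rule mat_opnorm_apply[OF A]) simp
  moreover have "vec_l2 (vec 1 (\<lambda>_. 1)) = 1" by (simp add: vec_l2_def)
  ultimately show "cmod c \<le> mat_opnorm (mat 1 1 (\<lambda>_. c))" using eq[of "vec 1 (\<lambda>_. 1)"] by simp
qed

lemma mat_opnorm_column:
  assumes A: "A \<in> carrier_mat n 1"
  shows "mat_opnorm A \<le> sqrt (\<Sum>i<n. (cmod (A $$ (i, 0)))\<^sup>2)"
proof (rule mat_opnorm_le[OF A])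
  fix v :: "complex vec" assume v: "v \<in> carrier_vec 1"
  have "(A *\<^sub>v v) $ i = A $$ (i, 0) * v $ 0" if "i < n" for i
    using mult_mat_vec_index[OF A v that] by simp
  hence "vec_l2 (A *\<^sub>v v) = L2_set (\<lambda>i. cmod (v $ 0) * cmod (A $$ (i, 0))) {..<n}"
    unfolding vec_l2_L2_set using A by (intro L2_set_cong) (auto simp: norm_mult)
  also have "\<dots> = sqrt (\<Sum>i<n. (cmod (A $$ (i, 0)))\<^sup>2) * cmod (v $ 0)"
    by (simp add: L2_set_right_distrib[symmetric]) (simp add: L2_set_def)
  also have "cmod (v $ 0) = vec_l2 v" using v by (simp add: vec_l2_def)
  finally show "vec_l2 (A *\<^sub>v v) \<le> sqrt (\<Sum>i<n. (cmod (A $$ (i, 0)))\<^sup>2) * vec_l2 v" by simp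
qed (simp add: sum_nonneg)

lemma mat_opnorm_row:
  assumes A: "A \<in> carrier_mat 1 n"
  shows "mat_opnorm A \<le> sqrt (\<Sum>i<n. (cmod (A $$ (0, i)))\<^sup>2)"
proof (rule mat_opnorm_le[OF A])
  fix v :: "complex vec" assume v: "v \<in> carrier_vec n"
  have "vec_l2 (A *\<^sub>v v) = cmod (\<Sum>i<n. A $$ (0, i) * v $ i)"
    using mult_mat_vec_index[OF A v, of 0] A by (simp add: vec_l2_def)
  also have "\<dots> \<le> (\<Sum>i<n. \<bar>cmod (A $$ (0, i))\<bar> * \<bar>cmod (v $ i)\<bar>)"
    by (rule sum_norm_le) (simp add: norm_mult)
  also have "\<dots> \<le> L2_set (\<lambda>i. cmod (A $$ (0, i))) {..<n} * L2_set (\<lambda>i. cmod (v $ i)) {..<n}"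
    by (rule L2_set_mult_ineq)
  finally show "vec_l2 (A *\<^sub>v v) \<le> sqrt (\<Sum>i<n. (cmod (A $$ (0, i)))\<^sup>2) * vec_l2 v"
    using v by (simp add: vec_l2_L2_set L2_set_def)
qed (simp add: sum_nonneg)

section \<open>Spaces of functions on a finite set and their biduals\<close>

definition point_fun :: "'x \<Rightarrow> 'x \<Rightarrow> complex" where
  "point_fun z = (\<lambda>x. if x = z then 1 else 0)"

text \<open>A finite-dimensional space in the form of all functions that vanish off a finite set. With the point
  evaluations bounded, its dual consists of all linear functionals.\<close>

locale fin_space =
  fixes X :: "'x fn_space" and Z :: "'x set"
  assumes finZ: "finite Z"
    and car: "fn_carrier X = {u. \<forall>x. x \<notin> Z \<longrightarrow> u x = 0}"
    and norm_nonneg: "\<And>u. u \<in> fn_carrier X \<Longrightarrow> fn_norm X u \<ge> 0"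
    and point_bounded: "\<And>z. z \<in> Z \<Longrightarrow> \<exists>C. \<forall>u\<in>fn_carrier X. cmod (u z) \<le> C * fn_norm X u"
begin

lemma add_closed: "u \<in> fn_carrier X \<Longrightarrow> v \<in> fn_carrier X \<Longrightarrow> (\<lambda>x. u x + v x) \<in> fn_carrier X"
  by (simp add: car)

lemma scale_closed: "u \<in> fn_carrier X \<Longrightarrow> (\<lambda>x. c * u x) \<in> fn_carrier X"
  by (simp add: car)

lemma zero_closed: "(\<lambda>x. 0) \<in> fn_carrier X"
  by (simp add: car)

lemma point_fun_closed: "z \<in> Z \<Longrightarrow> point_fun z \<in> fn_carrier X"
  by (auto simp: car point_fun_def)

definition linear_functional :: "(('x \<Rightarrow> complex) \<Rightarrow> complex) \<Rightarrow> bool" where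
  "linear_functional F \<longleftrightarrow>
     (\<forall>u\<in>fn_carrier X. \<forall>v\<in>fn_carrier X. F (\<lambda>x. u x + v x) = F u + F v) \<and>
     (\<forall>c. \<forall>u\<in>fn_carrier X. F (\<lambda>x. c * u x) = c * F u) \<and>
     (\<forall>u. u \<notin> fn_carrier X \<longrightarrow> F u = 0)"

lemma linear_functional_addD:
  "linear_functional F \<Longrightarrow> u \<in> fn_carrier X \<Longrightarrow> v \<in> fn_carrier X \<Longrightarrow>
    F (\<lambda>x. u x + v x) = F u + F v"
  by (simp add: linear_functional_def)

lemma linear_functional_scaleD:
  "linear_functional F \<Longrightarrow> u \<in> fn_carrier X \<Longrightarrow> F (\<lambda>x. c * u x) = c * F u"
  by (simp add: linear_functional_def)

lemma linear_functional_expand: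
  assumes F: "linear_functional F" and u: "u \<in> fn_carrier X"
  shows "F u = (\<Sum>z\<in>Z. u z * F (point_fun z))"
proof -
  have "F (\<lambda>x. \<Sum>z\<in>S. u z * point_fun z x) = (\<Sum>z\<in>S. u z * F (point_fun z)) \<and>
      (\<lambda>x. \<Sum>z\<in>S. u z * point_fun z x) \<in> fn_carrier X" if "finite S" "S \<subseteq> Z" for S
    using that
  proof (induction S rule: finite_induct)
    case empty
    show ?case using linear_functional_scaleD[OF F zero_closed, of 0] zero_closed by simp
  next
    case (insert y S)
    let ?v = "\<lambda>x. \<Sum>z\<in>S. u z * point_fun z x"
    have p: "point_fun y \<in> fn_carrier X" using insert by (intro point_fun_closed) auto
    have v: "?v \<in> fn_carrier X" "F ?v = (\<Sum>z\<in>S. u z * F (point_fun z))" using insert by auto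
    have "F (\<lambda>x. u y * point_fun y x + ?v x) = F (\<lambda>x. u y * point_fun y x) + F ?v"
      by (rule linear_functional_addD[OF F scale_closed[OF p] v(1)])
    also have "F (\<lambda>x. u y * point_fun y x) = u y * F (point_fun y)"
      by (rule linear_functional_scaleD[OF F p])
    finally show ?case
      using insert add_closed[OF scale_closed[OF p, of "u y"] v(1)] v(2) by simp
  qed
  from this[OF finZ] have "F (\<lambda>x. \<Sum>z\<in>Z. u z * point_fun z x) = (\<Sum>z\<in>Z. u z * F (point_fun z))" by simp
  moreover have "(\<lambda>x. \<Sum>z\<in>Z. u z * point_fun z x) = u"
  proof
    fix x
    have "(\<Sum>z\<in>Z. u z * point_fun z x) = (\<Sum>z\<in>Z. if z = x then u x else 0)"
      by (intro sum.cong) (auto simp: point_fun_def)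
    thus "(\<Sum>z\<in>Z. u z * point_fun z x) = u x" using u finZ by (auto simp: car)
  qed
  ultimately show ?thesis by simp
qed

text \<open>All linear functionals are combinations of the point evaluations, and these are bounded by assumption.\<close>

lemma linear_functional_bounded:
  assumes F: "linear_functional F"
  obtains C where "C \<ge> 0" "\<And>u. u \<in> fn_carrier X \<Longrightarrow> cmod (F u) \<le> C * fn_norm X u"
proof -
  have "\<exists>C. \<forall>z\<in>Z. \<forall>u\<in>fn_carrier X. cmod (u z) \<le> C z * fn_norm X u"
    using point_bounded by (intro bchoice) blast
  then obtain C where C: "\<And>z u. z \<in> Z \<Longrightarrow> u \<in> fn_carrier X \<Longrightarrow> cmod (u z) \<le> C z * fn_norm X u"
    by blast
  let ?C = "\<Sum>z\<in>Z. \<bar>C z\<bar> * cmod (F (point_fun z))"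
  have "cmod (F u) \<le> ?C * fn_norm X u" if u: "u \<in> fn_carrier X" for u
  proof -
    have "cmod (F u) \<le> (\<Sum>z\<in>Z. \<bar>C z\<bar> * fn_norm X u * cmod (F (point_fun z)))"
      unfolding linear_functional_expand[OF F u]
    proof (rule sum_norm_le)
      fix z assume z: "z \<in> Z"
      have "cmod (u z) \<le> \<bar>C z\<bar> * fn_norm X u"
        using C[OF z u] norm_nonneg[OF u] by (meson abs_ge_self mult_right_mono order_trans)
      thus "cmod (u z * F (point_fun z)) \<le> \<bar>C z\<bar> * fn_norm X u * cmod (F (point_fun z))"
        unfolding norm_mult by (rule mult_right_mono) simp
    qed
    thus ?thesis by (simp add: sum_distrib_left mult_ac)
  qed
  moreover have "?C \<ge> 0" by (intro sum_nonneg) simp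
  ultimately show ?thesis using that by blast
qed

lemma dual_iff: "F \<in> fn_carrier (fn_dual X) \<longleftrightarrow> linear_functional F"
proof
  assume "linear_functional F"
  with linear_functional_bounded[OF this] show "F \<in> fn_carrier (fn_dual X)"
    unfolding fn_dual_def linear_functional_def by simp metis
qed (auto simp: fn_dual_def linear_functional_def)

lemma dual_norm_bdd:
  assumes "linear_functional F"
  shows "bdd_above {cmod (F u) | u. u \<in> fn_carrier X \<and> fn_norm X u \<le> 1}"
proof -
  obtain C where C: "C \<ge> 0" "\<And>u. u \<in> fn_carrier X \<Longrightarrow> cmod (F u) \<le> C * fn_norm X u"
    using linear_functional_bounded[OF assms] by blast
  have "cmod (F u) \<le> C" if "u \<in> fn_carrier X" "fn_norm X u \<le> 1" for u
    using C(2)[OF that(1)] mult_left_le[OF that(2) C(1)] by linarith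
  thus ?thesis by (intro bdd_aboveI[of _ C]) auto
qed

lemma dual_norm_ge:
  assumes "linear_functional F" "u \<in> fn_carrier X" "fn_norm X u \<le> 1"
  shows "cmod (F u) \<le> fn_norm (fn_dual X) F"
  unfolding fn_dual_def using assms by (auto intro!: cSup_upper dual_norm_bdd)

definition evaluation :: "'x \<Rightarrow> ('x \<Rightarrow> complex) \<Rightarrow> complex" where
  "evaluation z u = (if u \<in> fn_carrier X then u z else 0)"

lemma evaluation_linear: "linear_functional (evaluation z)"
  by (auto simp: linear_functional_def evaluation_def add_closed scale_closed)

lemma linear_functional_add:
  "linear_functional F \<Longrightarrow> linear_functional H \<Longrightarrow> linear_functional (\<lambda>u. F u + H u)"
  by (simp add: linear_functional_def algebra_simps)

lemma linear_functional_scale: "linear_functional F \<Longrightarrow> linear_functional (\<lambda>u. c * F u)"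
  by (simp add: linear_functional_def algebra_simps)

lemma linear_functional_zero: "linear_functional (\<lambda>u. 0)"
  by (simp add: linear_functional_def)

lemma bidual_expand:
  assumes M: "M \<in> fn_carrier (fn_bidual X)" and F: "linear_functional F"
  shows "M F = (\<Sum>z\<in>Z. F (point_fun z) * M (evaluation z))"
proof -
  have add: "M (\<lambda>u. F u + H u) = M F + M H" if "linear_functional F" "linear_functional H" for F H
    using M that unfolding fn_dual_def[of "fn_dual X"] by (simp add: dual_iff)
  have scale: "M (\<lambda>u. c * F u) = c * M F" if "linear_functional F" for c F
    using M that unfolding fn_dual_def[of "fn_dual X"] by (simp add: dual_iff)
  have "M (\<lambda>u. \<Sum>z\<in>S. F (point_fun z) * evaluation z u) = (\<Sum>z\<in>S. F (point_fun z) * M (evaluation z)) \<and>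
      linear_functional (\<lambda>u. \<Sum>z\<in>S. F (point_fun z) * evaluation z u)" if "finite S" for S
    using that
  proof (induction S rule: finite_induct)
    case empty
    show ?case using scale[OF linear_functional_zero, of 0] linear_functional_zero by simp
  next
    case (insert y S)
    note l = linear_functional_scale[OF evaluation_linear, of "F (point_fun y)" y]
    show ?case
      using insert add[OF l, of "\<lambda>u. \<Sum>z\<in>S. F (point_fun z) * evaluation z u"]
        linear_functional_add[OF l, of "\<lambda>u. \<Sum>z\<in>S. F (point_fun z) * evaluation z u"]
        scale[OF evaluation_linear] by simp
  qed
  from this[OF finZ] have
    "M (\<lambda>u. \<Sum>z\<in>Z. F (point_fun z) * evaluation z u) = (\<Sum>z\<in>Z. F (point_fun z) * M (evaluation z))" by simp
  moreover have "(\<lambda>u. \<Sum>z\<in>Z. F (point_fun z) * evaluation z u) = F"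
  proof
    fix u show "(\<Sum>z\<in>Z. F (point_fun z) * evaluation z u) = F u"
    proof (cases "u \<in> fn_carrier X")
      case True
      thus ?thesis by (simp add: linear_functional_expand[OF F True] evaluation_def mult.commute)
    next
      case False
      thus ?thesis using F by (simp add: evaluation_def linear_functional_def)
    qed
  qed
  ultimately show ?thesis by simp
qed

lemma bidual_vanish: "M \<in> fn_carrier (fn_bidual X) \<Longrightarrow> \<not> linear_functional F \<Longrightarrow> M F = 0"
  unfolding fn_dual_def[of "fn_dual X"] by (simp add: dual_iff)

text \<open>An element of the bidual is determined by its values on the point evaluations.\<close>

lemma bidual_eq_embed:
  assumes M: "M \<in> fn_carrier (fn_bidual X)" and D: "D \<in> fn_carrier X"
    and eq: "\<And>z. z \<in> Z \<Longrightarrow> M (evaluation z) = D z"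
  shows "M = fn_embed X D"
proof
  fix F show "M F = fn_embed X D F"
  proof (cases "linear_functional F")
    case True
    thus ?thesis
      using bidual_expand[OF M True] linear_functional_expand[OF True D]
      by (simp add: fn_embed_def dual_iff eq mult.commute)
  next
    case False
    thus ?thesis using bidual_vanish[OF M False] by (simp add: fn_embed_def dual_iff)
  qed
qed

text \<open>The norm of the embedded vector is found between a bound from above, given by a multiple of \<open>D\<close> in the
  unit ball, and a bound from below, given by a contractive functional. This takes the place of the isometry of
  the canonical embedding, for which one would have to extend functionals.\<close>

lemma embed_norm:
  assumes D: "D \<in> fn_carrier X" and K: "K > 0"
    and upper: "fn_norm X (\<lambda>x. complex_of_real (1 / K) * D x) \<le> 1"
    and F0: "linear_functional F0" "\<And>u. u \<in> fn_carrier X \<Longrightarrow> cmod (F0 u) \<le> fn_norm X u"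
    and F0D: "F0 D = complex_of_real K"
  shows "fn_embed X D \<in> fn_carrier (fn_bidual X)" and "fn_norm (fn_bidual X) (fn_embed X D) = K"
proof -
  let ?D = "\<lambda>x. complex_of_real (1 / K) * D x"
  have D': "?D \<in> fn_carrier X" by (rule scale_closed[OF D])
  have le: "cmod (F D) \<le> K * fn_norm (fn_dual X) F" if F: "linear_functional F" for F
  proof -
    have "F ?D = complex_of_real (1 / K) * F D" by (rule linear_functional_scaleD[OF F D])
    hence "cmod (F D) = K * cmod (F ?D)" using K by (simp add: norm_mult norm_divide)
    also have "\<dots> \<le> K * fn_norm (fn_dual X) F"
      using K by (intro mult_left_mono dual_norm_ge[OF F D' upper]) simp
    finally show ?thesis .
  qed
  show "fn_embed X D \<in> fn_carrier (fn_bidual X)"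
    unfolding fn_dual_def[of "fn_dual X"] using le
    by (auto simp: fn_embed_def dual_iff linear_functional_add linear_functional_scale intro!: exI[of _ K])
  have norm: "fn_norm (fn_bidual X) (fn_embed X D) =
      Sup {cmod (F D) | F. linear_functional F \<and> fn_norm (fn_dual X) F \<le> 1}"
    unfolding fn_dual_def[of "fn_dual X"]
    by (simp, rule arg_cong[where f = Sup]) (auto simp: fn_embed_def dual_iff)
  have F0n: "fn_norm (fn_dual X) F0 \<le> 1"
    unfolding fn_dual_def fn_space.simps
  proof (rule cSup_least)
    show "{cmod (F0 u) | u. u \<in> fn_carrier X \<and> fn_norm X u \<le> 1} \<noteq> {}" using D' upper by blast
  qed (use F0(2) in force)
  have bound: "x \<le> K" if x: "x \<in> {cmod (F D) | F. linear_functional F \<and> fn_norm (fn_dual X) F \<le> 1}" for x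
  proof -
    obtain F where F: "linear_functional F" "fn_norm (fn_dual X) F \<le> 1" "x = cmod (F D)" using x by blast
    have "x \<le> K * fn_norm (fn_dual X) F" using le F by simp
    also have "\<dots> \<le> K" using F(2) K by (simp add: mult_left_le)
    finally show ?thesis .
  qed
  have mem: "K \<in> {cmod (F D) | F. linear_functional F \<and> fn_norm (fn_dual X) F \<le> 1}"
    using F0(1) F0n F0D K by (auto intro!: exI[of _ F0])
  show "fn_norm (fn_bidual X) (fn_embed X D) = K"
    unfolding norm by (rule cSup_eq_maximum[OF mem bound])
qed

end

lemma adjoint_linear:
  assumes X: "fin_space X Z" and Y: "fin_space Y Z'"
    and T: "\<And>u. u \<in> fn_carrier X \<Longrightarrow> T u \<in> fn_carrier Y"
    and add: "\<And>u v. T (\<lambda>x. u x + v x) = (\<lambda>y. T u y + T v y)"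
    and scale: "\<And>c u. T (\<lambda>x. c * u x) = (\<lambda>y. c * T u y)"
    and F: "fin_space.linear_functional Y F"
  shows "fin_space.linear_functional X (fn_adjoint X T F)"
proof -
  interpret X: fin_space X Z by (rule X)
  interpret Y: fin_space Y Z' by (rule Y)
  show ?thesis
    using F T
    by (auto simp: X.linear_functional_def Y.linear_functional_def fn_adjoint_def add scale
        X.add_closed X.scale_closed)
qed

lemma biadjoint_embed:
  assumes X: "fin_space X Z" and Y: "fin_space Y Z'"
    and T: "\<And>u. u \<in> fn_carrier X \<Longrightarrow> T u \<in> fn_carrier Y"
    and add: "\<And>u v. T (\<lambda>x. u x + v x) = (\<lambda>y. T u y + T v y)"
    and scale: "\<And>c u. T (\<lambda>x. c * u x) = (\<lambda>y. c * T u y)"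
    and D: "D \<in> fn_carrier X"
  shows "fn_biadjoint X Y T (fn_embed X D) = fn_embed Y (T D)"
proof
  interpret X: fin_space X Z by (rule X)
  interpret Y: fin_space Y Z' by (rule Y)
  fix F
  have "X.linear_functional (fn_adjoint X T F)" if "Y.linear_functional F"
    using T that by (intro adjoint_linear[OF X Y]) (auto simp: add scale)
  thus "fn_biadjoint X Y T (fn_embed X D) F = fn_embed Y (T D) F"
    using D by (auto simp: fn_biadjoint_def fn_adjoint_def[of "fn_dual Y"] fn_embed_def X.dual_iff Y.dual_iff)
       (simp_all add: fn_adjoint_def)
qed

context fin_group
begin

section \<open>Matrix norms of the Fourier algebra\<close>

lemma left_regular_point_fun:
  assumes "s \<in> carrier G" "x \<in> carrier G" "t \<in> carrier G"
  shows "left_regular G s (point_fun x) t = (if s = t \<otimes> inv x then 1 else 0)"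
proof -
  have "inv s \<otimes> t = x \<longleftrightarrow> s = t \<otimes> inv x"
    using assms by (metis inv_closed inv_solve_left inv_solve_right)
  thus ?thesis using assms by (simp add: left_regular_def point_fun_def)
qed

lemma VN_sum:
  assumes "T \<in> VN G"
  shows "T (\<lambda>t. \<Sum>j\<in>J. a j * \<xi> j t) t = (\<Sum>j\<in>J. a j * T (\<xi> j) t)"
proof -
  obtain c where c: "T = (\<lambda>\<xi> t. \<Sum>s\<in>carrier G. c s * left_regular G s \<xi> t)"
    using assms by (auto simp: VN_def)
  have "T (\<lambda>t. \<Sum>j\<in>J. a j * \<xi> j t) t = (\<Sum>s\<in>carrier G. \<Sum>j\<in>J. a j * (c s * left_regular G s (\<xi> j) t))"
    unfolding c by (intro sum.cong refl) (simp add: left_regular_def sum_distrib_left mult_ac)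
  thus ?thesis unfolding c sum_distrib_left by (subst sum.swap)
qed

lemma VN_scale:
  assumes "T \<in> VN G"
  shows "T (\<lambda>t. a * \<xi> t) t = a * T \<xi> t"
  using VN_sum[OF assms, where J = "{()}" and a = "\<lambda>_. a" and \<xi> = "\<lambda>_. \<xi>"] by simp

lemma VN_point_fun:
  assumes T: "T \<in> VN G" and x: "x \<in> carrier G" and t: "t \<in> carrier G"
  shows "T (point_fun x) t = T (point_fun \<one>) (t \<otimes> inv x)"
proof -
  obtain c where c: "T = (\<lambda>\<xi> t. \<Sum>s\<in>carrier G. c s * left_regular G s \<xi> t)"
    using T by (auto simp: VN_def)
  show ?thesis
    unfolding c using x t by (intro sum.cong refl) (simp add: left_regular_point_fun)
qed

lemma VN_bounded:
  assumes T: "T \<in> VN G"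
  obtains B where "\<And>\<xi> t. (\<And>t. t \<in> carrier G \<Longrightarrow> cmod (\<xi> t) \<le> 1) \<Longrightarrow> cmod (T \<xi> t) \<le> B"
proof -
  obtain c where c: "T = (\<lambda>\<xi> t. \<Sum>s\<in>carrier G. c s * left_regular G s \<xi> t)"
    using T by (auto simp: VN_def)
  have "cmod (T \<xi> t) \<le> (\<Sum>s\<in>carrier G. cmod (c s))"
    if "\<And>t. t \<in> carrier G \<Longrightarrow> cmod (\<xi> t) \<le> 1" for \<xi> t
    unfolding c
  proof (rule sum_norm_le)
    fix s assume "s \<in> carrier G"
    hence "cmod (left_regular G s \<xi> t) \<le> 1" using that by (simp add: left_regular_def)
    thus "cmod (c s * left_regular G s \<xi> t) \<le> cmod (c s)" by (simp add: norm_mult mult_left_le)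
  qed
  thus ?thesis using that by blast
qed

lemma elements_mat_subset_iff:
  "elements_mat T \<subseteq> S \<longleftrightarrow> (\<forall>i<dim_row T. \<forall>j<dim_col T. T $$ (i, j) \<in> S)"
  by (auto dest: elements_matD intro: elements_matI)

text \<open>Boundedness makes the supremum in the norm meaningful, so that members of the set can be compared with it.\<close>

lemma VN_norm_bdd:
  assumes T: "elements_mat T \<subseteq> VN G"
  shows "bdd_above {sqrt (\<Sum>k<dim_row T. \<Sum>t\<in>carrier G.
        (cmod (\<Sum>l<dim_col T. (T $$ (k, l)) (\<xi> l) t))\<^sup>2) | \<xi>.
     (\<forall>l<dim_col T. \<xi> l \<in> group_fun G) \<and>
     (\<Sum>l<dim_col T. \<Sum>t\<in>carrier G. (cmod (\<xi> l t))\<^sup>2) \<le> 1}"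
proof -
  have "\<exists>B. \<forall>\<xi> t. (\<forall>t\<in>carrier G. cmod (\<xi> t) \<le> 1) \<longrightarrow> cmod ((T $$ (k, l)) \<xi> t) \<le> B"
    if kl: "k < dim_row T" "l < dim_col T" for k l
  proof -
    have "T $$ (k, l) \<in> VN G" using T kl by (auto simp: elements_mat_subset_iff)
    from VN_bounded[OF this] show ?thesis by metis
  qed
  then obtain B where B: "\<And>k l \<xi> t. k < dim_row T \<Longrightarrow> l < dim_col T \<Longrightarrow>
      (\<forall>t\<in>carrier G. cmod (\<xi> t) \<le> 1) \<Longrightarrow> cmod ((T $$ (k, l)) \<xi> t) \<le> B k l"
    by metis
  let ?C = "sqrt (\<Sum>k<dim_row T. \<Sum>t\<in>carrier G. (\<Sum>l<dim_col T. B k l)\<^sup>2)"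
  have "sqrt (\<Sum>k<dim_row T. \<Sum>t\<in>carrier G. (cmod (\<Sum>l<dim_col T. (T $$ (k, l)) (\<xi> l) t))\<^sup>2) \<le> ?C"
    if le1: "(\<Sum>l<dim_col T. \<Sum>t\<in>carrier G. (cmod (\<xi> l t))\<^sup>2) \<le> 1" for \<xi>
  proof -
    have "cmod (\<xi> l t) \<le> 1" if l: "l < dim_col T" and t: "t \<in> carrier G" for l t
    proof -
      have "(cmod (\<xi> l t))\<^sup>2 \<le> (\<Sum>t\<in>carrier G. (cmod (\<xi> l t))\<^sup>2)"
        by (rule member_le_sum[OF t]) (use fin in auto)
      also have "\<dots> \<le> (\<Sum>l<dim_col T. \<Sum>t\<in>carrier G. (cmod (\<xi> l t))\<^sup>2)"
        by (rule member_le_sum[where f = "\<lambda>l. \<Sum>t\<in>carrier G. (cmod (\<xi> l t))\<^sup>2"])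
           (use l in \<open>auto intro!: sum_nonneg\<close>)
      finally have "(cmod (\<xi> l t))\<^sup>2 \<le> 1\<^sup>2" using le1 by simp
      thus ?thesis by (rule power2_le_imp_le) simp
    qed
    hence "cmod ((T $$ (k, l)) (\<xi> l) t) \<le> B k l" if "k < dim_row T" "l < dim_col T" for k l t
      using B that by simp
    thus ?thesis
      by (intro real_sqrt_le_mono sum_mono power_mono sum_norm_le) auto
  qed
  thus ?thesis by (intro bdd_aboveI[of _ ?C]) auto
qed

lemma VN_norm_apply:
  assumes T: "elements_mat T \<subseteq> VN G" and le1: "VN_norm G T \<le> 1"
    and \<xi>: "\<And>l. l < dim_col T \<Longrightarrow> \<xi> l \<in> group_fun G"
  shows "(\<Sum>k<dim_row T. \<Sum>t\<in>carrier G. (cmod (\<Sum>l<dim_col T. (T $$ (k, l)) (\<xi> l) t))\<^sup>2)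
    \<le> (\<Sum>l<dim_col T. \<Sum>t\<in>carrier G. (cmod (\<xi> l t))\<^sup>2)" (is "?L \<xi> \<le> ?R \<xi>")
proof -
  have scaled: "?L (\<lambda>l t. complex_of_real a * \<xi> l t) = a\<^sup>2 * ?L \<xi>"
    "?R (\<lambda>l t. complex_of_real a * \<xi> l t) = a\<^sup>2 * ?R \<xi>" for a
  proof -
    have eq: "(\<Sum>l<dim_col T. (T $$ (k, l)) (\<lambda>t. complex_of_real a * \<xi> l t) t) =
        complex_of_real a * (\<Sum>l<dim_col T. (T $$ (k, l)) (\<xi> l) t)" if "k < dim_row T" for k t
      using T that unfolding sum_distrib_left
      by (intro sum.cong refl VN_scale) (auto simp: elements_mat_subset_iff)
    show "?L (\<lambda>l t. complex_of_real a * \<xi> l t) = a\<^sup>2 * ?L \<xi>"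
      by (simp add: eq norm_mult power_mult_distrib sum_distrib_left[symmetric])
    show "?R (\<lambda>l t. complex_of_real a * \<xi> l t) = a\<^sup>2 * ?R \<xi>"
      by (simp add: norm_mult power_mult_distrib sum_distrib_left[symmetric])
  qed
  have unit: "?L \<eta> \<le> 1" if "\<forall>l<dim_col T. \<eta> l \<in> group_fun G" "?R \<eta> \<le> 1" for \<eta>
  proof -
    have "sqrt (?L \<eta>) \<le> VN_norm G T"
      unfolding VN_norm_def by (rule cSup_upper[OF _ VN_norm_bdd[OF T]]) (use that in blast)
    from order_trans[OF this le1] show ?thesis by simp
  qed
  have gf: "\<forall>l<dim_col T. (\<lambda>t. complex_of_real a * \<xi> l t) \<in> group_fun G" for a
    using \<xi> by (auto simp: group_fun_def)
  have R0: "?R \<xi> \<ge> 0" and L0: "?L \<xi> \<ge> 0" by (auto intro!: sum_nonneg)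
  \<comment> \<open>If \<open>\<xi>\<close> vanishes, every multiple of it lies in the unit ball, which forces the left-hand side to be 0.\<close>
  show ?thesis
  proof (cases "?R \<xi> = 0")
    case True
    have "a\<^sup>2 * ?L \<xi> \<le> 1" for a using unit[OF gf[of a]] True by (simp add: scaled)
    from this[of "sqrt (2 / ?L \<xi>)"] L0 True show ?thesis
      by (cases "?L \<xi> = 0") (auto simp: field_simps)
  next
    case False
    let ?a = "1 / sqrt (?R \<xi>)"
    have "?a\<^sup>2 * ?R \<xi> = 1" using False R0 by (simp add: power_divide)
    hence "?a\<^sup>2 * ?L \<xi> \<le> 1" using unit[OF gf[of ?a]] by (simp only: scaled)
    thus ?thesis using False R0 by (simp add: power_divide field_simps)
  qed
qed

text \<open>The operator \<open>\<lambda>(s)\<close> as a matrix of size 1, in the form of the elements of \<open>VN(G)\<close>.\<close>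

definition translation :: "'a \<Rightarrow> (('a \<Rightarrow> complex) \<Rightarrow> ('a \<Rightarrow> complex)) mat" where
  "translation s = mat 1 1 (\<lambda>_. \<lambda>\<xi> t. \<Sum>r\<in>carrier G. point_fun s r * left_regular G r \<xi> t)"

lemma translation_VN: "translation s \<in> carrier_mat 1 1" "elements_mat (translation s) \<subseteq> VN G"
  by (auto simp: translation_def elements_mat_subset_iff VN_def)

lemma translation_apply:
  assumes "s \<in> carrier G"
  shows "(translation s $$ (0, 0)) \<xi> t = left_regular G s \<xi> t"
proof -
  have "(translation s $$ (0, 0)) \<xi> t = (\<Sum>r\<in>carrier G. if r = s then left_regular G s \<xi> t else 0)"
    unfolding translation_def by (simp, intro sum.cong refl) (simp add: point_fun_def)
  thus ?thesis using assms fin by simp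
qed

lemma translation_norm:
  assumes s: "s \<in> carrier G"
  shows "VN_norm G (translation s) \<le> 1"
  unfolding VN_norm_def
proof (rule cSup_least)
  show "{sqrt (\<Sum>k<dim_row (translation s). \<Sum>t\<in>carrier G.
        (cmod (\<Sum>l<dim_col (translation s). (translation s $$ (k, l)) (\<xi> l) t))\<^sup>2) | \<xi>.
     (\<forall>l<dim_col (translation s). \<xi> l \<in> group_fun G) \<and>
     (\<Sum>l<dim_col (translation s). \<Sum>t\<in>carrier G. (cmod (\<xi> l t))\<^sup>2) \<le> 1} \<noteq> {}"
    by (auto intro!: exI[of _ "\<lambda>_ _. 0"] simp: group_fun_def)
next
  fix x assume "x \<in> {sqrt (\<Sum>k<dim_row (translation s). \<Sum>t\<in>carrier G.
        (cmod (\<Sum>l<dim_col (translation s). (translation s $$ (k, l)) (\<xi> l) t))\<^sup>2) | \<xi>.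
     (\<forall>l<dim_col (translation s). \<xi> l \<in> group_fun G) \<and>
     (\<Sum>l<dim_col (translation s). \<Sum>t\<in>carrier G. (cmod (\<xi> l t))\<^sup>2) \<le> 1}"
  then obtain \<xi> where le: "(\<Sum>t\<in>carrier G. (cmod (\<xi> (0::nat) t))\<^sup>2) \<le> 1"
    and x: "x = sqrt (\<Sum>t\<in>carrier G. (cmod ((translation s $$ (0, 0)) (\<xi> 0) t))\<^sup>2)"
    using carrier_matD[OF translation_VN(1)[of s]] by auto
  have "(\<Sum>t\<in>carrier G. (cmod ((translation s $$ (0, 0)) (\<xi> 0) t))\<^sup>2) =
      (\<Sum>t\<in>carrier G. (cmod (\<xi> 0 (inv s \<otimes> t)))\<^sup>2)"
    by (intro sum.cong refl) (simp add: translation_apply[OF s] left_regular_def)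
  also have "\<dots> = (\<Sum>t\<in>carrier G. (cmod (\<xi> 0 t))\<^sup>2)"
    by (rule sum_left_translate) (use s in simp)
  finally show "x \<le> 1" using le x by simp
qed

text \<open>Apply the matrix \<open>T\<close> to functions supported at the identity and read off the values at \<open>s\<close>.\<close>

lemma coefficient_matrix_norm:
  assumes T: "T \<in> carrier_mat m m" "elements_mat T \<subseteq> VN G" "VN_norm G T \<le> 1" and s: "s \<in> carrier G"
  shows "mat_opnorm (map_mat (\<lambda>\<tau>. \<tau> (point_fun \<one>) s) T) \<le> 1"
proof (rule mat_opnorm_le)
  let ?C = "map_mat (\<lambda>\<tau>. \<tau> (point_fun \<one>) s) T"
  show C: "?C \<in> carrier_mat m m" using T by simp
  fix v :: "complex vec" assume v: "v \<in> carrier_vec m"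
  define \<xi> where "\<xi> l = (\<lambda>t. v $ l * point_fun \<one> t)" for l
  have comp: "(?C *\<^sub>v v) $ k = (\<Sum>l<m. (T $$ (k, l)) (\<xi> l) s)" if k: "k < m" for k
  proof -
    have "(?C *\<^sub>v v) $ k = (\<Sum>l<m. ?C $$ (k, l) * v $ l)" by (rule mult_mat_vec_index[OF C v k])
    also have "\<dots> = (\<Sum>l<m. (T $$ (k, l)) (\<xi> l) s)"
      unfolding \<xi>_def using T k
      by (intro sum.cong refl) (auto simp: VN_scale elements_mat_subset_iff mult.commute)
    finally show ?thesis .
  qed
  have "(vec_l2 (?C *\<^sub>v v))\<^sup>2 = (\<Sum>k<m. (cmod (\<Sum>l<m. (T $$ (k, l)) (\<xi> l) s))\<^sup>2)"
    using C T(1) by (simp add: vec_l2_power2 comp del: index_mult_mat_vec)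
  also have "\<dots> \<le> (\<Sum>k<m. \<Sum>t\<in>carrier G. (cmod (\<Sum>l<m. (T $$ (k, l)) (\<xi> l) t))\<^sup>2)"
    by (intro sum_mono member_le_sum[OF s]) (use fin in auto)
  also have "\<dots> \<le> (\<Sum>l<m. \<Sum>t\<in>carrier G. (cmod (\<xi> l t))\<^sup>2)"
    using VN_norm_apply[OF T(2,3), of \<xi>] T(1) by (simp add: \<xi>_def group_fun_def point_fun_def)
  also have "\<dots> = (\<Sum>l<m. \<Sum>t\<in>carrier G. if t = \<one> then (cmod (v $ l))\<^sup>2 else 0)"
    by (intro sum.cong refl) (auto simp: \<xi>_def point_fun_def)
  also have "\<dots> = (vec_l2 v)\<^sup>2" using v fin by (simp add: vec_l2_power2)
  finally have "vec_l2 (?C *\<^sub>v v) \<le> vec_l2 v"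
      by (rule power2_le_imp_le) simp
    thus "vec_l2 (?C *\<^sub>v v) \<le> 1 * vec_l2 v" by (simp only: mult_1)
qed simp

lemma VN_pairing_eq: "VN_pairing G f T = (\<Sum>s\<in>carrier G. f s * T (point_fun \<one>) s)"
  by (simp add: VN_pairing_def point_fun_def)

text \<open>The pairing is a sum over \<open>s\<close> of Kronecker products of the values of \<open>f\<close> with the coefficient matrices
  of \<open>T\<close>, which gives a bound that is uniform in the size of \<open>T\<close>.\<close>

lemma fourier_norm_bdd:
  assumes f: "f \<in> carrier_mat n n'"
  shows "bdd_above {mat_opnorm (kron_with (VN_pairing G) f T) | m T.
    T \<in> carrier_mat m m \<and> elements_mat T \<subseteq> VN G \<and> VN_norm G T \<le> 1}"
proof -
  let ?f = "\<lambda>s. map_mat (\<lambda>h. h s) f"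
  have "mat_opnorm (kron_with (VN_pairing G) f T) \<le> (\<Sum>s\<in>carrier G. mat_opnorm (?f s))"
    if T: "T \<in> carrier_mat m m" "elements_mat T \<subseteq> VN G" "VN_norm G T \<le> 1" for m T
  proof -
    let ?C = "\<lambda>s. map_mat (\<lambda>\<tau>. \<tau> (point_fun \<one>) s) T"
    have fs: "?f s \<in> carrier_mat n n'" for s using f by simp
    have Cs: "?C s \<in> carrier_mat m m" for s using T by simp
    have "mat_opnorm (kron_with (VN_pairing G) f T) \<le>
        (\<Sum>s\<in>carrier G. cmod 1 * mat_opnorm (kron_with (*) (?f s) (?C s)))"
    proof (rule mat_opnorm_combination_le[OF fin kron_with_carrier[OF f T(1)] kron_with_carrier[OF fs Cs]])
      fix x y assume xy: "x < n * m" "y < n' * m"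
      hence "0 < m" by (cases m) auto
      hence "x div m < n" "y div m < n'" "x mod m < m" "y mod m < m"
        using xy by (auto simp: less_mult_imp_div_less)
      thus "kron_with (VN_pairing G) f T $$ (x, y) =
          (\<Sum>s\<in>carrier G. 1 * kron_with (*) (?f s) (?C s) $$ (x, y))"
        using f T(1) by (simp add: kron_with_index[OF f T(1) xy] kron_with_index[OF fs Cs xy] VN_pairing_eq)
    qed
    also have "\<dots> \<le> (\<Sum>s\<in>carrier G. mat_opnorm (?f s))"
    proof (rule sum_mono)
      fix s assume s: "s \<in> carrier G"
      have "mat_opnorm (kron_with (*) (?f s) (?C s)) \<le> mat_opnorm (?f s) * mat_opnorm (?C s)"
        by (rule mat_opnorm_kron[OF fs Cs])
      also have "\<dots> \<le> mat_opnorm (?f s)"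
        by (rule mult_left_le[OF coefficient_matrix_norm[OF T s]]) simp
      finally show "cmod 1 * mat_opnorm (kron_with (*) (?f s) (?C s)) \<le> mat_opnorm (?f s)" by simp
    qed
    finally show ?thesis .
  qed
  thus ?thesis by (intro bdd_aboveI[of _ "\<Sum>s\<in>carrier G. mat_opnorm (?f s)"]) auto
qed

text \<open>Evaluation at \<open>s\<close> is the pairing with the translation by \<open>s\<close>.\<close>

lemma evaluation_le_fourier_norm:
  assumes f: "f \<in> carrier_mat n n'" and s: "s \<in> carrier G"
  shows "mat_opnorm (map_mat (\<lambda>h. h s) f) \<le> os_norm (fourier_algebra G) f"
proof -
  have pair: "VN_pairing G h (translation s $$ (0, 0)) = h s" for h
  proof -
    have "VN_pairing G h (translation s $$ (0, 0)) = (\<Sum>r\<in>carrier G. if r = s then h s else 0)"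
      unfolding VN_pairing_eq using s
      by (intro sum.cong refl) (auto simp: translation_apply left_regular_point_fun)
    thus ?thesis using s fin by simp
  qed
  have "kron_with (VN_pairing G) f (translation s) = map_mat (\<lambda>h. h s) f"
    using f carrier_matD[OF translation_VN(1)[of s]] by (intro eq_matI) (auto simp: kron_with_def pair)
  hence "mat_opnorm (map_mat (\<lambda>h. h s) f) \<in> {mat_opnorm (kron_with (VN_pairing G) f T) | m T.
      T \<in> carrier_mat m m \<and> elements_mat T \<subseteq> VN G \<and> VN_norm G T \<le> 1}"
    using translation_VN[of s] translation_norm[OF s] by (metis (mono_tags, lifting) mem_Collect_eq)
  from cSup_upper[OF this fourier_norm_bdd[OF f]] show ?thesis
    by (simp add: fourier_algebra_def)
qed

text \<open>The coefficients of the left regular representation in the basis of point masses: as a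
  function of \<open>s\<close>, the entry \<open>(i, j)\<close> is 1 exactly when \<open>s e(j) = e(i)\<close>.\<close>

definition regular_matrix :: "(nat \<Rightarrow> 'a) \<Rightarrow> ('a \<Rightarrow> complex) mat" where
  "regular_matrix e = mat (card (carrier G)) (card (carrier G)) (\<lambda>(i, j). point_fun (e i \<otimes> inv (e j)))"

text \<open>Paired with an operator \<open>T\<close>, the coefficients of the regular representation give the matrix of \<open>T\<close> with respect
  to the point masses, so the pairing has the same norm as \<open>T\<close>.\<close>

lemma regular_matrix_norm:
  assumes e: "bij_betw e {..<card (carrier G)} (carrier G)"
  shows "os_norm (fourier_algebra G) (regular_matrix e) \<le> 1"
proof -
  let ?N = "card (carrier G)"
  have ec: "e i \<in> carrier G" if "i < ?N" for i using e that by (auto simp: bij_betw_def)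
  have R: "regular_matrix e \<in> carrier_mat ?N ?N" by (simp add: regular_matrix_def)
  have "mat_opnorm (kron_with (VN_pairing G) (regular_matrix e) T) \<le> 1"
    if T: "T \<in> carrier_mat m m" "elements_mat T \<subseteq> VN G" "VN_norm G T \<le> 1" for m T
  proof (rule mat_opnorm_le[OF kron_with_carrier[OF R T(1)]])
    have TVN: "T $$ (k, l) \<in> VN G" if "k < m" "l < m" for k l
      using T that by (auto simp: elements_mat_subset_iff)
    have pair: "VN_pairing G (regular_matrix e $$ (i, j)) (T $$ (k, l)) = (T $$ (k, l)) (point_fun (e j)) (e i)"
      if "i < ?N" "j < ?N" "k < m" "l < m" for i j k l
    proof -
      have "VN_pairing G (regular_matrix e $$ (i, j)) (T $$ (k, l)) =
          (\<Sum>s\<in>carrier G. if s = e i \<otimes> inv (e j) then (T $$ (k, l)) (point_fun \<one>) s else 0)"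
        unfolding VN_pairing_eq using that by (intro sum.cong refl) (simp add: regular_matrix_def point_fun_def)
      thus ?thesis
        using that ec fin VN_point_fun[OF TVN[OF that(3,4)] ec[OF that(2)] ec[OF that(1)]] by simp
    qed
    fix z :: "complex vec" assume z: "z \<in> carrier_vec (?N * m)"
    \<comment> \<open>A column vector for the Kronecker product is a family of functions on the group.\<close>
    define \<xi> where "\<xi> l = (\<lambda>t. \<Sum>j<?N. z $ (j * m + l) * point_fun (e j) t)" for l
    have \<xi>gf: "\<xi> l \<in> group_fun G" for l
      using ec by (auto simp: \<xi>_def group_fun_def point_fun_def intro!: sum.neutral)
    have \<xi>e: "\<xi> l (e j) = z $ (j * m + l)" if "j < ?N" for j l
    proof -
      have "\<xi> l (e j) = (\<Sum>j'<?N. if j' = j then z $ (j * m + l) else 0)"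
        unfolding \<xi>_def using e that
        by (intro sum.cong refl) (auto simp: point_fun_def bij_betw_def inj_on_def)
      thus ?thesis using that by simp
    qed
    let ?K = "kron_with (VN_pairing G) (regular_matrix e) T"
    have comp: "(?K *\<^sub>v z) $ (i * m + k) = (\<Sum>l<m. (T $$ (k, l)) (\<xi> l) (e i))"
      if i: "i < ?N" and k: "k < m" for i k
    proof -
      have "(?K *\<^sub>v z) $ (i * m + k) =
          (\<Sum>j<?N. \<Sum>l<m. z $ (j * m + l) * (T $$ (k, l)) (point_fun (e j)) (e i))"
        unfolding kron_with_mult_vec[OF R T(1) z i k]
        using i k by (intro sum.cong refl) (simp add: pair mult.commute)
      also have "\<dots> = (\<Sum>l<m. \<Sum>j<?N. z $ (j * m + l) * (T $$ (k, l)) (point_fun (e j)) (e i))"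
        by (rule sum.swap)
      also have "\<dots> = (\<Sum>l<m. (T $$ (k, l)) (\<xi> l) (e i))"
        unfolding \<xi>_def using k by (intro sum.cong refl VN_sum[symmetric] TVN) auto
      finally show ?thesis .
    qed
    have "(vec_l2 (?K *\<^sub>v z))\<^sup>2 = (\<Sum>i<?N. \<Sum>k<m. (cmod (\<Sum>l<m. (T $$ (k, l)) (\<xi> l) (e i)))\<^sup>2)"
      by (subst vec_l2_pairs[OF mult_mat_vec_carrier[OF kron_with_carrier[OF R T(1)] z]]) (simp add: comp)
    also have "\<dots> = (\<Sum>k<m. \<Sum>i<?N. (cmod (\<Sum>l<m. (T $$ (k, l)) (\<xi> l) (e i)))\<^sup>2)" by (rule sum.swap)
    also have "\<dots> = (\<Sum>k<m. \<Sum>t\<in>carrier G. (cmod (\<Sum>l<m. (T $$ (k, l)) (\<xi> l) t))\<^sup>2)"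
      by (intro sum.cong refl sum.reindex_bij_betw[OF e])
    also have "\<dots> \<le> (\<Sum>l<m. \<Sum>t\<in>carrier G. (cmod (\<xi> l t))\<^sup>2)"
      using VN_norm_apply[OF T(2,3), of \<xi>] T(1) \<xi>gf by simp
    also have "\<dots> = (\<Sum>l<m. \<Sum>j<?N. (cmod (\<xi> l (e j)))\<^sup>2)"
      by (intro sum.cong refl sum.reindex_bij_betw[OF e, symmetric])
    also have "\<dots> = (vec_l2 z)\<^sup>2"
      unfolding vec_l2_pairs[OF z] by (subst sum.swap) (simp add: \<xi>e)
    finally have "vec_l2 (?K *\<^sub>v z) \<le> vec_l2 z"
      by (rule power2_le_imp_le) simp
    thus "vec_l2 (?K *\<^sub>v z) \<le> 1 * vec_l2 z" by (simp only: mult_1)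
  qed simp
  moreover have "{mat_opnorm (kron_with (VN_pairing G) (regular_matrix e) T) | m T.
      T \<in> carrier_mat m m \<and> elements_mat T \<subseteq> VN G \<and> VN_norm G T \<le> 1} \<noteq> {}"
    using translation_VN[of \<one>] translation_norm[OF one_closed] by blast
  ultimately show ?thesis
    unfolding fourier_algebra_def op_space.simps by (intro cSup_least) auto
qed

end

lemma row_mat_column_index:
  fixes A B C :: "complex mat"
  assumes "A \<in> carrier_mat 1 m" "B \<in> carrier_mat m m" "C \<in> carrier_mat m 1"
  shows "(A * B * C) $$ (0, 0) = (\<Sum>b<m. \<Sum>a<m. A $$ (0, a) * B $$ (a, b) * C $$ (b, 0))"
proof -
  have AB: "A * B \<in> carrier_mat 1 m" using assms(1,2) by (rule mult_carrier_mat)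
  have "(A * B * C) $$ (0, 0) = (\<Sum>b<m. (A * B) $$ (0, b) * C $$ (b, 0))"
    by (rule mult_mat_index[OF AB assms(3)]) auto
  also have "\<dots> = (\<Sum>b<m. (\<Sum>a<m. A $$ (0, a) * B $$ (a, b)) * C $$ (b, 0))"
    by (intro sum.cong refl arg_cong2[where f = "(*)"] mult_mat_index[OF assms(1,2)]) auto
  finally show ?thesis by (simp add: sum_distrib_right)
qed

lemma row_kron_column_index:
  fixes A B V W :: "complex mat"
  assumes A: "A \<in> carrier_mat 1 (p * q)" and V: "V \<in> carrier_mat p p" and W: "W \<in> carrier_mat q q"
    and B: "B \<in> carrier_mat (p * q) 1"
  shows "(A * kron_with (*) V W * B) $$ (0, 0) =
    (\<Sum>j<p. \<Sum>l<q. \<Sum>i<p. \<Sum>k<q.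
      A $$ (0, i * q + k) * V $$ (i, j) * W $$ (k, l) * B $$ (j * q + l, 0))"
proof -
  have K: "kron_with (*) V W \<in> carrier_mat (p * q) (p * q)" by (rule kron_with_carrier[OF V W])
  let ?f = "\<lambda>i k j l. A $$ (0, i * q + k) * V $$ (i, j) * W $$ (k, l) * B $$ (j * q + l, 0)"
  have "(A * kron_with (*) V W * B) $$ (0, 0) =
      (\<Sum>b<p * q. \<Sum>a<p * q. ?f (a div q) (a mod q) (b div q) (b mod q))"
    unfolding row_mat_column_index[OF A K B]
    by (intro sum.cong refl) (simp add: kron_with_index[OF V W] mult.assoc)
  also have "\<dots> = (\<Sum>b<p * q. \<Sum>i<p. \<Sum>k<q. ?f i k (b div q) (b mod q))"
  proof (rule sum.cong[OF refl])
    fix b show "(\<Sum>a<p * q. ?f (a div q) (a mod q) (b div q) (b mod q)) =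
        (\<Sum>i<p. \<Sum>k<q. ?f i k (b div q) (b mod q))"
      by (rule sum_div_mod[where f = "\<lambda>i k. ?f i k (b div q) (b mod q)"])
  qed
  also have "\<dots> = (\<Sum>j<p. \<Sum>l<q. \<Sum>i<p. \<Sum>k<q. ?f i k j l)"
    by (rule sum_div_mod[where f = "\<lambda>j l. \<Sum>i<p. \<Sum>k<q. ?f i k j l"])
  finally show ?thesis .
qed

lemma sum_bilinear:
  fixes f g :: "'r \<Rightarrow> 'x \<Rightarrow> complex"
  shows "(\<Sum>x\<in>X. \<Sum>y\<in>Y. b x * b' y * (\<Sum>r\<in>S. c r * f r x * g r y)) =
    (\<Sum>r\<in>S. c r * (\<Sum>x\<in>X. b x * f r x) * (\<Sum>y\<in>Y. b' y * g r y))"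
proof -
  have "(\<Sum>x\<in>X. \<Sum>y\<in>Y. b x * b' y * (\<Sum>r\<in>S. c r * f r x * g r y)) =
      (\<Sum>x\<in>X. \<Sum>y\<in>Y. \<Sum>r\<in>S. c r * ((b x * f r x) * (b' y * g r y)))"
    by (intro sum.cong refl) (simp add: sum_distrib_left mult_ac)
  also have "\<dots> = (\<Sum>x\<in>X. \<Sum>r\<in>S. \<Sum>y\<in>Y. c r * ((b x * f r x) * (b' y * g r y)))"
    by (intro sum.cong refl sum.swap)
  also have "\<dots> = (\<Sum>r\<in>S. \<Sum>x\<in>X. \<Sum>y\<in>Y. c r * ((b x * f r x) * (b' y * g r y)))"
    by (rule sum.swap)
  also have "\<dots> = (\<Sum>r\<in>S. c r * ((\<Sum>x\<in>X. b x * f r x) * (\<Sum>y\<in>Y. b' y * g r y)))"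
    by (intro sum.cong refl, subst sum_product) (simp only: sum_distrib_left)
  finally show ?thesis by (simp only: mult.assoc)
qed

locale weighted_group = fin_group G for G (structure) +
  fixes \<omega> :: "'a rep set \<Rightarrow> real"
  assumes weight_pos: "\<pi> \<in> dual_group G \<Longrightarrow> \<omega> \<pi> > 0"
begin

abbreviation A where "A \<equiv> weighted_fourier_algebra G \<omega>"
abbreviation P where "P \<equiv> os_fn_space (proj_tensor A A)"
abbreviation weight where "weight \<equiv> \<lambda>\<pi>. complex_of_real (\<omega> \<pi>)"
abbreviation inv_weight where "inv_weight \<equiv> \<lambda>\<pi>. complex_of_real (1 / \<omega> \<pi>)"
abbreviation weight_fun where "weight_fun \<equiv> central_fun weight"
abbreviation inv_fun where "inv_fun \<equiv> central_fun inv_weight"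

lemma carrier_A: "os_carrier A = group_fun G"
  by (auto simp: weighted_fourier_algebra_def finite_dual)

lemma norm_A: "os_norm A v = os_norm (fourier_algebra G) (map_mat (multiplier weight) v)"
proof -
  have "weight_multiplier G \<omega> = multiplier weight" by (rule ext) (rule weight_multiplier_eq)
  thus ?thesis by (simp add: weighted_fourier_algebra_def)
qed

lemma multiplier_weight_cancel:
  assumes f: "f \<in> group_fun G"
  shows "multiplier weight (multiplier inv_weight f) = f"
    and "multiplier inv_weight (multiplier weight f) = f"
proof -
  have "inv_weight \<pi> * weight \<pi> = 1" "weight \<pi> * inv_weight \<pi> = 1" if "\<pi> \<in> dual_group G" for \<pi>
    unfolding of_real_mult[symmetric] using weight_pos[OF that] by simp_all
  thus "multiplier weight (multiplier inv_weight f) = f" "multiplier inv_weight (multiplier weight f) = f"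
    by (auto intro!: multiplier_inverse f simp del: of_real_divide)
qed

lemma multiplier_apply:
  "x \<in> carrier G \<Longrightarrow> multiplier a f x = (\<Sum>y\<in>carrier G. central_fun a (inv y \<otimes> x) * f y)"
  by (simp add: multiplier_def mult.commute)

lemma os_mats_A: "v \<in> os_mats A p \<longleftrightarrow> v \<in> carrier_mat p p \<and> (\<forall>i<p. \<forall>j<p. v $$ (i, j) \<in> group_fun G)"
  by (auto simp: os_mats_def carrier_A elements_mat_subset_iff)

lemma evaluation_le_norm_A:
  assumes v: "v \<in> carrier_mat p p" and y: "y \<in> carrier G"
  shows "mat_opnorm (map_mat (\<lambda>f. multiplier weight f y) v) \<le> os_norm A v"
proof -
  have "map_mat (\<lambda>f. multiplier weight f y) v = map_mat (\<lambda>h. h y) (map_mat (multiplier weight) v)"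
    by (rule eq_matI) auto
  thus ?thesis
    using evaluation_le_fourier_norm[OF _ y, of "map_mat (multiplier weight) v" p p] v
    by (simp add: norm_A)
qed

lemma norm_A_nonneg: "v \<in> carrier_mat p p \<Longrightarrow> os_norm A v \<ge> 0"
  using evaluation_le_norm_A[OF _ one_closed, of v p] mat_opnorm_nonneg order_trans by blast

section \<open>Completely bounded functionals on the weighted algebra\<close>

text \<open>The functional \<open>f \<mapsto> \<Sum> b(x) f(x)\<close> has completely bounded norm at most \<open>C\<close> on the weighted algebra.\<close>

definition cb_bound :: "('a \<Rightarrow> complex) \<Rightarrow> real \<Rightarrow> bool" where
  "cb_bound b C \<longleftrightarrow> C \<ge> 0 \<and> (\<forall>p. \<forall>v\<in>os_mats A p.
     mat_opnorm (map_mat (\<lambda>f. \<Sum>x\<in>carrier G. b x * f x) v) \<le> C * os_norm A v)"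

text \<open>Summation against the function \<open>x \<mapsto> W\<^sub>\<omega>(x\<^sup>-\<^sup>1)\<close> multiplies by the weight and evaluates at the identity.\<close>

lemma cb_bound_weight: "cb_bound (\<lambda>x. weight_fun (inv x)) 1"
  unfolding cb_bound_def
proof (intro conjI allI ballI)
  fix p v assume v: "v \<in> os_mats A p"
  have "map_mat (\<lambda>f. \<Sum>x\<in>carrier G. weight_fun (inv x) * f x) v =
      map_mat (\<lambda>f. multiplier weight f \<one>) v"
    by (rule eq_matI) (auto simp: multiplier_def mult.commute intro!: sum.cong)
  thus "mat_opnorm (map_mat (\<lambda>f. \<Sum>x\<in>carrier G. weight_fun (inv x) * f x) v) \<le> 1 * os_norm A v"
    using evaluation_le_norm_A[OF _ one_closed, of v p] v by (simp add: os_mats_A)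
qed simp

text \<open>Division by the weight is convolution with a fixed function, so a value of \<open>f\<close> is a fixed linear combination
  of the values of its weighted version.\<close>

lemma cb_bound_point:
  assumes s: "s \<in> carrier G"
  obtains C where "cb_bound (point_fun s) C"
proof -
  let ?c = "\<lambda>y. inv_fun (inv y \<otimes> s)"
  let ?C = "\<Sum>y\<in>carrier G. cmod (?c y)"
  have "mat_opnorm (map_mat (\<lambda>f. \<Sum>x\<in>carrier G. point_fun s x * f x) v) \<le> ?C * os_norm A v"
    if v: "v \<in> os_mats A p" for p v
  proof -
    have vc: "v \<in> carrier_mat p p" and vg: "\<And>i j. i < p \<Longrightarrow> j < p \<Longrightarrow> v $$ (i, j) \<in> group_fun G"
      using v by (auto simp: os_mats_A)
    let ?M = "\<lambda>y. map_mat (\<lambda>f. multiplier weight f y) v"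
    have "mat_opnorm (map_mat (\<lambda>f. \<Sum>x\<in>carrier G. point_fun s x * f x) v) \<le>
        (\<Sum>y\<in>carrier G. cmod (?c y) * mat_opnorm (?M y))"
    proof (rule mat_opnorm_combination_le[OF fin])
      fix i j assume ij: "i < p" "j < p"
      have "(\<Sum>x\<in>carrier G. point_fun s x * (v $$ (i, j)) x) =
          (\<Sum>x\<in>carrier G. if x = s then (v $$ (i, j)) s else 0)"
        by (intro sum.cong refl) (simp add: point_fun_def)
      also have "\<dots> = (v $$ (i, j)) s" using s fin by simp
      also have "\<dots> = multiplier inv_weight (multiplier weight (v $$ (i, j))) s"
        by (simp only: multiplier_weight_cancel(2)[OF vg[OF ij]])
      also have "\<dots> = (\<Sum>y\<in>carrier G. ?c y * multiplier weight (v $$ (i, j)) y)"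
        by (rule multiplier_apply[OF s])
      finally show "map_mat (\<lambda>f. \<Sum>x\<in>carrier G. point_fun s x * f x) v $$ (i, j) =
          (\<Sum>y\<in>carrier G. ?c y * ?M y $$ (i, j))"
        using ij vc by simp
    qed (use vc in auto)
    also have "\<dots> \<le> (\<Sum>y\<in>carrier G. cmod (?c y) * os_norm A v)"
      by (intro sum_mono mult_left_mono evaluation_le_norm_A[OF vc]) auto
    finally show ?thesis by (simp add: sum_distrib_right)
  qed
  moreover have "?C \<ge> 0" by (intro sum_nonneg) simp
  ultimately have "cb_bound (point_fun s) ?C" unfolding cb_bound_def by blast
  thus ?thesis using that by blast
qed

section \<open>The projective tensor square\<close>

definition enum :: "nat \<Rightarrow> 'a" where
  "enum = (SOME e. bij_betw e {..<card (carrier G)} (carrier G))"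

lemma enum_bij: "bij_betw enum {..<card (carrier G)} (carrier G)"
  unfolding enum_def
proof (rule someI_ex[where P = "\<lambda>e. bij_betw e {..<card (carrier G)} (carrier G)"])
  show "\<exists>e. bij_betw e {..<card (carrier G)} (carrier G)"
    using ex_bij_betw_nat_finite[OF fin] by (simp add: lessThan_atLeast0)
qed

lemma enum_carrier: "i < card (carrier G) \<Longrightarrow> enum i \<in> carrier G"
  using enum_bij by (auto simp: bij_betw_def)

lemma sum_enum: "(\<Sum>i<card (carrier G). f (enum i)) = (\<Sum>x\<in>carrier G. f x)"
  by (rule sum.reindex_bij_betw[OF enum_bij])

text \<open>The factorizations of a single function of two variables over which the infimum in the projective
  norm is taken.\<close>

definition factorizes :: "('a \<times> 'a \<Rightarrow> complex) \<Rightarrow> nat \<Rightarrow> nat \<Rightarrow> complex mat \<Rightarrow>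
    ('a \<Rightarrow> complex) mat \<Rightarrow> ('a \<Rightarrow> complex) mat \<Rightarrow> complex mat \<Rightarrow> bool" where
  "factorizes u p q \<alpha> v w \<beta> \<longleftrightarrow> v \<in> os_mats A p \<and> w \<in> os_mats A q \<and>
     \<alpha> \<in> carrier_mat 1 (p * q) \<and> \<beta> \<in> carrier_mat (p * q) 1 \<and>
     (\<forall>x y. u (x, y) = (\<alpha> * kron_with (*) (map_mat (\<lambda>h. h x) v) (map_mat (\<lambda>h. h y) w) * \<beta>) $$ (0, 0))"

definition factorization_norms :: "('a \<times> 'a \<Rightarrow> complex) \<Rightarrow> real set" where
  "factorization_norms u = {mat_opnorm \<alpha> * os_norm A v * os_norm A w * mat_opnorm \<beta> | \<alpha> v w \<beta> p q.
     factorizes u p q \<alpha> v w \<beta>}"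

lemma map_mat_kron_tensor:
  assumes v: "v \<in> carrier_mat p p" and w: "w \<in> carrier_mat q q"
  shows "map_mat (\<lambda>h. h (x, y)) (kron_with tensor_fun v w) =
    kron_with (*) (map_mat (\<lambda>h. h x) v) (map_mat (\<lambda>h. h y) w)"
proof (rule eq_matI)
  fix i j
  assume "i < dim_row (kron_with (*) (map_mat (\<lambda>h. h x) v) (map_mat (\<lambda>h. h y) w))"
    "j < dim_col (kron_with (*) (map_mat (\<lambda>h. h x) v) (map_mat (\<lambda>h. h y) w))"
  hence ij: "i < p * q" "j < p * q" using v w by (auto simp: kron_with_def)
  hence "0 < q" by (cases q) auto
  hence "i div q < p" "j div q < p" "i mod q < q" "j mod q < q"
    using ij by (auto simp: less_mult_imp_div_less)
  thus "map_mat (\<lambda>h. h (x, y)) (kron_with tensor_fun v w) $$ (i, j) =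
      kron_with (*) (map_mat (\<lambda>h. h x) v) (map_mat (\<lambda>h. h y) w) $$ (i, j)"
    using ij v w by (simp add: kron_with_def tensor_fun_def)
qed (use v w in \<open>auto simp: kron_with_def\<close>)

text \<open>For a single function the factorized identity is between matrices of size 1, so it can be read entrywise.\<close>

lemma norm_P: "fn_norm P u = Inf (factorization_norms u)"
proof -
  have eq: "(\<forall>z. map_mat (\<lambda>h. h z) (mat 1 1 (\<lambda>_. u)) = \<alpha> * map_mat (\<lambda>h. h z) (kron_with tensor_fun v w) * \<beta>) \<longleftrightarrow>
      (\<forall>x y. u (x, y) = (\<alpha> * kron_with (*) (map_mat (\<lambda>h. h x) v) (map_mat (\<lambda>h. h y) w) * \<beta>) $$ (0, 0))"
    if "v \<in> carrier_mat p p" "w \<in> carrier_mat q q" "\<alpha> \<in> carrier_mat 1 (p * q)" "\<beta> \<in> carrier_mat (p * q) 1"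
    for \<alpha> v w \<beta> p q
  proof -
    have "map_mat (\<lambda>h. h (x, y)) (mat 1 1 (\<lambda>_. u)) = \<alpha> * map_mat (\<lambda>h. h (x, y)) (kron_with tensor_fun v w) * \<beta> \<longleftrightarrow>
        u (x, y) = (\<alpha> * kron_with (*) (map_mat (\<lambda>h. h x) v) (map_mat (\<lambda>h. h y) w) * \<beta>) $$ (0, 0)" for x y
    proof -
      let ?R = "\<alpha> * kron_with (*) (map_mat (\<lambda>h. h x) v) (map_mat (\<lambda>h. h y) w) * \<beta>"
      have "dim_row ?R = 1" "dim_col ?R = 1" using that by auto
      hence "map_mat (\<lambda>h. h (x, y)) (mat 1 1 (\<lambda>_. u)) = ?R \<longleftrightarrow> u (x, y) = ?R $$ (0, 0)"
        by (auto simp: mat_eq_iff)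
      thus ?thesis by (simp only: map_mat_kron_tensor[OF that(1,2)])
    qed
    thus ?thesis by (simp only: split_paired_All)
  qed
  have "(v \<in> os_mats A p \<and> w \<in> os_mats A q \<and> \<alpha> \<in> carrier_mat 1 (p * q) \<and> \<beta> \<in> carrier_mat (p * q) 1 \<and>
      (\<forall>z. map_mat (\<lambda>h. h z) (mat 1 1 (\<lambda>_. u)) = \<alpha> * map_mat (\<lambda>h. h z) (kron_with tensor_fun v w) * \<beta>)) \<longleftrightarrow>
      factorizes u p q \<alpha> v w \<beta>" for \<alpha> v w \<beta> p q
    unfolding factorizes_def by (intro conj_cong refl eq) (simp_all add: os_mats_A)
  thus ?thesis
    unfolding os_fn_space_def proj_tensor_def factorization_norms_def
    by (simp del: One_nat_def) (rule arg_cong[where f = Inf], blast)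
qed

text \<open>A function of two variables is the sum over \<open>x\<close> of its slices tensored with point masses.\<close>

lemma carrier_P: "fn_carrier P = {u. \<forall>z. z \<notin> carrier G \<times> carrier G \<longrightarrow> u z = 0}" (is "_ = ?R")
proof
  have eq: "fn_carrier P = {\<lambda>z. \<Sum>i<n. tensor_fun (f i) (g i) z | (n::nat) f g.
      \<forall>i<n. f i \<in> group_fun G \<and> g i \<in> group_fun G}"
    by (simp add: os_fn_space_def proj_tensor_def carrier_A)
  show "fn_carrier P \<subseteq> ?R"
    by (auto simp: eq tensor_fun_def group_fun_def)
  show "?R \<subseteq> fn_carrier P"
  proof
    fix u assume u: "u \<in> ?R"
    let ?N = "card (carrier G)"
    have "u = (\<lambda>z. \<Sum>i<?N. tensor_fun (point_fun (enum i)) (\<lambda>y. u (enum i, y)) z)"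
    proof
      fix z :: "'a \<times> 'a"
      obtain x y where z: "z = (x, y)" by (cases z)
      have "(\<Sum>i<?N. tensor_fun (point_fun (enum i)) (\<lambda>y. u (enum i, y)) z) =
          (\<Sum>r\<in>carrier G. tensor_fun (point_fun r) (\<lambda>y. u (r, y)) z)"
        by (rule sum_enum)
      also have "\<dots> = (\<Sum>r\<in>carrier G. if r = x then u (x, y) else 0)"
        by (intro sum.cong refl) (simp add: z tensor_fun_def point_fun_def)
      also have "\<dots> = u z" using u fin by (auto simp: z)
      finally show "u z = (\<Sum>i<?N. tensor_fun (point_fun (enum i)) (\<lambda>y. u (enum i, y)) z)" by simp
    qed
    moreover have "point_fun (enum i) \<in> group_fun G" "(\<lambda>y. u (enum i, y)) \<in> group_fun G" if "i < ?N" for i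
      using u enum_carrier[OF that] by (auto simp: group_fun_def point_fun_def)
    ultimately show "u \<in> fn_carrier P"
      unfolding eq mem_Collect_eq
      by (intro exI[of _ ?N] exI[of _ "\<lambda>i. point_fun (enum i)"] exI[of _ "\<lambda>i y. u (enum i, y)"]) blast
  qed
qed

text \<open>The infimum that defines the norm is taken over a nonempty set.\<close>

lemma factorization_exists:
  assumes u: "u \<in> fn_carrier P"
  shows "factorization_norms u \<noteq> {}"
proof -
  let ?N = "card (carrier G)"
  \<comment> \<open>Diagonal matrices \<open>v\<close> and \<open>w\<close> encode the expansion of \<open>u\<close> along its first variable, and
    \<open>\<alpha>\<close> and \<open>\<beta>\<close> select the index pairs with equal components.\<close>
  define v where "v = mat ?N ?N (\<lambda>(i, j). if i = j then point_fun (enum i) else (\<lambda>_. 0))"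
  define w where "w = mat ?N ?N (\<lambda>(i, j). if i = j then (\<lambda>y. u (enum i, y)) else (\<lambda>_. 0))"
  define \<alpha> where "\<alpha> = mat 1 (?N * ?N) (\<lambda>(_, a). if a div ?N = a mod ?N then 1 else 0 :: complex)"
  define \<beta> where "\<beta> = mat (?N * ?N) 1 (\<lambda>(a, _). if a div ?N = a mod ?N then 1 else 0 :: complex)"
  have c: "\<alpha> \<in> carrier_mat 1 (?N * ?N)" "\<beta> \<in> carrier_mat (?N * ?N) 1" by (auto simp: \<alpha>_def \<beta>_def)
  have vw: "v \<in> os_mats A ?N" "w \<in> os_mats A ?N"
    using u enum_carrier by (auto simp: os_mats_A v_def w_def carrier_P group_fun_def point_fun_def)
  have vwc: "map_mat (\<lambda>h. h x) v \<in> carrier_mat ?N ?N" "map_mat (\<lambda>h. h x) w \<in> carrier_mat ?N ?N" for x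
    by (auto simp: v_def w_def)
  have "u (x, y) = (\<alpha> * kron_with (*) (map_mat (\<lambda>h. h x) v) (map_mat (\<lambda>h. h y) w) * \<beta>) $$ (0, 0)" for x y
  proof -
    have "(\<alpha> * kron_with (*) (map_mat (\<lambda>h. h x) v) (map_mat (\<lambda>h. h y) w) * \<beta>) $$ (0, 0) =
        (\<Sum>j<?N. \<Sum>l<?N. \<Sum>i<?N. \<Sum>k<?N. if k = i then if i = j then if l = j then point_fun (enum j) x * u (enum j, y) else 0 else 0 else 0)"
      unfolding row_kron_column_index[OF c(1) vwc c(2)]
    proof (intro sum.cong refl)
      fix i j k l assume "j \<in> {..<?N}" "l \<in> {..<?N}" "i \<in> {..<?N}" "k \<in> {..<?N}"
      hence "i * ?N + k < ?N * ?N" "j * ?N + l < ?N * ?N" "i < ?N" "j < ?N" "k < ?N" "l < ?N"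
        by (auto intro: pair_index_less)
      thus "\<alpha> $$ (0, i * ?N + k) * map_mat (\<lambda>h. h x) v $$ (i, j) * map_mat (\<lambda>h. h y) w $$ (k, l) * \<beta> $$ (j * ?N + l, 0) =
          (if k = i then if i = j then if l = j then point_fun (enum j) x * u (enum j, y) else 0 else 0 else 0)"
        by (auto simp: \<alpha>_def \<beta>_def v_def w_def)
    qed
    also have "\<dots> = (\<Sum>j<?N. point_fun (enum j) x * u (enum j, y))" by simp
    also have "\<dots> = (\<Sum>r\<in>carrier G. point_fun r x * u (r, y))" by (rule sum_enum)
    also have "\<dots> = (\<Sum>r\<in>carrier G. if r = x then u (x, y) else 0)"
      by (intro sum.cong refl) (simp add: point_fun_def)
    also have "\<dots> = u (x, y)" using u fin by (auto simp: carrier_P)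
    finally show ?thesis by simp
  qed
  hence "factorizes u ?N ?N \<alpha> v w \<beta>" using c vw by (simp add: factorizes_def)
  thus ?thesis unfolding factorization_norms_def by blast
qed

lemma factorization_norms_nonneg: "r \<in> factorization_norms u \<Longrightarrow> r \<ge> 0"
  by (auto simp: factorization_norms_def factorizes_def os_mats_A intro!: mult_nonneg_nonneg norm_A_nonneg)

text \<open>Applied to a factorization, the tensor product of two functionals acts inside the Kronecker product,
  where each of the four factors is estimated separately.\<close>

lemma functional_le_factorization:
  assumes b: "cb_bound b C" "cb_bound b' C'" and f: "factorizes u p q \<alpha> v w \<beta>"
  shows "cmod (\<Sum>x\<in>carrier G. \<Sum>y\<in>carrier G. b x * b' y * u (x, y)) \<le>
    C * C' * (mat_opnorm \<alpha> * os_norm A v * os_norm A w * mat_opnorm \<beta>)"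
proof -
  have v: "v \<in> os_mats A p" and w: "w \<in> os_mats A q"
    and c: "\<alpha> \<in> carrier_mat 1 (p * q)" "\<beta> \<in> carrier_mat (p * q) 1"
    and u: "\<And>x y. u (x, y) = (\<alpha> * kron_with (*) (map_mat (\<lambda>h. h x) v) (map_mat (\<lambda>h. h y) w) * \<beta>) $$ (0, 0)"
    using f by (auto simp: factorizes_def)
  have vc: "v \<in> carrier_mat p p" and wc: "w \<in> carrier_mat q q" using v w by (auto simp: os_mats_A)
  let ?V = "map_mat (\<lambda>f. \<Sum>x\<in>carrier G. b x * f x) v"
  let ?W = "map_mat (\<lambda>f. \<Sum>x\<in>carrier G. b' x * f x) w"
  have VW: "?V \<in> carrier_mat p p" "?W \<in> carrier_mat q q" using vc wc by auto
  note K = kron_with_carrier[OF VW, of "(*)"]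
  have ev: "map_mat (\<lambda>h. h x) v \<in> carrier_mat p p" "map_mat (\<lambda>h. h x) w \<in> carrier_mat q q" for x
    using vc wc by auto
  have bnd: "a div q < p" "a mod q < q" if "a < p * q" for a
  proof -
    have "0 < q" using that by (cases q) auto
    thus "a div q < p" "a mod q < q" using that by (auto simp: less_mult_imp_div_less)
  qed
  let ?S = "{..<p * q} \<times> {..<p * q}"
  define \<gamma> where "\<gamma> = (\<lambda>(l, k). \<alpha> $$ (0, k) * \<beta> $$ (l, 0))"
  define vv where "vv = (\<lambda>(l, k). v $$ (k div q, l div q))"
  define ww where "ww = (\<lambda>(l, k). w $$ (k mod q, l mod q))"
  have "u (x, y) = (\<Sum>r\<in>?S. \<gamma> r * vv r x * ww r y)" for x y
    unfolding u row_mat_column_index[OF c(1) kron_with_carrier[OF ev] c(2)] sum.cartesian_product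
    using bnd vc wc
    by (intro sum.cong refl) (auto simp: kron_with_index[OF ev] \<gamma>_def vv_def ww_def)
  hence "(\<Sum>x\<in>carrier G. \<Sum>y\<in>carrier G. b x * b' y * u (x, y)) =
      (\<Sum>r\<in>?S. \<gamma> r * (\<Sum>x\<in>carrier G. b x * vv r x) * (\<Sum>y\<in>carrier G. b' y * ww r y))"
    by (simp add: sum_bilinear)
  also have "\<dots> = (\<alpha> * kron_with (*) ?V ?W * \<beta>) $$ (0, 0)"
    unfolding row_mat_column_index[OF c(1) K c(2)] sum.cartesian_product
    using bnd vc wc
    by (intro sum.cong refl) (auto simp: kron_with_index[OF VW] \<gamma>_def vv_def ww_def)
  finally have eq: "(\<Sum>x\<in>carrier G. \<Sum>y\<in>carrier G. b x * b' y * u (x, y)) =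
      (\<alpha> * kron_with (*) ?V ?W * \<beta>) $$ (0, 0)" .
  have R: "\<alpha> * kron_with (*) ?V ?W * \<beta> = mat 1 1 (\<lambda>_. (\<alpha> * kron_with (*) ?V ?W * \<beta>) $$ (0, 0))"
    using c by (intro eq_matI) auto
  have aK: "\<alpha> * kron_with (*) ?V ?W \<in> carrier_mat 1 (p * q)" using c(1) K by (rule mult_carrier_mat)
  have nn: "os_norm A v \<ge> 0" "os_norm A w \<ge> 0" using norm_A_nonneg vc wc by auto
  have V: "mat_opnorm ?V \<le> C * os_norm A v" and W: "mat_opnorm ?W \<le> C' * os_norm A w"
    and CC: "C \<ge> 0" "C' \<ge> 0"
    using b v w by (auto simp: cb_bound_def)
  have "cmod (\<Sum>x\<in>carrier G. \<Sum>y\<in>carrier G. b x * b' y * u (x, y)) = mat_opnorm (\<alpha> * kron_with (*) ?V ?W * \<beta>)"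
    by (subst R) (simp only: mat_opnorm_1x1 eq)
  also have "\<dots> \<le> mat_opnorm (\<alpha> * kron_with (*) ?V ?W) * mat_opnorm \<beta>" by (rule mat_opnorm_mult[OF aK c(2)])
  also have "\<dots> \<le> (mat_opnorm \<alpha> * mat_opnorm (kron_with (*) ?V ?W)) * mat_opnorm \<beta>"
    by (intro mult_right_mono mat_opnorm_mult[OF c(1) K]) simp
  also have "\<dots> \<le> (mat_opnorm \<alpha> * (mat_opnorm ?V * mat_opnorm ?W)) * mat_opnorm \<beta>"
    by (intro mult_right_mono mult_left_mono mat_opnorm_kron[OF VW]) simp_all
  also have "\<dots> \<le> (mat_opnorm \<alpha> * ((C * os_norm A v) * (C' * os_norm A w))) * mat_opnorm \<beta>"
    by (intro mult_right_mono mult_left_mono mult_mono V W) (use nn CC in auto)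
  finally show ?thesis by (simp add: mult_ac)
qed

lemma functional_le_norm_P:
  assumes b: "cb_bound b C" "cb_bound b' C'" and u: "u \<in> fn_carrier P"
  shows "cmod (\<Sum>x\<in>carrier G. \<Sum>y\<in>carrier G. b x * b' y * u (x, y)) \<le> C * C' * fn_norm P u"
proof -
  have CC: "C * C' \<ge> 0" using b by (auto simp: cb_bound_def)
  have le: "cmod (\<Sum>x\<in>carrier G. \<Sum>y\<in>carrier G. b x * b' y * u (x, y)) \<le> C * C' * r"
    if "r \<in> factorization_norms u" for r
    using that functional_le_factorization[OF b] by (auto simp: factorization_norms_def)
  show ?thesis
  proof (cases "C * C' = 0")
    case True
    obtain r where "r \<in> factorization_norms u" using factorization_exists[OF u] by blast
    from le[OF this] show ?thesis unfolding True by simp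
  next
    case False
    with CC have pos: "C * C' > 0" by (metis less_eq_real_def)
    have "cmod (\<Sum>x\<in>carrier G. \<Sum>y\<in>carrier G. b x * b' y * u (x, y)) / (C * C') \<le> Inf (factorization_norms u)"
    proof (rule cInf_greatest[OF factorization_exists[OF u]])
      fix r assume "r \<in> factorization_norms u"
      from le[OF this] pos
      show "cmod (\<Sum>x\<in>carrier G. \<Sum>y\<in>carrier G. b x * b' y * u (x, y)) / (C * C') \<le> r"
        by (simp add: pos_divide_le_eq mult.commute)
    qed
    thus ?thesis using pos by (simp add: norm_P pos_divide_le_eq mult.commute)
  qed
qed

lemma norm_P_nonneg: "u \<in> fn_carrier P \<Longrightarrow> fn_norm P u \<ge> 0"
  unfolding norm_P by (rule cInf_greatest[OF factorization_exists]) (auto intro: factorization_norms_nonneg)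

lemma norm_P_le:
  assumes "factorizes u p q \<alpha> v w \<beta>"
  shows "fn_norm P u \<le> mat_opnorm \<alpha> * os_norm A v * os_norm A w * mat_opnorm \<beta>"
  unfolding norm_P
proof (rule cInf_lower)
  show "mat_opnorm \<alpha> * os_norm A v * os_norm A w * mat_opnorm \<beta> \<in> factorization_norms u"
    unfolding factorization_norms_def using assms by blast
  show "bdd_below (factorization_norms u)"
    by (rule bdd_belowI[of _ 0]) (rule factorization_norms_nonneg)
qed

lemma fin_space_A: "fin_space (os_fn_space A) (carrier G)"
proof
  show "fn_carrier (os_fn_space A) = {u. \<forall>x. x \<notin> carrier G \<longrightarrow> u x = 0}"
    by (simp add: os_fn_space_def carrier_A group_fun_def)
  show "fn_norm (os_fn_space A) u \<ge> 0" for u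
    unfolding os_fn_space_def fn_space.simps by (rule norm_A_nonneg[of _ 1]) simp
  fix s assume s: "s \<in> carrier G"
  obtain C where C: "cb_bound (point_fun s) C" using cb_bound_point[OF s] .
  have "cmod (u s) \<le> C * fn_norm (os_fn_space A) u" if u: "u \<in> group_fun G" for u
  proof -
    have "mat 1 1 (\<lambda>_. u) \<in> os_mats A 1" using u by (simp add: os_mats_A)
    hence "mat_opnorm (map_mat (\<lambda>f. \<Sum>x\<in>carrier G. point_fun s x * f x) (mat 1 1 (\<lambda>_. u))) \<le> C * os_norm A (mat 1 1 (\<lambda>_. u))"
      using C unfolding cb_bound_def by blast
    moreover have "map_mat (\<lambda>f. \<Sum>x\<in>carrier G. point_fun s x * f x) (mat 1 1 (\<lambda>_. u)) = mat 1 1 (\<lambda>_. u s)"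
    proof -
      have "(\<Sum>x\<in>carrier G. point_fun s x * u x) = (\<Sum>x\<in>carrier G. if x = s then u s else 0)"
        by (intro sum.cong refl) (simp add: point_fun_def)
      also have "\<dots> = u s" using s fin by simp
      finally show ?thesis by (intro eq_matI) auto
    qed
    ultimately show ?thesis by (simp only: mat_opnorm_1x1 os_fn_space_def fn_space.simps)
  qed
  thus "\<exists>C. \<forall>u\<in>fn_carrier (os_fn_space A). cmod (u s) \<le> C * fn_norm (os_fn_space A) u"
    by (auto simp: os_fn_space_def carrier_A)
qed (rule fin)

lemma fin_space_P: "fin_space P (carrier G \<times> carrier G)"
proof
  show "finite (carrier G \<times> carrier G)" using fin by simp
  show "fn_carrier P = {u. \<forall>x. x \<notin> carrier G \<times> carrier G \<longrightarrow> u x = 0}" by (rule carrier_P)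
  show "fn_norm P u \<ge> 0" if "u \<in> fn_carrier P" for u using norm_P_nonneg[OF that] .
  fix z assume "z \<in> carrier G \<times> carrier G"
  then obtain s t where z: "z = (s, t)" and st: "s \<in> carrier G" "t \<in> carrier G" by auto
  obtain C where C: "cb_bound (point_fun s) C" using cb_bound_point[OF st(1)] .
  obtain C' where C': "cb_bound (point_fun t) C'" using cb_bound_point[OF st(2)] .
  have "cmod (u z) \<le> C * C' * fn_norm P u" if u: "u \<in> fn_carrier P" for u
  proof -
    have "(\<Sum>x\<in>carrier G. \<Sum>y\<in>carrier G. point_fun s x * point_fun t y * u (x, y)) =
        (\<Sum>x\<in>carrier G. \<Sum>y\<in>carrier G. if y = t then if x = s then u (s, t) else 0 else 0)"
      by (intro sum.cong refl) (simp add: point_fun_def)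
    also have "\<dots> = u z" using st fin by (simp add: z)
    finally show ?thesis using functional_le_norm_P[OF C C' u] by simp
  qed
  thus "\<exists>C. \<forall>u\<in>fn_carrier P. cmod (u z) \<le> C * fn_norm P u" by blast
qed

end

lemma sum_swap_pairs:
  "(\<Sum>a\<in>A. \<Sum>b\<in>B. \<Sum>c\<in>C. \<Sum>d\<in>D. f a b c d) = (\<Sum>c\<in>C. \<Sum>d\<in>D. \<Sum>b\<in>B. \<Sum>a\<in>A. f a b c d)"
proof -
  have "(\<Sum>a\<in>A. \<Sum>b\<in>B. \<Sum>c\<in>C. \<Sum>d\<in>D. f a b c d) = (\<Sum>a\<in>A. \<Sum>c\<in>C. \<Sum>b\<in>B. \<Sum>d\<in>D. f a b c d)"
    by (rule sum.cong[OF refl], rule sum.swap)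
  also have "\<dots> = (\<Sum>c\<in>C. \<Sum>a\<in>A. \<Sum>b\<in>B. \<Sum>d\<in>D. f a b c d)" by (rule sum.swap)
  also have "\<dots> = (\<Sum>c\<in>C. \<Sum>a\<in>A. \<Sum>d\<in>D. \<Sum>b\<in>B. f a b c d)"
    by (rule sum.cong[OF refl], rule sum.cong[OF refl], rule sum.swap)
  also have "\<dots> = (\<Sum>c\<in>C. \<Sum>d\<in>D. \<Sum>a\<in>A. \<Sum>b\<in>B. f a b c d)"
    by (rule sum.cong[OF refl], rule sum.swap)
  also have "\<dots> = (\<Sum>c\<in>C. \<Sum>d\<in>D. \<Sum>b\<in>B. \<Sum>a\<in>A. f a b c d)"
    by (rule sum.cong[OF refl], rule sum.cong[OF refl], rule sum.swap)
  finally show ?thesis .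
qed

context weighted_group
begin

section \<open>The norm of the diagonal\<close>

definition diag :: "'a \<times> 'a \<Rightarrow> complex" where
  "diag = (\<lambda>(x, y). if x = y \<and> x \<in> carrier G then 1 else 0)"

definition amen_const :: real where
  "amen_const = (\<Sum>\<pi>\<in>dual_group G. (real (class_deg G \<pi>))\<^sup>2 * symmetrization G \<omega> \<pi>) / card (carrier G)"

abbreviation \<Omega> where "\<Omega> \<equiv> symmetrization G \<omega>"

lemma symmetrization_pos: "\<pi> \<in> dual_group G \<Longrightarrow> \<Omega> \<pi> > 0"
  by (simp add: symmetrization_def weight_pos conj_class_in_dual)

lemma amen_const_pos: "amen_const > 0"
proof -
  have "dual_group G \<noteq> {}" using sum_deg_squares card_pos by auto
  hence "(\<Sum>\<pi>\<in>dual_group G. (real (class_deg G \<pi>))\<^sup>2 * \<Omega> \<pi>) > 0"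
    using finite_dual class_deg_pos symmetrization_pos by (intro sum_pos) auto
  thus ?thesis using card_pos by (simp add: amen_const_def)
qed

lemma diag_carrier: "diag \<in> fn_carrier P"
  by (auto simp: carrier_P diag_def)

text \<open>The tensor square of the functional that multiplies by the weight and evaluates at the identity.\<close>

definition unit_functional :: "('a \<times> 'a \<Rightarrow> complex) \<Rightarrow> complex" where
  "unit_functional u = (if u \<in> fn_carrier P then
     \<Sum>x\<in>carrier G. \<Sum>y\<in>carrier G. weight_fun (inv x) * weight_fun (inv y) * u (x, y) else 0)"

lemma unit_functional_linear: "fin_space.linear_functional P unit_functional"
proof -
  interpret P: fin_space P "carrier G \<times> carrier G" by (rule fin_space_P)
  show ?thesis
    unfolding P.linear_functional_def unit_functional_def
    by (auto simp: P.add_closed P.scale_closed sum.distrib sum_distrib_left algebra_simps)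
qed

lemma unit_functional_le: "u \<in> fn_carrier P \<Longrightarrow> cmod (unit_functional u) \<le> fn_norm P u"
  using functional_le_norm_P[OF cb_bound_weight cb_bound_weight] by (simp add: unit_functional_def)

text \<open>On the diagonal, the functional is the convolution of \<open>W\<^sub>\<omega>\<close> with its inverted copy at the identity.\<close>

lemma unit_functional_diag: "unit_functional diag = complex_of_real amen_const"
proof -
  have "unit_functional diag = (\<Sum>x\<in>carrier G. \<Sum>y\<in>carrier G.
      if y = x then weight_fun (inv x) * weight_fun (inv x) else 0)"
    using diag_carrier unfolding unit_functional_def by (auto simp: diag_def intro!: sum.cong)
  also have "\<dots> = (\<Sum>x\<in>carrier G. weight_fun (inv x) * weight_fun (inv x))"
    using fin by simp
  also have "\<dots> = (\<Sum>x\<in>carrier G. central_fun (\<lambda>\<pi>. weight (conj_class G \<pi>)) x * weight_fun (inv x \<otimes> \<one>))"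
    by (intro sum.cong refl) (simp add: central_fun_inv)
  also have "\<dots> = central_fun (\<lambda>\<pi>. weight (conj_class G \<pi>) * weight \<pi>) \<one>"
    by (rule central_fun_convolution) simp
  also have "\<dots> = central_fun (\<lambda>\<pi>. complex_of_real (\<Omega> \<pi>)) \<one>"
    by (rule central_fun_cong) (simp add: symmetrization_def)
  finally show ?thesis by (simp only: central_fun_one amen_const_def)
qed

text \<open>The coefficients \<open>q\<close> of the square root \<open>Q\<close>.\<close>

abbreviation root where
  "root \<equiv> \<lambda>\<pi>. complex_of_real (sqrt (\<Omega> \<pi> / card (carrier G)))"
abbreviation root_fun where "root_fun \<equiv> central_fun root"

lemma root_cnj:
  assumes "x \<in> carrier G" "y \<in> carrier G"
  shows "cnj (root_fun (inv x \<otimes> y)) = root_fun (inv y \<otimes> x)"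
  using assms by (simp add: central_fun_cnj inv_mult_group)

text \<open>For fixed \<open>x\<close> the sum is the convolution square of \<open>Q\<close> at the identity, which does not depend on \<open>x\<close>.\<close>

lemma root_l2_norm:
  "(\<Sum>x\<in>carrier G. \<Sum>y\<in>carrier G. (cmod (root_fun (inv x \<otimes> y)))\<^sup>2) = amen_const"
proof -
  have "complex_of_real (\<Sum>y\<in>carrier G. (cmod (root_fun (inv x \<otimes> y)))\<^sup>2) =
      complex_of_real (amen_const / card (carrier G))" if x: "x \<in> carrier G" for x
  proof -
    have "complex_of_real (\<Sum>y\<in>carrier G. (cmod (root_fun (inv x \<otimes> y)))\<^sup>2) =
        (\<Sum>y\<in>carrier G. root_fun (inv x \<otimes> y) * cnj (root_fun (inv x \<otimes> y)))"
      by (simp add: complex_norm_square del: of_real_power)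
    also have "\<dots> = (\<Sum>y\<in>carrier G. root_fun (inv x \<otimes> y) * root_fun (inv y \<otimes> x))"
      using x by (intro sum.cong refl) (simp only: root_cnj)
    also have "\<dots> = central_fun (\<lambda>\<pi>. root \<pi> * root \<pi>) (inv x \<otimes> x)"
      by (rule central_fun_convolution') (use x in auto)
    also have "\<dots> = central_fun (\<lambda>\<pi>. complex_of_real (\<Omega> \<pi> / card (carrier G))) \<one>"
    proof -
      have "root \<pi> * root \<pi> = complex_of_real (\<Omega> \<pi> / card (carrier G))" if "\<pi> \<in> dual_group G" for \<pi>
        unfolding of_real_mult[symmetric] using symmetrization_pos[OF that] by simp
      thus ?thesis using x by (simp only: l_inv) (rule central_fun_cong)
    qed
    also have "\<dots> = complex_of_real (amen_const / card (carrier G))"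
      by (simp only: central_fun_one amen_const_def times_divide_eq_right sum_divide_distrib[symmetric])
    finally show ?thesis .
  qed
  hence "(\<Sum>y\<in>carrier G. (cmod (root_fun (inv x \<otimes> y)))\<^sup>2) = amen_const / card (carrier G)"
    if "x \<in> carrier G" for x using that by (simp only: of_real_eq_iff)
  thus ?thesis using card_pos by simp
qed

lemma inv_mult_cancel_right: "x \<in> carrier G \<Longrightarrow> y \<in> carrier G \<Longrightarrow> x \<otimes> inv y = \<one> \<longleftrightarrow> x = y"
  by (metis inv_closed inv_equality inv_inv r_inv)

text \<open>The summands of \<open>\<alpha> (v \<otimes> v) \<beta>\<close> at the point \<open>(s, t)\<close>, with matrix indices replaced by group elements.\<close>

abbreviation diag_kernel :: "'a \<Rightarrow> 'a \<Rightarrow> 'a \<Rightarrow> 'a \<Rightarrow> 'a \<Rightarrow> 'a \<Rightarrow> complex" where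
  "diag_kernel s t x y x' y' \<equiv> cnj (root_fun (inv x \<otimes> y)) * inv_fun (inv (x \<otimes> inv x') \<otimes> s) *
     inv_fun (inv (y \<otimes> inv y') \<otimes> t) * root_fun (inv x' \<otimes> y')"

text \<open>The sums over \<open>x'\<close>, \<open>y'\<close> and \<open>y\<close> are convolutions of central functions. They produce a central function
  with the constant coefficient \<open>1 / |G|\<close>, evaluated at a conjugate of \<open>s t\<^sup>-\<^sup>1\<close>, and the sum over \<open>x\<close> cancels the
  factor.\<close>

lemma diag_identity:
  assumes s: "s \<in> carrier G" and t: "t \<in> carrier G"
  shows "(\<Sum>x'\<in>carrier G. \<Sum>y'\<in>carrier G. \<Sum>x\<in>carrier G. \<Sum>y\<in>carrier G. diag_kernel s t x y x' y') =
    diag (s, t)"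
proof -
  let ?N = "of_nat (card (carrier G)) :: complex"
  let ?i' = "\<lambda>\<pi>. inv_weight (conj_class G \<pi>)"
  \<comment> \<open>Centrality brings both factors into a form that is a convolution in \<open>x'\<close> and in \<open>y'\<close>.
    The inversion in the second factor turns \<open>\<omega>\<close> into its conjugate, which is where \<open>\<Omega>\<close> comes from.\<close>
  have w1: "inv_fun (inv (x \<otimes> inv x') \<otimes> s) = inv_fun ((inv x \<otimes> s) \<otimes> x')"
    if "x \<in> carrier G" "x' \<in> carrier G" for x x'
  proof -
    have "inv (x \<otimes> inv x') \<otimes> s = x' \<otimes> (inv x \<otimes> s)" using that s by (simp add: inv_mult_group m_assoc)
    thus ?thesis using central_fun_central[of x' "inv x \<otimes> s"] that s by simp
  qed
  have w2: "inv_fun (inv (y \<otimes> inv y') \<otimes> t) = central_fun ?i' (inv y' \<otimes> (inv t \<otimes> y))"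
    if y: "y \<in> carrier G" "y' \<in> carrier G" for y y'
  proof -
    have "inv (y \<otimes> inv y') \<otimes> t = y' \<otimes> (inv y \<otimes> t)" using that t by (simp add: inv_mult_group m_assoc)
    hence "inv_fun (inv (y \<otimes> inv y') \<otimes> t) = inv_fun ((inv y \<otimes> t) \<otimes> y')"
      using central_fun_central[of y' "inv y \<otimes> t"] y t by simp
    also have "(inv y \<otimes> t) \<otimes> y' = inv (inv y' \<otimes> (inv t \<otimes> y))"
      using y t by (simp add: inv_mult_group m_assoc)
    also have "inv_fun \<dots> = central_fun ?i' (inv y' \<otimes> (inv t \<otimes> y))"
      by (rule central_fun_inv) (use y t in auto)
    finally show ?thesis .
  qed
  let ?a = "\<lambda>\<pi>. inv_weight \<pi> * root \<pi> * ?i' \<pi>"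
  have inner: "(\<Sum>y'\<in>carrier G. \<Sum>x'\<in>carrier G. diag_kernel s t x y x' y') =
      central_fun ?a ((inv x \<otimes> s) \<otimes> (inv t \<otimes> y)) * root_fun (inv y \<otimes> x)"
    if x: "x \<in> carrier G" and y: "y \<in> carrier G" for x y
  proof -
    let ?U = "\<lambda>y'. central_fun ?i' (inv y' \<otimes> (inv t \<otimes> y))"
    have "(\<Sum>y'\<in>carrier G. \<Sum>x'\<in>carrier G. diag_kernel s t x y x' y') =
        (\<Sum>y'\<in>carrier G. root_fun (inv y \<otimes> x) *
          (\<Sum>x'\<in>carrier G. inv_fun ((inv x \<otimes> s) \<otimes> x') * root_fun (inv x' \<otimes> y')) * ?U y')"
      unfolding sum_distrib_left sum_distrib_right
      by (rule sum.cong[OF refl], rule sum.cong[OF refl]) (simp only: w1 w2 x y root_cnj mult_ac)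
    also have "\<dots> = (\<Sum>y'\<in>carrier G. root_fun (inv y \<otimes> x) *
        (central_fun (\<lambda>\<pi>. inv_weight \<pi> * root \<pi>) ((inv x \<otimes> s) \<otimes> y') * ?U y'))"
    proof (rule sum.cong[OF refl])
      fix y' assume y': "y' \<in> carrier G"
      have "(\<Sum>x'\<in>carrier G. inv_fun ((inv x \<otimes> s) \<otimes> x') * root_fun (inv x' \<otimes> y')) =
          central_fun (\<lambda>\<pi>. inv_weight \<pi> * root \<pi>) ((inv x \<otimes> s) \<otimes> y')"
        by (rule central_fun_convolution') (use x s y' in auto)
      thus "root_fun (inv y \<otimes> x) * (\<Sum>x'\<in>carrier G. inv_fun ((inv x \<otimes> s) \<otimes> x') * root_fun (inv x' \<otimes> y')) * ?U y' =
          root_fun (inv y \<otimes> x) * (central_fun (\<lambda>\<pi>. inv_weight \<pi> * root \<pi>) ((inv x \<otimes> s) \<otimes> y') * ?U y')"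
        by (simp only: mult.assoc)
    qed
    also have "\<dots> = root_fun (inv y \<otimes> x) * central_fun ?a ((inv x \<otimes> s) \<otimes> (inv t \<otimes> y))"
      unfolding sum_distrib_left[symmetric]
      by (rule arg_cong[where f = "(*) _"], rule central_fun_convolution') (use x s y t in auto)
    finally show ?thesis by (simp only: mult.commute)
  qed
  have "(\<Sum>x'\<in>carrier G. \<Sum>y'\<in>carrier G. \<Sum>x\<in>carrier G. \<Sum>y\<in>carrier G. diag_kernel s t x y x' y') =
      (\<Sum>x\<in>carrier G. \<Sum>y\<in>carrier G. \<Sum>y'\<in>carrier G. \<Sum>x'\<in>carrier G. diag_kernel s t x y x' y')"
    by (rule sum_swap_pairs)
  also have "\<dots> = (\<Sum>x\<in>carrier G. \<Sum>y\<in>carrier G.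
      central_fun ?a ((inv x \<otimes> s) \<otimes> (inv t \<otimes> y)) * root_fun (inv y \<otimes> x))"
    by (rule sum.cong[OF refl], rule sum.cong[OF refl], rule inner)
  also have "\<dots> = (\<Sum>x\<in>carrier G. (1 / ?N) * central_fun (\<lambda>_. 1) (s \<otimes> inv t))"
  proof (rule sum.cong[OF refl])
    fix x assume x: "x \<in> carrier G"
    have "(\<Sum>y\<in>carrier G. central_fun ?a ((inv x \<otimes> s) \<otimes> (inv t \<otimes> y)) *
        root_fun (inv y \<otimes> x)) =
      (\<Sum>y\<in>carrier G. central_fun ?a ((inv x \<otimes> (s \<otimes> inv t)) \<otimes> y) *
        root_fun (inv y \<otimes> x))"
      using x s t by (intro sum.cong refl) (simp add: m_assoc)
    also have "\<dots> = central_fun (\<lambda>\<pi>. ?a \<pi> * root \<pi>) ((inv x \<otimes> (s \<otimes> inv t)) \<otimes> x)"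
      by (rule central_fun_convolution') (use x s t in auto)
    also have "\<dots> = central_fun (\<lambda>\<pi>. ?a \<pi> * root \<pi>) (x \<otimes> (inv x \<otimes> (s \<otimes> inv t)))"
      by (rule central_fun_central) (use x s t in auto)
    also have "x \<otimes> (inv x \<otimes> (s \<otimes> inv t)) = s \<otimes> inv t" using x s t by (simp add: m_assoc[symmetric])
    also have "central_fun (\<lambda>\<pi>. ?a \<pi> * root \<pi>) (s \<otimes> inv t) =
        central_fun (\<lambda>_. 1 / ?N) (s \<otimes> inv t)"
    proof (rule central_fun_cong)
      fix \<pi> assume \<pi>: "\<pi> \<in> dual_group G"
      have p: "\<omega> \<pi> > 0" "\<omega> (conj_class G \<pi>) > 0" using \<pi> by (auto intro: weight_pos conj_class_in_dual)
      have "1 / \<omega> \<pi> * sqrt (\<Omega> \<pi> / card (carrier G)) * (1 / \<omega> (conj_class G \<pi>)) * sqrt (\<Omega> \<pi> / card (carrier G)) =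
          (sqrt (\<Omega> \<pi> / card (carrier G)))\<^sup>2 / (\<omega> \<pi> * \<omega> (conj_class G \<pi>))"
        by (simp add: power2_eq_square)
      also have "\<dots> = 1 / card (carrier G)"
        using p by (simp add: symmetrization_def)
      finally have "complex_of_real (1 / \<omega> \<pi> * sqrt (\<Omega> \<pi> / card (carrier G)) * (1 / \<omega> (conj_class G \<pi>)) * sqrt (\<Omega> \<pi> / card (carrier G))) =
          complex_of_real (1 / card (carrier G))" by (rule arg_cong)
      thus "inv_weight \<pi> * root \<pi> * ?i' \<pi> * root \<pi> = 1 / ?N"
        by (simp only: of_real_mult of_real_divide of_real_1 of_real_of_nat_eq)
    qed
    also have "\<dots> = (1 / ?N) * central_fun (\<lambda>_. 1) (s \<otimes> inv t)"
      by (simp add: central_fun_def sum_distrib_left sum_divide_distrib)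
    finally show "(\<Sum>y\<in>carrier G. central_fun ?a ((inv x \<otimes> s) \<otimes> (inv t \<otimes> y)) *
        root_fun (inv y \<otimes> x)) = (1 / ?N) * central_fun (\<lambda>_. 1) (s \<otimes> inv t)" .
  qed
  also have "\<dots> = central_fun (\<lambda>_. 1) (s \<otimes> inv t)" using card_pos by simp
  also have "\<dots> = diag (s, t)"
    using s t by (simp add: central_fun_1 diag_def inv_mult_cancel_right)
  finally show ?thesis .
qed

text \<open>The factorization through the regular representation is optimal: row and column have the norms
  \<open>1 / sqrt K\<close> and \<open>sqrt K\<close>, where \<open>K\<close> is the amenability constant.\<close>

lemma diag_norm_le: "fn_norm P (\<lambda>z. complex_of_real (1 / amen_const) * diag z) \<le> 1"
proof -
  let ?N = "card (carrier G)"
  let ?k = "complex_of_real (1 / amen_const)"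
  \<comment> \<open>After multiplication by the weight, \<open>v\<close> is the matrix of coefficients of the regular representation,
    so it has norm at most 1 and all of the norm sits in the row \<open>\<alpha>\<close> and the column \<open>\<beta>\<close>.
    Their entries are indexed by pairs \<open>(x, y)\<close> of group elements.\<close>
  define v where "v = map_mat (multiplier inv_weight) (regular_matrix enum)"
  define \<beta> where "\<beta> = mat (?N * ?N) 1 (\<lambda>(a, _). root_fun (inv (enum (a div ?N)) \<otimes> enum (a mod ?N)))"
  define \<alpha> where "\<alpha> = mat 1 (?N * ?N) (\<lambda>(_, a). ?k * cnj (root_fun (inv (enum (a div ?N)) \<otimes> enum (a mod ?N))))"
  have c: "\<alpha> \<in> carrier_mat 1 (?N * ?N)" "\<beta> \<in> carrier_mat (?N * ?N) 1" by (auto simp: \<alpha>_def \<beta>_def)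
  have vc: "v \<in> carrier_mat ?N ?N" by (simp add: v_def regular_matrix_def)
  have vA: "v \<in> os_mats A ?N"
    using vc by (auto simp: os_mats_A v_def regular_matrix_def multiplier_group_fun)
  have vx: "map_mat (\<lambda>h. h x) v \<in> carrier_mat ?N ?N" for x using vc by simp
  have ventry: "(v $$ (i, j)) s = inv_fun (inv (enum i \<otimes> inv (enum j)) \<otimes> s)"
    if "i < ?N" "j < ?N" "s \<in> carrier G" for i j s
  proof -
    have "(v $$ (i, j)) s = multiplier inv_weight (point_fun (enum i \<otimes> inv (enum j))) s"
      using that by (simp add: v_def regular_matrix_def)
    also have "\<dots> = (\<Sum>y\<in>carrier G. if y = enum i \<otimes> inv (enum j) then
        inv_fun (inv (enum i \<otimes> inv (enum j)) \<otimes> s) else 0)"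
      unfolding multiplier_apply[OF that(3)] by (intro sum.cong refl) (simp add: point_fun_def)
    finally show ?thesis using that enum_carrier fin by simp
  qed
  have "map_mat (multiplier weight) v = regular_matrix enum"
  proof (rule eq_matI)
    fix i j assume "i < dim_row (regular_matrix enum)" "j < dim_col (regular_matrix enum)"
    hence ij: "i < ?N" "j < ?N" by (auto simp: regular_matrix_def)
    have "point_fun (enum i \<otimes> inv (enum j)) \<in> group_fun G"
      using ij enum_carrier by (auto simp: group_fun_def point_fun_def)
    from multiplier_weight_cancel(1)[OF this] ij
    show "map_mat (multiplier weight) v $$ (i, j) = regular_matrix enum $$ (i, j)"
      by (simp add: v_def regular_matrix_def)
  qed (auto simp: v_def)
  hence vnorm: "os_norm A v \<le> 1" using regular_matrix_norm[OF enum_bij] by (simp add: norm_A)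
  have factor: "?k * diag (s, t) =
      (\<alpha> * kron_with (*) (map_mat (\<lambda>h. h s) v) (map_mat (\<lambda>h. h t) v) * \<beta>) $$ (0, 0)" for s t
  proof -
    let ?F = "\<lambda>i k j l. \<alpha> $$ (0, i * ?N + k) * map_mat (\<lambda>h. h s) v $$ (i, j) * map_mat (\<lambda>h. h t) v $$ (k, l) * \<beta> $$ (j * ?N + l, 0)"
    have idx: "(\<alpha> * kron_with (*) (map_mat (\<lambda>h. h s) v) (map_mat (\<lambda>h. h t) v) * \<beta>) $$ (0, 0) =
        (\<Sum>j<?N. \<Sum>l<?N. \<Sum>i<?N. \<Sum>k<?N. ?F i k j l)"
      by (rule row_kron_column_index[OF c(1) vx vx c(2)])
    show ?thesis
    proof (cases "s \<in> carrier G \<and> t \<in> carrier G")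
      case True
      let ?H = "diag_kernel s t"
      have F: "?F i k j l = ?k * ?H (enum i) (enum k) (enum j) (enum l)"
        if "i < ?N" "k < ?N" "j < ?N" "l < ?N" for i k j l
      proof -
        have "i * ?N + k < ?N * ?N" "j * ?N + l < ?N * ?N" using that by (auto intro: pair_index_less)
        hence "\<alpha> $$ (0, i * ?N + k) = ?k * cnj (root_fun (inv (enum i) \<otimes> enum k))"
          "\<beta> $$ (j * ?N + l, 0) = root_fun (inv (enum j) \<otimes> enum l)"
          using that by (auto simp: \<alpha>_def \<beta>_def)
        moreover have "map_mat (\<lambda>h. h s) v $$ (i, j) = inv_fun (inv (enum i \<otimes> inv (enum j)) \<otimes> s)"
          "map_mat (\<lambda>h. h t) v $$ (k, l) = inv_fun (inv (enum k \<otimes> inv (enum l)) \<otimes> t)"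
          using that vc True ventry by auto
        ultimately show ?thesis by (simp only: mult.assoc)
      qed
      have "(\<Sum>j<?N. \<Sum>l<?N. \<Sum>i<?N. \<Sum>k<?N. ?F i k j l) =
          (\<Sum>j<?N. \<Sum>l<?N. \<Sum>i<?N. \<Sum>k<?N. ?k * ?H (enum i) (enum k) (enum j) (enum l))"
        by (intro sum.cong refl F) auto
      also have "\<dots> = ?k * (\<Sum>j<?N. \<Sum>l<?N. \<Sum>i<?N. \<Sum>k<?N. ?H (enum i) (enum k) (enum j) (enum l))"
        by (simp only: sum_distrib_left)
      also have "(\<Sum>j<?N. \<Sum>l<?N. \<Sum>i<?N. \<Sum>k<?N. ?H (enum i) (enum k) (enum j) (enum l)) =
          (\<Sum>x'\<in>carrier G. \<Sum>l<?N. \<Sum>i<?N. \<Sum>k<?N. ?H (enum i) (enum k) x' (enum l))"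
        by (rule sum_enum)
      also have "\<dots> = (\<Sum>x'\<in>carrier G. \<Sum>y'\<in>carrier G. \<Sum>i<?N. \<Sum>k<?N. ?H (enum i) (enum k) x' y')"
        by (rule sum.cong[OF refl], rule sum_enum)
      also have "\<dots> = (\<Sum>x'\<in>carrier G. \<Sum>y'\<in>carrier G. \<Sum>x\<in>carrier G. \<Sum>k<?N. ?H x (enum k) x' y')"
        by (rule sum.cong[OF refl], rule sum.cong[OF refl], rule sum_enum)
      also have "\<dots> = (\<Sum>x'\<in>carrier G. \<Sum>y'\<in>carrier G. \<Sum>x\<in>carrier G. \<Sum>y\<in>carrier G. ?H x y x' y')"
        by (rule sum.cong[OF refl], rule sum.cong[OF refl], rule sum.cong[OF refl], rule sum_enum)
      also have "\<dots> = diag (s, t)" using True by (intro diag_identity) auto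
      finally show ?thesis unfolding idx by simp
    next
      case False
      have "(v $$ (i, j)) x = 0" if "x \<notin> carrier G" "i < ?N" "j < ?N" for i j x
        using vA that by (auto simp: os_mats_A group_fun_def)
      hence "(\<Sum>j<?N. \<Sum>l<?N. \<Sum>i<?N. \<Sum>k<?N. ?F i k j l) = 0"
        using False vc by (intro sum.neutral ballI) auto
      thus ?thesis unfolding idx using False by (auto simp: diag_def)
    qed
  qed
  have f: "factorizes (\<lambda>z. ?k * diag z) ?N ?N \<alpha> v v \<beta>"
    unfolding factorizes_def using c vA factor by blast
  have l2: "(\<Sum>a<?N * ?N. (cmod (root_fun (inv (enum (a div ?N)) \<otimes> enum (a mod ?N))))\<^sup>2) = amen_const"
  proof -
    have "(\<Sum>a<?N * ?N. (cmod (root_fun (inv (enum (a div ?N)) \<otimes> enum (a mod ?N))))\<^sup>2) =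
        (\<Sum>i<?N. \<Sum>k<?N. (cmod (root_fun (inv (enum i) \<otimes> enum k)))\<^sup>2)"
      by (rule sum_div_mod[where f = "\<lambda>i k. (cmod (root_fun (inv (enum i) \<otimes> enum k)))\<^sup>2"])
    also have "\<dots> = (\<Sum>x\<in>carrier G. \<Sum>k<?N. (cmod (root_fun (inv x \<otimes> enum k)))\<^sup>2)"
      by (rule sum_enum)
    also have "\<dots> = (\<Sum>x\<in>carrier G. \<Sum>y\<in>carrier G. (cmod (root_fun (inv x \<otimes> y)))\<^sup>2)"
      by (rule sum.cong[OF refl], rule sum_enum)
    finally show ?thesis by (simp only: root_l2_norm)
  qed
  have nb: "mat_opnorm \<beta> \<le> sqrt amen_const"
    using mat_opnorm_column[OF c(2)] l2 by (simp add: \<beta>_def)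
  have "(\<Sum>a<?N * ?N. (cmod (\<alpha> $$ (0, a)))\<^sup>2) =
      (\<Sum>a<?N * ?N. (1 / amen_const)\<^sup>2 * (cmod (root_fun (inv (enum (a div ?N)) \<otimes> enum (a mod ?N))))\<^sup>2)"
    using amen_const_pos by (intro sum.cong refl) (simp add: \<alpha>_def norm_mult norm_divide power_mult_distrib power_divide)
  also have "\<dots> = (1 / amen_const)\<^sup>2 * amen_const" by (simp only: sum_distrib_left[symmetric] l2)
  also have "\<dots> = 1 / amen_const" using amen_const_pos by (simp add: power2_eq_square)
  finally have na: "mat_opnorm \<alpha> \<le> sqrt (1 / amen_const)"
    using mat_opnorm_row[OF c(1)] by simp
  have v0: "os_norm A v \<ge> 0" by (rule norm_A_nonneg[OF vc])
  have "fn_norm P (\<lambda>z. ?k * diag z) \<le> mat_opnorm \<alpha> * os_norm A v * os_norm A v * mat_opnorm \<beta>"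
    by (rule norm_P_le[OF f])
  also have "\<dots> \<le> sqrt (1 / amen_const) * 1 * 1 * sqrt amen_const"
    by (intro mult_mono na vnorm nb) (use v0 amen_const_pos in auto)
  also have "\<dots> = 1" using amen_const_pos by (simp add: real_sqrt_divide)
  finally show ?thesis .
qed

section \<open>Virtual diagonals and the amenability constant\<close>

abbreviation AX where "AX \<equiv> os_fn_space A"

lemma carrier_AX: "fn_carrier AX = group_fun G"
  by (simp add: os_fn_space_def carrier_A)

lemma diag_virtual: "virtual_diagonal A (fn_embed P diag)"
proof -
  note emb = fin_space.embed_norm[OF fin_space_P diag_carrier amen_const_pos diag_norm_le
      unit_functional_linear unit_functional_le unit_functional_diag]
  define one where "one = (\<lambda>x. if x \<in> carrier G then 1 else 0 :: complex)"
  have one: "one \<in> fn_carrier AX" by (simp add: carrier_AX group_fun_def one_def)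
  have N: "fn_biadjoint P AX mult_map (fn_embed P diag) = fn_embed AX one"
  proof -
    have "fn_biadjoint P AX mult_map (fn_embed P diag) = fn_embed AX (mult_map diag)"
      by (rule biadjoint_embed[OF fin_space_P fin_space_A])
         (auto simp: mult_map_def carrier_P carrier_AX group_fun_def diag_def)
    moreover have "mult_map diag = one" by (auto simp: mult_map_def diag_def one_def)
    ultimately show ?thesis by simp
  qed
  have L: "fn_biadjoint P P (left_act a) (fn_embed P diag) = fn_embed P (left_act a diag)" for a
    by (rule biadjoint_embed[OF fin_space_P fin_space_P])
       (auto simp: left_act_def carrier_P diag_def distrib_left mult_ac)
  have R: "fn_biadjoint P P (right_act a) (fn_embed P diag) = fn_embed P (right_act a diag)" for a
    by (rule biadjoint_embed[OF fin_space_P fin_space_P])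
       (auto simp: right_act_def carrier_P diag_def distrib_right fun_eq_iff)
  have LR: "left_act a diag = right_act a diag" for a
    by (auto simp: left_act_def right_act_def diag_def)
  have unit: "fn_biadjoint AX AX (\<lambda>b x. a x * b x) (fn_embed AX one) = fn_embed AX a"
    if a: "a \<in> group_fun G" for a
  proof -
    have "fn_biadjoint AX AX (\<lambda>b x. a x * b x) (fn_embed AX one) = fn_embed AX (\<lambda>x. a x * one x)"
      by (rule biadjoint_embed[OF fin_space_A fin_space_A])
         (auto simp: carrier_AX group_fun_def one_def distrib_left mult_ac)
    moreover have "(\<lambda>x. a x * one x) = a" using a by (auto simp: group_fun_def one_def)
    ultimately show ?thesis by simp
  qed
  have comm: "(\<lambda>(b :: 'a \<Rightarrow> complex) x. b x * a x) = (\<lambda>b x. a x * b x)" for a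
    by (simp add: mult.commute)
  show ?thesis
    unfolding virtual_diagonal_def Let_def N L R LR comm carrier_A
    using emb(1) unit by blast
qed

lemma virtual_diagonal_unique:
  assumes M: "virtual_diagonal A M"
  shows "M = fn_embed P diag"
proof -
  interpret X: fin_space AX "carrier G" by (rule fin_space_A)
  interpret P: fin_space P "carrier G \<times> carrier G" by (rule fin_space_P)
  define N where "N = fn_biadjoint P AX mult_map M"
  have Mc: "M \<in> fn_carrier (fn_bidual P)"
    and LR: "\<And>a. a \<in> group_fun G \<Longrightarrow> fn_biadjoint P P (left_act a) M = fn_biadjoint P P (right_act a) M"
    and unit: "\<And>a. a \<in> group_fun G \<Longrightarrow> fn_biadjoint AX AX (\<lambda>b x. a x * b x) N = fn_embed AX a"
    using M by (auto simp: virtual_diagonal_def Let_def carrier_A N_def)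
  have scale: "M (\<lambda>u. c * F u) = c * M F" if "P.linear_functional F" for c F
    using Mc that unfolding fn_dual_def[of "fn_dual P"] by (simp add: P.dual_iff)
  have act: "left_act a u \<in> fn_carrier P" "right_act a u \<in> fn_carrier P" if "u \<in> fn_carrier P" for a u
    using that by (auto simp: carrier_P left_act_def right_act_def)
  \<comment> \<open>Off the diagonal, the two actions of the point mass at \<open>s\<close> multiply the evaluation at \<open>(s, t)\<close>
    by 1 and by 0. On the diagonal, the unit condition for the constant function 1 gives the value.\<close>
  have "M (P.evaluation (s, t)) = diag (s, t)" if st: "s \<in> carrier G" "t \<in> carrier G" for s t
  proof (cases "s = t")
    case False
    have a: "point_fun s \<in> group_fun G" using st by (auto simp: group_fun_def point_fun_def)
    have "fn_biadjoint P P (left_act (point_fun s)) M (P.evaluation (s, t)) =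
        M (fn_adjoint P (left_act (point_fun s)) (P.evaluation (s, t)))"
      by (simp add: fn_biadjoint_def fn_adjoint_def[of "fn_dual P"] P.dual_iff P.evaluation_linear)
    also have "fn_adjoint P (left_act (point_fun s)) (P.evaluation (s, t)) = P.evaluation (s, t)"
      by (rule ext) (simp add: fn_adjoint_def P.evaluation_def act, simp add: left_act_def point_fun_def)
    finally have l: "fn_biadjoint P P (left_act (point_fun s)) M (P.evaluation (s, t)) = M (P.evaluation (s, t))" .
    have "fn_biadjoint P P (right_act (point_fun s)) M (P.evaluation (s, t)) =
        M (fn_adjoint P (right_act (point_fun s)) (P.evaluation (s, t)))"
      by (simp add: fn_biadjoint_def fn_adjoint_def[of "fn_dual P"] P.dual_iff P.evaluation_linear)
    also have "fn_adjoint P (right_act (point_fun s)) (P.evaluation (s, t)) = (\<lambda>u. 0 * P.evaluation (s, t) u)"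
      using False
      by (intro ext) (simp add: fn_adjoint_def P.evaluation_def act, simp add: right_act_def point_fun_def)
    also have "M \<dots> = 0" by (subst scale[OF P.evaluation_linear]) simp
    finally show ?thesis using l LR[OF a] False by (simp add: diag_def)
  next
    case True
    define one where "one = (\<lambda>x. if x \<in> carrier G then 1 else 0 :: complex)"
    have one: "one \<in> group_fun G" by (simp add: group_fun_def one_def)
    have "fn_embed AX one (X.evaluation s) = 1"
      using one st by (simp add: fn_embed_def X.dual_iff X.evaluation_linear X.evaluation_def carrier_AX one_def)
    hence "1 = fn_biadjoint AX AX (\<lambda>b x. one x * b x) N (X.evaluation s)" using unit[OF one] by simp
    also have "\<dots> = N (fn_adjoint AX (\<lambda>b x. one x * b x) (X.evaluation s))"
      by (simp add: fn_biadjoint_def fn_adjoint_def[of "fn_dual AX"] X.dual_iff X.evaluation_linear)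
    also have "fn_adjoint AX (\<lambda>b x. one x * b x) (X.evaluation s) = X.evaluation s"
    proof
      fix u show "fn_adjoint AX (\<lambda>b x. one x * b x) (X.evaluation s) u = X.evaluation s u"
        using st by (simp add: fn_adjoint_def X.evaluation_def carrier_AX group_fun_def) (auto simp: one_def)
    qed
    also have "N (X.evaluation s) = M (fn_adjoint P mult_map (X.evaluation s))"
      by (simp add: N_def fn_biadjoint_def fn_adjoint_def[of "fn_dual AX"] X.dual_iff X.evaluation_linear)
    also have "fn_adjoint P mult_map (X.evaluation s) = P.evaluation (s, t)"
      using True
      by (intro ext) (simp add: fn_adjoint_def X.evaluation_def P.evaluation_def carrier_AX carrier_P
          group_fun_def mult_map_def, blast)
    finally show ?thesis using st True by (simp add: diag_def)
  qed
  thus ?thesis by (intro P.bidual_eq_embed[OF Mc diag_carrier]) auto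
qed

lemma operator_amenability:
  "operator_amenable A" "is_operator_amenability_constant A amen_const"
proof -
  note emb = fin_space.embed_norm[OF fin_space_P diag_carrier amen_const_pos diag_norm_le
      unit_functional_linear unit_functional_le unit_functional_diag]
  show "operator_amenable A" using diag_virtual by (auto simp: operator_amenable_def)
  show "is_operator_amenability_constant A amen_const"
    unfolding is_operator_amenability_constant_def K_operator_amenable_def
  proof (intro conjI allI impI)
    show "\<exists>M. virtual_diagonal A M \<and> fn_norm (fn_bidual P) M = amen_const"
      using diag_virtual emb(2) by blast
    fix K' assume "\<exists>M. virtual_diagonal A M \<and> fn_norm (fn_bidual P) M = K'"
    then obtain M where M: "virtual_diagonal A M" "fn_norm (fn_bidual P) M = K'" by blast
    show "amen_const \<le> K'"
      using M(2) emb(2) unfolding virtual_diagonal_unique[OF M(1)] by simp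
  qed
qed

end

theorem theorem3p7:
  fixes G :: "('a, 'm) monoid_scheme" and \<omega> :: "'a rep set \<Rightarrow> real"
  assumes "group G" and "finite (carrier G)"
    and "central_weight G \<omega>"
  shows "operator_amenable (weighted_fourier_algebra G \<omega>) \<and>
    is_operator_amenability_constant (weighted_fourier_algebra G \<omega>)
      ((\<Sum>\<pi>\<in>dual_group G. (real (class_deg G \<pi>))\<^sup>2 * symmetrization G \<omega> \<pi>) /
       (\<Sum>\<pi>\<in>dual_group G. (real (class_deg G \<pi>))\<^sup>2))"
proof -
  interpret group G by (rule assms(1))
  interpret weighted_group G \<omega>
  proof
    show "finite (carrier G)" by (rule assms(2))
    fix \<pi> assume "\<pi> \<in> dual_group G"
    thus "\<omega> \<pi> > 0" using assms(3) by (fastforce simp: central_weight_def)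
  qed
  show ?thesis
    using operator_amenability by (simp add: amen_const_def sum_deg_squares)
qed

end
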